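(* For any non-degenerate ellipsoid $\mathcal{E}\subset\mathbb{R}^d$ and any $k\in\{0,1,\dots,d\}$, $$\int_{A_{d,k}}|\mathcal{E}\cap E|^{d+1}\,\mu_{d,k}(dE)=\frac{\kappa_k^{d+1}}{\kappa_d^{k+1}}\,\frac{\kappa_{d(k+1)}}{\kappa_{k(d+1)}}\,|\mathcal{E}|^{k+1}.$$
   Context: $|\mathcal{E}|$ is the $d$-dimensional volume and $|\mathcal{E}\cap E|$ is the $k$-dimensional volume (for $k=0$ a point has volume $1$). For real $q\ge 0$, $\kappa_q:=\pi^{q/2}/\Gamma(q/2+1)$ (so $\kappa_0=1$). $A_{d,k}$ is the affine Grassmannian of $k$-dimensional affine subspaces of $\mathbb{R}^d$, equipped with the unique rigid motion invariant measure $\mu_{d,k}$ normalized by $\mu_{d,k}(\{E\in A_{d,k}: E\cap\mathbb{B}^d\neq\emptyset\})=\kappa_{d-k}$, where $\mathbb{B}^d$ is the unit ball of $\mathbb{R}^d$. *)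

theory Defs
  imports "HOL-Analysis.Analysis"
begin

definition affine_grassmannian :: "nat \<Rightarrow> (real ^ 'n) set set" where
  "affine_grassmannian k = {E. affine E \<and> aff_dim E = int k}"

(* The usual topology of the affine Grassmannian, as the trace of the Fell (hit-or-miss)
   topology on closed sets. *)
definition affine_grassmannian_topology :: "nat \<Rightarrow> (real ^ 'n) set topology" where
  "affine_grassmannian_topology k =
     topology_generated_by
       ({{E \<in> affine_grassmannian k. E \<inter> U \<noteq> {}} | U. open U} \<union>
        {{E \<in> affine_grassmannian k. E \<inter> C = {}} | C. compact C})"

definition affine_grassmannian_borel :: "nat \<Rightarrow> (real ^ 'n) set measure" where
  "affine_grassmannian_borel k =
     sigma (affine_grassmannian k) {W. openin (affine_grassmannian_topology k) W}"

lemma topspace_affine_grassmannian_topology: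
  "topspace (affine_grassmannian_topology k) = affine_grassmannian k"
proof -
  have "affine_grassmannian k = {E \<in> affine_grassmannian k. E \<inter> {} = {}}"
    by simp
  then show ?thesis
    unfolding affine_grassmannian_topology_def topology_generated_by_topspace
    using compact_empty by blast
qed

lemma space_affine_grassmannian_borel:
  "space (affine_grassmannian_borel k) = affine_grassmannian k"
  by (simp add: affine_grassmannian_borel_def space_measure_of_conv)

(* Only proper rigid motions are used; invariance under reflections is not required. *)
definition rigid_motion :: "(real ^ 'n \<Rightarrow> real ^ 'n) \<Rightarrow> bool" where
  "rigid_motion g \<longleftrightarrow> (\<exists>Q v. rotation_matrix Q \<and> g = (\<lambda>x. Q *v x + v))"

(* mu is the measure mu_{d,k}, where d = CARD('n); there is exactly one such measure for k <= d. *)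
definition is_affine_grassmannian_measure :: "nat \<Rightarrow> (real ^ 'n) set measure \<Rightarrow> bool" where
  "is_affine_grassmannian_measure k \<mu> \<longleftrightarrow>
     sets \<mu> = sets (affine_grassmannian_borel k) \<and>
     (\<forall>g. rigid_motion g \<longrightarrow>
        (\<forall>W \<in> sets \<mu>. emeasure \<mu> ((\<lambda>E. g ` E) ` W) = emeasure \<mu> W)) \<and>
     emeasure \<mu> {E \<in> affine_grassmannian k. E \<inter> cball 0 1 \<noteq> {}} =
       ennreal (unit_ball_vol (real CARD('n) - real k))"

definition orthonormal_frame :: "(real ^ 'n) set \<Rightarrow> real ^ 'n \<Rightarrow> (real ^ 'n) set \<Rightarrow> bool" where
  "orthonormal_frame E p B \<longleftrightarrow>
     pairwise orthogonal B \<and> (\<forall>b \<in> B. norm b = 1) \<and> E = (\<lambda>x. p + x) ` span B"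

lemma orthonormal_frame_exists:
  assumes "affine E" "E \<noteq> {}"
  shows "\<exists>p B. orthonormal_frame E p B"
proof -
  from assms obtain p where "p \<in> E" by blast
  with assms have "subspace ((\<lambda>x. - p + x) ` E)"
    using affine_diffs_subspace by blast
  then obtain B where B: "pairwise orthogonal B" "\<And>x. x \<in> B \<Longrightarrow> norm x = 1"
      "span B = (\<lambda>x. - p + x) ` E"
    using orthonormal_basis_subspace by metis
  have "E = (\<lambda>x. p + x) ` span B"
    by (simp add: B(3) image_image)
  with B show ?thesis
    unfolding orthonormal_frame_def by blast
qed

(* Lebesgue measure of dimension aff_dim E on the affine subspace E, transported from coordinates
   with respect to an orthonormal frame (the choice of the frame is immaterial).  If E is a point,
   then B = {} and the product measure over the empty index set has mass 1. *)
definition flat_lborel :: "(real ^ 'n) set \<Rightarrow> (real ^ 'n) measure" where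
  "flat_lborel E =
     (let (p, B) = (SOME (p, B). orthonormal_frame E p B)
      in distr (Pi\<^sub>M B (\<lambda>_. lborel)) borel (\<lambda>t. p + (\<Sum>b\<in>B. t b *\<^sub>R b)))"

definition nondegenerate_ellipsoid :: "(real ^ 'n) set \<Rightarrow> bool" where
  "nondegenerate_ellipsoid S \<longleftrightarrow>
     (\<exists>(A :: real ^ 'n ^ 'n) c. invertible A \<and> S = (\<lambda>x. A *v x + c) ` cball 0 1)"

end

theory Submission
  imports Defs "HOL-Probability.Distributions"
begin

text \<open>
  A flat is encoded by the orthogonal projection \<open>P\<close> onto its direction and by its point \<open>y\<close> closest
  to the origin. Translation invariance and Fubini alone disintegrate \<open>\<mu>\<close> as \<open>\<nu>(dP) dy\<close>, with \<open>y\<close>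
  running over the kernel of \<open>P\<close> and \<open>\<nu>\<close> a rotation invariant measure on projections, which the
  normalization of \<open>\<mu>\<close> forces to have mass 1. For \<open>\<E> = A B + c\<close> with the unit ball \<open>B\<close> and
  \<open>T = A\<^sup>-\<^sup>1\<close>, the substitution by \<open>T\<close> reduces the integral over the parallel flats of
  direction \<open>P\<close> to the one for \<open>B\<close>, at the cost of a factor \<open>|det A| s(P)\<^sup>-\<^sup>d\<close>, where \<open>s(P)\<close> is the
  factor by which \<open>T\<close> stretches volume on the range of \<open>P\<close>.

  It remains to see that the mean of \<open>s(P)\<^sup>-\<^sup>d\<close> is \<open>|det T|\<^sup>-\<^sup>k\<close>. Now \<open>s(P)\<^sup>2 = det (P G P + 1 - P)\<close> with
  \<open>G = T\<^sup>T T\<close>. Let \<open>G\<close> move along a segment ending in the identity. The derivative of the mean is found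
  by integrating by parts against the infinitesimal rotations, so no Haar measure, uniqueness theorem
  or Blaschke-Petkantschin formula is needed; it shows that the mean times \<open>(det G)\<^sup>k\<^sup>/\<^sup>2\<close> is constant.
\<close>

section \<open>Translation invariant measures and linear substitutions\<close>

text \<open>The exponent d + 1 is tied to the dimension at two points. One of the d + 1 factors of
  section volume is spent, by Fubini, on turning the integral over the kernel of P into one over the
  whole space, so that the linear substitution leaves s(P)^(-d). The integration by parts then uses
  the vector field that moves ranges by R = G^(-1) H, where H is the derivative of G. Its divergence
  and the derivative of s(P)^c along it both contain the term tr(R P), which depends on P; for c =
  -d these terms cancel. What remains is a linear differential equation for the mean, solved by
  det(G)^(-k/2).

  The obstacle to Fubini is that the kernel of P, over which y ranges, varies with the flat.
  Gaussian weights of mass 1 along the missing directions replace each integral over a subspace by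
  one over the whole space, with P as a mere parameter. The same weight, taken at y, turns \<mu>
  into the finite measure whose image under the map to P is \<nu>.\<close>

lemma cball_sets_borel [measurable, simp]: "cball x r \<in> sets borel"
  for x :: "'a::metric_space"
  by (rule borel_closed) simp

lemma emeasure_unit_cball_neq:
  "emeasure lborel (cball (0::'a::euclidean_space) 1) \<noteq> 0"
  "emeasure lborel (cball (0::'a) 1) \<noteq> \<infinity>"
  "emeasure lborel (cball (0::'a) 1) \<noteq> top"
  using less_imp_neq[OF unit_ball_vol_pos[of "real DIM('a)"]] by (auto simp: emeasure_cball)

lemma nn_integral_lborel_translate:
  fixes h :: "'a::euclidean_space \<Rightarrow> ennreal"
  assumes "h \<in> borel_measurable borel"
  shows "(\<integral>\<^sup>+x. h (x + t) \<partial>lborel) = (\<integral>\<^sup>+x. h x \<partial>lborel)"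
proof -
  have "(\<integral>\<^sup>+x. h x \<partial>lborel) = (\<integral>\<^sup>+x. h x \<partial>distr lborel borel ((+) t))"
    using lborel_affine[of 1 t] by (simp add: density_1)
  then show ?thesis
    using assms by (simp add: nn_integral_distr add.commute)
qed

lemma nn_integral_lborel_reflect:
  fixes h :: "'a::euclidean_space \<Rightarrow> ennreal"
  assumes "h \<in> borel_measurable borel"
  shows "(\<integral>\<^sup>+x. h (- x) \<partial>lborel) = (\<integral>\<^sup>+x. h x \<partial>lborel)"
proof -
  have "(\<integral>\<^sup>+x. h x \<partial>lborel) = (\<integral>\<^sup>+x. h x \<partial>distr lborel borel uminus)"
    using lborel_affine[of "-1::real" "0::'a"] by (simp add: density_1)
  then show ?thesis
    using assms by (simp add: nn_integral_distr)
qed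

text \<open>Integrate \<open>indicator B y * indicator A x\<close> over y with respect to
  \<open>M\<close> and over x with respect to Lebesgue measure, B being the unit ball. Shifting x by
  y and then y by -x exchanges the roles of the two measures, so M(B) vol(A) = vol(B) M(A).\<close>

lemma translation_invariant_measure_eq:
  fixes M :: "'a::euclidean_space measure"
  assumes sets: "sets M = sets borel"
    and inv: "\<And>v. distr M borel ((+) v) = M"
    and ball: "emeasure M (cball 0 1) = c * emeasure lborel (cball (0::'a) 1)"
    and c: "c < \<infinity>" and A: "A \<in> sets borel"
  shows "emeasure M A = c * emeasure lborel A"
proof -
  have [measurable_cong, simp]: "sets M = sets borel" by fact
  have spM: "space M = UNIV"
    using sets_eq_imp_space_eq[OF sets] by simp
  have m: "(+) v \<in> M \<rightarrow>\<^sub>M borel" for v :: 'a by simp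
  have trans: "(\<integral>\<^sup>+y. f (v + y) \<partial>M) = (\<integral>\<^sup>+y. f y \<partial>M)" if "f \<in> borel_measurable borel" for f :: "'a \<Rightarrow> ennreal" and v
    using that by (subst (2) inv[of v, symmetric]) (simp add: nn_integral_distr m)
  have fin: "emeasure lborel (cball (0::'a) 1) < \<infinity>"
    by (simp add: emeasure_cball)
  have cb: "emeasure M (cball v 1) = c * emeasure lborel (cball (0::'a) 1)" for v
  proof -
    have "emeasure M (cball v 1) = (\<integral>\<^sup>+y. indicator (cball v 1) y \<partial>M)" by simp
    also have "\<dots> = (\<integral>\<^sup>+y. indicator (cball v 1) (v + y) \<partial>M)"
      by (rule trans[symmetric]) measurable
    also have "\<dots> = (\<integral>\<^sup>+y. indicator (cball 0 1) y \<partial>M)"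
      by (intro nn_integral_cong) (auto simp: indicator_def dist_norm)
    finally show ?thesis using ball by simp
  qed
  \<comment> \<open>Fubini needs this: all unit balls have the same finite mass, and those centred
    in a countable dense set cover the space.\<close>
  interpret M: sigma_finite_measure M
  proof
    obtain D :: "'a set" where D: "countable D" "\<And>X. open X \<Longrightarrow> X \<noteq> {} \<Longrightarrow> \<exists>d\<in>D. d \<in> X"
      using countable_dense_setE by blast
    have "\<exists>d\<in>D. x \<in> cball d 1" for x
      using D(2)[of "ball x 1"] by (auto simp: dist_commute intro: less_imp_le)
    moreover have "emeasure M (cball d 1) \<noteq> \<infinity>" for d
      using c fin by (simp add: cb ennreal_mult_less_top less_top[symmetric] ennreal_mult_eq_top_iff)
    ultimately show "\<exists>A. countable A \<and> A \<subseteq> sets M \<and> \<Union> A = space M \<and> (\<forall>a\<in>A. emeasure M a \<noteq> \<infinity>)"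
      using D(1) by (intro exI[of _ "(\<lambda>d. cball d 1) ` D"]) (auto simp: spM)
  qed
  interpret pair_sigma_finite M "lborel :: 'a measure" ..
  let ?B = "cball (0::'a) 1"
  have [measurable]: "A \<in> sets borel" by fact
  have "emeasure M ?B * emeasure lborel A = (\<integral>\<^sup>+y. \<integral>\<^sup>+x. indicator ?B y * indicator A x \<partial>lborel \<partial>M)"
    by (simp add: nn_integral_cmult nn_integral_multc)
  also have "\<dots> = (\<integral>\<^sup>+y. \<integral>\<^sup>+x. indicator ?B y * indicator A (y + x) \<partial>lborel \<partial>M)"
  proof (rule nn_integral_cong)
    fix y :: 'a
    show "(\<integral>\<^sup>+x. indicator ?B y * indicator A x \<partial>lborel) = (\<integral>\<^sup>+x. indicator ?B y * indicator A (y + x) \<partial>lborel)"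
      using nn_integral_lborel_translate[of "\<lambda>x. indicator ?B y * indicator A x" y] by (simp add: add.commute)
  qed
  also have "\<dots> = (\<integral>\<^sup>+x. \<integral>\<^sup>+y. indicator ?B y * indicator A (y + x) \<partial>M \<partial>lborel)"
    by (rule Fubini'[symmetric]) simp
  also have "\<dots> = (\<integral>\<^sup>+x. \<integral>\<^sup>+y. indicator ?B (-x + y) * indicator A y \<partial>M \<partial>lborel)"
  proof (rule nn_integral_cong)
    fix x :: 'a
    show "(\<integral>\<^sup>+y. indicator ?B y * indicator A (y + x) \<partial>M) = (\<integral>\<^sup>+y. indicator ?B (-x + y) * indicator A y \<partial>M)"
      using trans[of "\<lambda>y. indicator ?B y * indicator A (y + x)" "-x"] by simp
  qed
  also have "\<dots> = (\<integral>\<^sup>+y. \<integral>\<^sup>+x. indicator ?B (-x + y) * indicator A y \<partial>lborel \<partial>M)"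
    by (rule Fubini') simp
  also have "\<dots> = (\<integral>\<^sup>+y. \<integral>\<^sup>+x. indicator ?B x * indicator A y \<partial>lborel \<partial>M)"
  proof (rule nn_integral_cong)
    fix y :: 'a
    show "(\<integral>\<^sup>+x. indicator ?B (-x + y) * indicator A y \<partial>lborel) = (\<integral>\<^sup>+x. indicator ?B x * indicator A y \<partial>lborel)"
      using nn_integral_lborel_reflect[of "\<lambda>x. indicator ?B (x + y) * indicator A y"]
        nn_integral_lborel_translate[of "\<lambda>x. indicator ?B x * indicator A y" y] by (simp add: add.commute)
  qed
  also have "\<dots> = emeasure lborel ?B * emeasure M A"
    by (simp add: nn_integral_cmult nn_integral_multc)
  finally have "emeasure lborel ?B * (c * emeasure lborel A) = emeasure lborel ?B * emeasure M A"
    by (simp add: ball mult_ac)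
  moreover note emeasure_unit_cball_neq(1)
  ultimately show ?thesis
    using fin by (auto simp: ennreal_mult_cancel_left)
qed

lemma translation_invariant_nn_integral_eq:
  fixes M :: "'a::euclidean_space measure"
  assumes sets: "sets M = sets borel"
    and inv: "\<And>v. distr M borel ((+) v) = M"
    and ball: "emeasure M (cball 0 1) = c * emeasure lborel (cball (0::'a) 1)"
    and c: "c < \<infinity>" and h: "h \<in> borel_measurable borel"
  shows "(\<integral>\<^sup>+x. h x \<partial>M) = c * (\<integral>\<^sup>+x. h x \<partial>lborel)"
proof -
  have "M = scale_measure c lborel"
  proof (rule measure_eqI)
    fix A assume "A \<in> sets M"
    then show "emeasure M A = emeasure (scale_measure c lborel) A"
      using translation_invariant_measure_eq[OF sets inv ball c] sets by simp
  qed (simp add: sets)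
  then show ?thesis
    using h by (simp add: nn_integral_scale_measure)
qed

lemma borel_measurable_matrix_vector_mult [measurable]:
  "(*v) (T::real^'n^'m) \<in> borel_measurable borel"
  by (intro borel_measurable_continuous_onI linear_continuous_on) auto

text \<open>\<open>T\<close> turns translation by T^(-1) v into translation by v, so the image of
  Lebesgue measure is translation invariant and hence a multiple of it. Positivity and finiteness of
  the multiple permit cancelling it later; its value comes from elementary matrices.\<close>

lemma nn_integral_lborel_linear_scale:
  fixes T :: "real^'n^'n"
  assumes "invertible T"
  shows "\<exists>c. 0 < c \<and> c < \<infinity> \<and>
    (\<forall>h\<in>borel_measurable borel. (\<integral>\<^sup>+x. h (T *v x) \<partial>lborel) = c * (\<integral>\<^sup>+x. h x \<partial>lborel))"
proof -
  let ?M = "distr lborel borel ((*v) T)"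
  obtain S where S: "S ** T = mat 1" "T ** S = mat 1"
    using assms by (auto simp: invertible_def)
  have ST: "S *v (T *v x) = x" "T *v (S *v x) = x" for x
    by (simp_all add: matrix_vector_mul_assoc S)
  have inv: "distr ?M borel ((+) v) = ?M" for v
  proof -
    have "distr ?M borel ((+) v) = distr lborel borel ((+) v \<circ> (*v) T)"
      by (simp add: distr_distr)
    also have "(+) v \<circ> (*v) T = (*v) T \<circ> (+) (S *v v)"
      by (auto simp: fun_eq_iff matrix_vector_right_distrib ST)
    also have "distr lborel borel ((*v) T \<circ> (+) (S *v v)) = distr (distr lborel borel ((+) (S *v v))) borel ((*v) T)"
      by (simp add: distr_distr)
    also have "distr lborel borel ((+) (S *v v)) = (lborel :: (real^'n) measure)"
      using lborel_affine[of 1 "S *v v"] by (simp add: density_1)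
    finally show ?thesis .
  qed
  let ?V = "(*v) T -` cball 0 1"
  have V: "?V = (*v) S ` cball 0 1"
    by (metis (no_types, lifting) ST bij_image_Collect_eq bij_vimage_eq_inv_image bijI' inv_equality)
  have "bounded ?V"
    unfolding V by (intro bounded_linear_image) auto
  then have f: "emeasure lborel ?V < \<infinity>"
    by (metis emeasure_bounded_finite infinity_ennreal_def)
  have "open ((*v) T -` ball 0 1)"
    by (intro open_vimage linear_continuous_on) auto
  moreover have "0 \<in> (*v) T -` ball 0 1" by simp
  ultimately obtain e where e: "e > 0" "ball 0 e \<subseteq> (*v) T -` ball 0 1"
    using open_contains_ball by blast
  then have "ball 0 e \<subseteq> ?V" by (auto intro: less_imp_le)
  moreover have "?V \<in> sets lborel"
    by (simp add: measurable_sets_borel[of "(*v) T" borel])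
  ultimately have "emeasure lborel (ball (0::real^'n) e) \<le> emeasure lborel ?V"
    by (intro emeasure_mono)
  moreover have "emeasure lborel (ball (0::real^'n) e) > 0"
    using e by (simp add: emeasure_ball)
  ultimately have p: "0 < emeasure lborel ?V" by (rule less_le_trans[rotated])
  let ?k = "emeasure lborel (cball (0::real^'n) 1)"
  have k: "?k \<noteq> 0" "?k \<noteq> \<infinity>"
    by (simp_all add: emeasure_unit_cball_neq)
  define c where "c = emeasure lborel ?V / ?k"
  have c: "0 < c" "c < \<infinity>"
    using p f k by (auto simp: c_def ennreal_zero_less_divide ennreal_divide_eq_top_iff less_top[symmetric])
  have "emeasure ?M (cball 0 1) = c * ?k"
    using k ennreal_mult_divide_eq[of ?k "emeasure lborel ?V"]
    by (simp add: c_def emeasure_distr ennreal_divide_times ennreal_times_divide mult.commute)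
  then have "(\<integral>\<^sup>+x. h x \<partial>?M) = c * (\<integral>\<^sup>+x. h x \<partial>lborel)" if "h \<in> borel_measurable borel" for h
    using inv c that by (intro translation_invariant_nn_integral_eq) auto
  then show ?thesis
    using c by (intro exI[of _ c]) (auto simp: nn_integral_distr)
qed

lemma ennreal_square_eq_self_imp_one:
  fixes c :: ennreal
  assumes "c * c = c" "0 < c" "c < \<infinity>"
  shows "c = 1"
  using ennreal_mult_cancel_left[of c c 1] assms by auto

text \<open>HOL-Analysis has this substitution rule only for index types of class wellorder.\<close>
lemma nn_integral_lborel_linear:
  fixes T :: "real^'n^'n"
  assumes "invertible T" and "h \<in> borel_measurable borel"
  shows "(\<integral>\<^sup>+x. h (T *v x) \<partial>lborel) = ennreal (1 / \<bar>det T\<bar>) * (\<integral>\<^sup>+x. h x \<partial>lborel)"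
proof -
  \<comment> \<open>\<open>?sc A c\<close> says that substituting A multiplies integrals by c. The
    factor is unique and multiplicative in A, so it need only be found for elementary
    matrices.\<close>
  let ?sc = "\<lambda>T c. \<forall>h\<in>borel_measurable borel. (\<integral>\<^sup>+x. h (T *v (x::real^'n)) \<partial>lborel) = c * (\<integral>\<^sup>+x. h x \<partial>lborel)"
  have sc_mult: "?sc (A ** B) (a * b)" if "?sc A a" "?sc B b" for A B :: "real^'n^'n" and a b
  proof
    fix h :: "real^'n \<Rightarrow> ennreal" assume h: "h \<in> borel_measurable borel"
    have "(\<integral>\<^sup>+x. h ((A ** B) *v x) \<partial>lborel) = (\<integral>\<^sup>+x. h (A *v (B *v x)) \<partial>lborel)"
      by (simp add: matrix_vector_mul_assoc)
    also have "\<dots> = b * (\<integral>\<^sup>+x. h (A *v x) \<partial>lborel)"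
      using h by (intro that(2)[rule_format]) simp
    also have "\<dots> = a * b * (\<integral>\<^sup>+x. h x \<partial>lborel)"
      using that(1) h by (simp add: mult_ac)
    finally show "(\<integral>\<^sup>+x. h ((A ** B) *v x) \<partial>lborel) = a * b * (\<integral>\<^sup>+x. h x \<partial>lborel)" .
  qed
  have sc_unique: "a = b" if "?sc A a" "?sc A b" for A :: "real^'n^'n" and a b
  proof -
    have "a * emeasure lborel (cball (0::real^'n) 1) = b * emeasure lborel (cball (0::real^'n) 1)"
      using that[THEN bspec, of "indicator (cball 0 1)"] by simp
    then show ?thesis
      using ennreal_mult_cancel_left[of "emeasure lborel (cball (0::real^'n) 1)" a b]
      by (simp add: emeasure_unit_cball_neq mult.commute)
  qed
  have sc_one: "?sc (mat 1) 1" by simp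
  have "invertible T \<longrightarrow> ?sc T (ennreal (1 / \<bar>det T\<bar>))"
  proof (induction T rule: induct_matrix_elementary_alt)
    case (1 A B)
    show ?case
    proof
      assume "invertible (A ** B)"
      then have i: "invertible A" "invertible B"
        by (auto simp: invertible_det_nz det_mul)
      have "?sc (A ** B) (ennreal (1 / \<bar>det A\<bar>) * ennreal (1 / \<bar>det B\<bar>))"
        using 1 i by (intro sc_mult) auto
      then show "?sc (A ** B) (ennreal (1 / \<bar>det (A ** B)\<bar>))"
        by (simp add: det_mul abs_mult ennreal_mult'[symmetric])
    qed
  next
    case (2 A i)
    then show ?case by (simp add: invertible_det_nz det_zero_row)
  next
    case (3 A)
    show ?case
    proof
      assume "invertible A"
      then have nz: "A $ i $ i \<noteq> 0" for i
        using 3 by (auto simp: invertible_det_nz det_diagonal)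
      \<comment> \<open>The diagonal entries, indexed by basis vectors instead of coordinates, which
        is the form that \<open>lborel_affine_euclidean\<close> takes.\<close>
      let ?c = "\<lambda>j::real^'n. j \<bullet> (A *v j)"
      have Aj: "A *v axis i 1 = axis i (A $ i $ i)" for i
        using 3 by (auto simp: vec_eq_iff matrix_vector_mult_def axis_def if_distrib cong: if_cong)
      have c: "?c (axis i 1) = A $ i $ i" for i
        by (subst Aj) (simp only: inner_axis_axis, simp)
      have Ax: "A *v x = 0 + (\<Sum>j\<in>Basis. (?c j * (x \<bullet> j)) *\<^sub>R j)" for x
      proof -
        have "(A *v x) = A *v (\<Sum>j\<in>Basis. (x \<bullet> j) *\<^sub>R j)"
          by (simp add: euclidean_representation)
        also have "\<dots> = (\<Sum>j\<in>Basis. (x \<bullet> j) *\<^sub>R (A *v j))"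
          by (simp add: linear_sum matrix_vector_mult_scaleR)
        also have "\<dots> = (\<Sum>j\<in>Basis. (?c j * (x \<bullet> j)) *\<^sub>R j)"
        proof (intro sum.cong refl)
          fix j :: "real^'n" assume "j \<in> Basis"
          then obtain i where j: "j = axis i 1" by (auto simp: Basis_vec_def)
          have "A *v j = ?c j *\<^sub>R j"
            unfolding j c unfolding Aj by (simp add: axis_def vec_eq_iff)
          then show "(x \<bullet> j) *\<^sub>R (A *v j) = (?c j * (x \<bullet> j)) *\<^sub>R j"
            by (metis mult.commute scaleR_scaleR)
        qed
        finally show ?thesis by simp
      qed
      have nzc: "?c j \<noteq> 0" if "j \<in> Basis" for j
        using that nz c by (auto simp: Basis_vec_def)
      have "(\<Prod>j\<in>Basis. \<bar>?c j\<bar>) = (\<Prod>i\<in>UNIV. \<bar>A $ i $ i\<bar>)"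
      proof -
        have B: "Basis = (\<lambda>i. axis i 1 :: real^'n) ` UNIV" by (auto simp: Basis_vec_def)
        have "inj (\<lambda>i. axis i 1 :: real^'n)" by (auto simp: inj_def axis_eq_axis)
        then show ?thesis unfolding B by (subst prod.reindex) (simp_all only: o_def c)
      qed
      also have "\<dots> = \<bar>det A\<bar>"
        using 3 by (simp add: det_diagonal abs_prod)
      finally have pr: "(\<Prod>j\<in>Basis. \<bar>?c j\<bar>) = \<bar>det A\<bar>" .
      have dens: "(lborel :: (real^'n) measure) = density (distr lborel borel ((*v) A)) (\<lambda>_. \<bar>det A\<bar>)"
        using lborel_affine_euclidean[of ?c 0, OF nzc] by (simp only: Ax[symmetric] pr)
      show "?sc A (ennreal (1 / \<bar>det A\<bar>))"
      proof
        fix h :: "real^'n \<Rightarrow> ennreal" assume h: "h \<in> borel_measurable borel"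
        have "(\<integral>\<^sup>+x. h x \<partial>lborel) = ennreal \<bar>det A\<bar> * (\<integral>\<^sup>+x. h (A *v x) \<partial>lborel)"
          using h by (subst dens) (simp add: nn_integral_density nn_integral_distr nn_integral_cmult)
        then have "ennreal (1 / \<bar>det A\<bar>) * (\<integral>\<^sup>+x. h x \<partial>lborel) =
            (ennreal (1 / \<bar>det A\<bar>) * ennreal \<bar>det A\<bar>) * (\<integral>\<^sup>+x. h (A *v x) \<partial>lborel)"
          by (simp add: mult.assoc)
        also have "ennreal (1 / \<bar>det A\<bar>) * ennreal \<bar>det A\<bar> = 1"
          using \<open>invertible A\<close> by (simp add: ennreal_mult'[symmetric] invertible_det_nz)
        finally show "(\<integral>\<^sup>+x. h (A *v x) \<partial>lborel) = ennreal (1 / \<bar>det A\<bar>) * (\<integral>\<^sup>+x. h x \<partial>lborel)"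
          by simp
      qed
    qed
  next
    case (4 m n)
    \<comment> \<open>A transposition is an involution, so its factor c satisfies c * c = 1.\<close>
    let ?S = "\<chi> i j. mat 1 $ i $ Transposition.transpose m n j :: real^'n^'n"
    let ?t = "Transposition.transpose m n"
    have "(?S ** ?S) $ i $ j = (mat 1 :: real^'n^'n) $ i $ j" for i j
    proof -
      have "(?S ** ?S) $ i $ j = (\<Sum>k\<in>UNIV. if k = ?t j then of_bool (i = ?t (?t j)) else 0)"
        unfolding matrix_matrix_mult_def mat_def vec_lambda_beta by (intro sum.cong) auto
      also have "\<dots> = (mat 1 :: real^'n^'n) $ i $ j"
        by (subst sum.delta) (auto simp: mat_def)
      finally show ?thesis .
    qed
    then have SS: "?S ** ?S = mat 1"
      by (simp add: vec_eq_iff)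
    then have i: "invertible ?S" by (auto simp: invertible_def)
    obtain c where c: "0 < c" "c < \<infinity>" "?sc ?S c"
      using nn_integral_lborel_linear_scale[OF i] by blast
    have "c * c = 1"
      using sc_unique[OF _ sc_one] sc_mult[OF c(3) c(3)] by (simp only: SS)
    then have "c = 1"
      using c(1,2) by (cases c rule: ennreal_cases)
        (auto simp: ennreal_mult'[symmetric] square_eq_1_iff simp flip: ennreal_1)
    moreover have "\<bar>det ?S\<bar> = 1"
      using arg_cong[OF SS, of det] by (auto simp: det_mul square_eq_1_iff)
    ultimately show ?case using c(3) by simp
  next
    case (5 m n)
    let ?S = "\<chi> i j. of_bool (i = m \<and> j = n \<or> i = j) :: real^'n^'n"
    let ?D = "\<lambda>a. \<chi> i j. if i = j then (if i = m then a else 1) else 0 :: real^'n^'n"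
    have neq: "m \<noteq> n" by fact
    have "?S = (\<chi> k. if k = m then row m (mat 1) + 1 *s row n (mat 1) else row k (mat 1))"
      using neq by (auto simp: vec_eq_iff row_def mat_def)
    then have det: "det ?S = 1"
      using det_row_operation[OF neq, of "mat 1 :: real^'n^'n" 1] by simp
    have ent: "(A ** ?D a) $ i $ j = A $ i $ j * (if j = m then a else 1)"
      "(?D a ** A) $ i $ j = (if i = m then a else 1) * A $ i $ j" for A a i j
      by (simp_all add: matrix_matrix_mult_def if_distrib[of "\<lambda>x. y * x" for y]
          if_distrib[of "\<lambda>x. x * y" for y] cong: if_cong)
    have DD: "?D 2 ** ?D (1/2) = mat 1"
      unfolding vec_eq_iff ent by (auto simp: mat_def)
    have DD': "?D (1/2) ** ?D 2 = mat 1"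
      unfolding vec_eq_iff ent by (auto simp: mat_def)
    have SS: "(?S ** ?S) $ i $ j = (if i = j then 1 else if i = m \<and> j = n then 2 else 0)" for i j
    proof -
      have "(?S ** ?S) $ i $ j = (\<Sum>k\<in>UNIV. of_bool (i = m \<and> k = n) * of_bool (k = m \<and> j = n \<or> k = j)
          + of_bool (i = k) * of_bool (k = m \<and> j = n \<or> k = j))"
        unfolding matrix_matrix_mult_def vec_lambda_beta using neq by (intro sum.cong) auto
      also have "\<dots> = of_bool (i = m) * of_bool (n = j) + of_bool (i = m \<and> j = n \<or> i = j)"
      proof -
        have "(\<Sum>k\<in>UNIV. of_bool (i = m \<and> k = n) * of_bool (k = m \<and> j = n \<or> k = j)) =
            (\<Sum>k\<in>UNIV. if k = n then of_bool (i = m) * of_bool (n = j) else (0::real))"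
          using neq by (intro sum.cong) auto
        moreover have "(\<Sum>k\<in>UNIV. of_bool (i = k) * of_bool (k = m \<and> j = n \<or> k = j)) =
            (\<Sum>k\<in>UNIV. if k = i then of_bool (i = m \<and> j = n \<or> i = j) else (0::real))"
          by (intro sum.cong) auto
        ultimately show ?thesis by (simp only: sum.distrib sum.delta) simp
      qed
      finally show ?thesis using neq by auto
    qed
    have DSD: "?D 2 ** ?S ** ?D (1/2) = ?S ** ?S"
      unfolding vec_eq_iff SS ent using neq by auto
    have iS: "invertible ?S" using det by (simp add: invertible_det_nz)
    have iD: "invertible (?D 2)" "invertible (?D (1/2))" using DD DD' by (auto simp: invertible_def)
    obtain c where c: "0 < c" "c < \<infinity>" "?sc ?S c"
      using nn_integral_lborel_linear_scale[OF iS] by blast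
    obtain a where a: "?sc (?D 2) a"
      using nn_integral_lborel_linear_scale[OF iD(1)] by blast
    obtain b where b: "?sc (?D (1/2)) b"
      using nn_integral_lborel_linear_scale[OF iD(2)] by blast
    have ab: "a * b = 1"
      by (rule sc_unique[OF _ sc_one]) (use sc_mult[OF a b] in \<open>simp only: DD\<close>)
    \<comment> \<open>A diagonal matrix conjugates the shear \<open>S\<close> into its square, so its factor is idempotent.\<close>
    have "a * c * b = c * c"
      by (rule sc_unique[OF sc_mult[OF sc_mult[OF a c(3)] b]]) (use sc_mult[OF c(3) c(3)] in \<open>simp only: DSD\<close>)
    moreover have "a * c * b = c" using ab by (metis mult.commute mult.assoc mult.right_neutral)
    ultimately have "c = 1"
      using c(1,2) by (intro ennreal_square_eq_self_imp_one) auto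
    then show ?case using c(3) det by simp
  qed
  then show ?thesis using assms by blast
qed

section \<open>Orthogonal projections and integration over flats\<close>

text \<open>The factor \<pi> in the exponent makes the total mass 1 in every dimension, so no
  constant appears when directions are split off.\<close>

definition gauss :: "'a::euclidean_space \<Rightarrow> real" where
  "gauss x = exp (- pi * (norm x)\<^sup>2)"

lemma gauss_pos [simp]: "gauss x > 0" and gauss_nonneg [simp]: "gauss x \<ge> 0"
  by (simp_all add: gauss_def)

lemma gauss_minus: "gauss (- x) = gauss x"
  by (simp add: gauss_def)

lemma gauss_add_orthogonal: "x \<bullet> y = 0 \<Longrightarrow> gauss (x + y) = gauss x * gauss y"
  by (simp add: gauss_def norm_add_Pythagorean orthogonal_def distrib_left flip: exp_add)

lemma borel_measurable_gauss [measurable]: "gauss \<in> borel_measurable borel"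
  unfolding gauss_def by measurable

lemma nn_integral_gauss_real: "(\<integral>\<^sup>+t. ennreal (exp (- pi * t\<^sup>2)) \<partial>lborel) = 1"
proof -
  have "exp (- pi * t\<^sup>2) = normal_density 0 (sqrt (1 / (2 * pi))) t" for t
    by (simp add: normal_density_def)
  then show ?thesis
    using prob_space.emeasure_space_1[OF prob_space_normal_density[of "sqrt (1 / (2 * pi))" 0]]
    by (simp add: emeasure_density)
qed

section \<open>Orthonormal frames and Lebesgue measure in frame coordinates\<close>

definition orthonormal :: "'a::euclidean_space set \<Rightarrow> bool" where
  "orthonormal A \<longleftrightarrow> pairwise orthogonal A \<and> (\<forall>a\<in>A. norm a = 1)"

lemma orthonormal_finite: "orthonormal A \<Longrightarrow> finite A"
  by (simp add: orthonormal_def pairwise_orthogonal_imp_finite)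

lemma orthonormal_subset: "orthonormal A \<Longrightarrow> B \<subseteq> A \<Longrightarrow> orthonormal B"
  by (meson orthonormal_def pairwise_subset subsetD)

lemma orthonormal_inner:
  "orthonormal A \<Longrightarrow> a \<in> A \<Longrightarrow> b \<in> A \<Longrightarrow> a \<bullet> b = (if a = b then 1 else 0)"
  by (auto simp: orthonormal_def pairwise_def orthogonal_def norm_eq_1)

lemma orthonormal_inner_sum:
  assumes "orthonormal A" "a \<in> A"
  shows "(\<Sum>b\<in>A. t b *\<^sub>R b) \<bullet> a = t a"
proof -
  have "(\<Sum>b\<in>A. t b *\<^sub>R b) \<bullet> a = (\<Sum>b\<in>A. if b = a then t b else 0)"
    using assms by (auto simp: inner_sum_left orthonormal_inner intro!: sum.cong)
  then show ?thesis using assms by (simp add: orthonormal_finite)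
qed

lemma orthonormal_norm_sum:
  assumes "orthonormal A"
  shows "(norm (\<Sum>b\<in>A. t b *\<^sub>R b))\<^sup>2 = (\<Sum>b\<in>A. (t b)\<^sup>2)"
proof -
  have "(norm (\<Sum>b\<in>A. t b *\<^sub>R b))\<^sup>2 = (\<Sum>b\<in>A. (\<Sum>b\<in>A. t b *\<^sub>R b) \<bullet> (t b *\<^sub>R b))"
    by (simp only: power2_norm_eq_inner inner_sum_right)
  also have "\<dots> = (\<Sum>b\<in>A. (t b)\<^sup>2)"
    using assms by (intro sum.cong) (simp_all add: orthonormal_inner_sum power2_eq_square)
  finally show ?thesis .
qed

lemma orthonormal_expand:
  assumes "orthonormal A" "x \<in> span A"
  shows "(\<Sum>a\<in>A. (x \<bullet> a) *\<^sub>R a) = x"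
  using assms by (intro orthonormal_basis_expand) (auto simp: orthonormal_def pairwise_orthogonal_imp_finite)

lemma orthonormal_extend:
  fixes A :: "'a::euclidean_space set"
  assumes A: "orthonormal A"
  obtains B where "A \<inter> B = {}" "orthonormal (A \<union> B)" "span (A \<union> B) = UNIV"
proof -
  define W where "W = {x. \<forall>a\<in>A. x \<bullet> a = 0}"
  have "subspace W" by (auto simp: W_def subspace_def inner_left_distrib)
  then obtain B where B: "B \<subseteq> W" "pairwise orthogonal B" "\<And>x. x \<in> B \<Longrightarrow> norm x = 1" "span B = W"
    by (metis orthonormal_basis_subspace)
  have "A \<inter> B = {}"
  proof -
    have False if "x \<in> A" "x \<in> B" for x
    proof -
      have "x \<bullet> x = 0" using that B(1) unfolding W_def by blast
      then show False using B(3)[OF that(2)] by simp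
    qed
    then show ?thesis by auto
  qed
  moreover have "orthonormal (A \<union> B)"
    unfolding orthonormal_def pairwise_def
  proof (intro conjI ballI impI)
    fix x y assume xy: "x \<in> A \<union> B" "y \<in> A \<union> B" "x \<noteq> y"
    have "b \<bullet> a = 0" if "a \<in> A" "b \<in> B" for a b using B(1) that unfolding W_def by blast
    then show "orthogonal x y"
      using xy A B(2) by (auto simp: orthonormal_def pairwise_def orthogonal_def) (metis inner_commute)+
  qed (use A B(3) in \<open>auto simp: orthonormal_def\<close>)
  moreover have "x \<in> span (A \<union> B)" for x
  proof -
    let ?y = "\<Sum>a\<in>A. (x \<bullet> a) *\<^sub>R a"
    have "x - ?y \<in> W" using A by (auto simp: W_def inner_diff_left orthonormal_inner_sum)
    then have "x - ?y \<in> span (A \<union> B)"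
      using B(4) by (metis span_mono sup_ge2 subsetD)
    moreover have "?y \<in> span (A \<union> B)"
      by (intro span_sum span_scale span_base) auto
    ultimately show ?thesis by (metis diff_add_cancel span_add)
  qed
  ultimately show ?thesis using that by blast
qed

lemma measurable_frame_sum [measurable]:
  fixes A :: "'a::euclidean_space set"
  shows "(\<lambda>t. \<Sum>a\<in>A. t a *\<^sub>R a) \<in> (\<Pi>\<^sub>M a\<in>A. lborel) \<rightarrow>\<^sub>M borel"
  by (intro borel_measurable_sum borel_measurable_scaleR measurable_component_singleton[THEN measurable_compose]) auto

interpretation lborel_prod: product_sigma_finite "\<lambda>_::'i. lborel :: real measure"
  by standard

text \<open>Tested on boxes, where it reduces to translation invariance in each coordinate.\<close>

lemma distr_PiM_lborel_translate:
  fixes v :: "'i \<Rightarrow> real"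
  assumes "finite A"
  shows "distr (Pi\<^sub>M A (\<lambda>_. lborel)) (Pi\<^sub>M A (\<lambda>_. lborel)) (\<lambda>t. \<lambda>a\<in>A. v a + t a) = Pi\<^sub>M A (\<lambda>_. lborel)"
proof (rule lborel_prod.PiM_eqI)
  interpret finite_product_sigma_finite "\<lambda>_. lborel :: real measure" A
    by standard fact
  let ?s = "\<lambda>t. \<lambda>a\<in>A. v a + t a"
  have m: "?s \<in> Pi\<^sub>M A (\<lambda>_. lborel) \<rightarrow>\<^sub>M Pi\<^sub>M A (\<lambda>_. lborel)"
    by measurable
  fix S :: "'i \<Rightarrow> real set" assume S: "\<And>i. i \<in> A \<Longrightarrow> S i \<in> sets lborel"
  have "emeasure (distr (Pi\<^sub>M A (\<lambda>_. lborel)) (Pi\<^sub>M A (\<lambda>_. lborel)) ?s) (Pi\<^sub>E A S) =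
      emeasure (Pi\<^sub>M A (\<lambda>_. lborel)) (?s -` Pi\<^sub>E A S \<inter> space (Pi\<^sub>M A (\<lambda>_. lborel)))"
    using S assms by (intro emeasure_distr m) (auto intro!: sets_PiM_I_finite)
  also have "?s -` Pi\<^sub>E A S \<inter> space (Pi\<^sub>M A (\<lambda>_. lborel)) = Pi\<^sub>E A (\<lambda>a. (+) (v a) -` S a)"
    by (auto simp: space_PiM PiE_iff)
  also have "emeasure (Pi\<^sub>M A (\<lambda>_. lborel)) \<dots> = (\<Prod>a\<in>A. emeasure lborel ((+) (v a) -` S a))"
    using S by (intro measure_times) (simp add: measurable_sets_borel[of "(+) (v _)" borel])
  also have "\<dots> = (\<Prod>a\<in>A. emeasure lborel (S a))"
  proof (rule prod.cong)
    fix a assume "a \<in> A"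
    then have [measurable]: "S a \<in> sets borel" using S by auto
    have "(\<integral>\<^sup>+x. indicator (S a) (x + v a) \<partial>lborel) = (\<integral>\<^sup>+x. indicator ((+) (v a) -` S a) x \<partial>lborel)"
      by (intro nn_integral_cong) (auto simp: add.commute split: split_indicator)
    also have "\<dots> = emeasure lborel ((+) (v a) -` S a)"
      by (intro nn_integral_indicator) (simp add: measurable_sets_borel[of "(+) (v a)" borel])
    finally have "emeasure lborel ((+) (v a) -` S a) = (\<integral>\<^sup>+x. indicator (S a) (x + v a) \<partial>lborel)"
      by (rule sym)
    then show "emeasure lborel ((+) (v a) -` S a) = emeasure lborel (S a)"
      by (simp add: nn_integral_lborel_translate)
  qed simp
  finally show "emeasure (distr (Pi\<^sub>M A (\<lambda>_. lborel)) (Pi\<^sub>M A (\<lambda>_. lborel)) ?s) (Pi\<^sub>E A S) =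
      (\<Prod>a\<in>A. emeasure lborel (S a))" .
qed (use assms in auto)

text \<open>In orthonormal coordinates a translation acts coordinatewise, and the unit ball becomes
  the coordinate ball, whose volume depends only on the dimension. So the image of the product
  measure is translation invariant with the right mass on the unit ball, and uniqueness applies with
  constant 1.\<close>

lemma nn_integral_lborel_frame:
  fixes C :: "'a::euclidean_space set"
  assumes C: "orthonormal C" "span C = UNIV" and h: "h \<in> borel_measurable borel"
  shows "(\<integral>\<^sup>+x. h x \<partial>lborel) = (\<integral>\<^sup>+t. h (\<Sum>c\<in>C. t c *\<^sub>R c) \<partial>Pi\<^sub>M C (\<lambda>_. lborel))"
proof -
  let ?P = "Pi\<^sub>M C (\<lambda>_. lborel) :: ('a \<Rightarrow> real) measure"
  let ?f = "\<lambda>t. \<Sum>c\<in>C. t c *\<^sub>R c"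
  let ?M = "distr ?P borel ?f"
  have fC: "finite C" using C(1) by (rule orthonormal_finite)
  have cC: "card C = DIM('a)"
  proof -
    have "independent C"
      using C(1) by (intro pairwise_orthogonal_independent) (auto simp: orthonormal_def)
    then show ?thesis using C(2) by (metis dim_UNIV dim_span_eq_card_independent)
  qed
  have inv: "distr ?M borel ((+) v) = ?M" for v
  proof -
    let ?s = "\<lambda>t. \<lambda>c\<in>C. v \<bullet> c + t c"
    have "distr ?M borel ((+) v) = distr ?P borel ((+) v \<circ> ?f)"
      by (subst distr_distr) auto
    also have "\<dots> = distr ?P borel (?f \<circ> ?s)"
      using C by (intro distr_cong) (auto simp: scaleR_left_distrib sum.distrib orthonormal_expand)
    also have "\<dots> = distr (distr ?P ?P ?s) borel ?f"
      by (subst distr_distr) auto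
    also have "\<dots> = ?M" by (simp only: distr_PiM_lborel_translate[OF fC])
    finally show ?thesis .
  qed
  have "emeasure ?M (cball 0 1) = emeasure ?P ({t. sqrt (\<Sum>c\<in>C. (t c)\<^sup>2) \<le> 1} \<inter> space ?P)"
  proof -
    have "norm (?f t) = sqrt (\<Sum>c\<in>C. (t c)\<^sup>2)" for t
      using orthonormal_norm_sum[OF C(1), of t] by (metis norm_ge_zero real_sqrt_unique)
    then have "?f -` cball 0 1 \<inter> space ?P = {t. sqrt (\<Sum>c\<in>C. (t c)\<^sup>2) \<le> 1} \<inter> space ?P"
      by auto
    then show ?thesis by (subst emeasure_distr) auto
  qed
  also have "\<dots> = emeasure lborel (cball (0::'a) 1)"
    using emeasure_cball_aux[OF fC, of 1] cC by (simp add: emeasure_cball)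
  finally have "(\<integral>\<^sup>+x. h x \<partial>?M) = 1 * (\<integral>\<^sup>+x. h x \<partial>lborel)"
    using inv h by (intro translation_invariant_nn_integral_eq) auto
  then show ?thesis using h by (simp add: nn_integral_distr)
qed

section \<open>Orthogonal projections and the Gaussian form of integrals over their ranges\<close>

definition orth_projection :: "real^'n^'n \<Rightarrow> bool" where
  "orth_projection P \<longleftrightarrow> transpose P = P \<and> P ** P = P"

lemma orth_projection_idem: "orth_projection P \<Longrightarrow> P *v (P *v x) = P *v x"
  by (simp add: orth_projection_def matrix_vector_mul_assoc)

lemma orth_projection_inner: "orth_projection P \<Longrightarrow> (P *v x) \<bullet> y = x \<bullet> (P *v y)"
  by (metis dot_lmul_matrix orth_projection_def transpose_matrix_vector)

lemma orth_projection_inner_compl: "orth_projection P \<Longrightarrow> (P *v x) \<bullet> (y - P *v y) = 0"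
  by (simp add: orth_projection_inner orth_projection_idem matrix_vector_mult_diff_distrib)

lemma orth_projection_compl:
  assumes "orth_projection P"
  shows "orth_projection (mat 1 - P)"
proof -
  have "(mat 1 - P) *v ((mat 1 - P) *v x) = (mat 1 - P) *v x" for x
    using assms by (simp add: matrix_vector_mult_diff_rdistrib matrix_vector_mult_diff_distrib orth_projection_idem)
  then have "(mat 1 - P) ** (mat 1 - P) = mat 1 - P"
    by (simp add: matrix_eq flip: matrix_vector_mul_assoc)
  moreover have "transpose (mat 1 - P) = mat 1 - P"
    using assms by (auto simp: orth_projection_def transpose_def vec_eq_iff mat_def)
  ultimately show ?thesis by (simp add: orth_projection_def)
qed

definition frame_projection :: "(real^'n) set \<Rightarrow> real^'n^'n" where
  "frame_projection A = (\<chi> i j. \<Sum>a\<in>A. a $ i * a $ j)"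

lemma frame_projection_mult: "frame_projection A *v x = (\<Sum>a\<in>A. (x \<bullet> a) *\<^sub>R a)"
  by (simp add: vec_eq_iff frame_projection_def matrix_vector_mult_def inner_vec_def
      sum_distrib_right sum_distrib_left sum_component)
    (subst sum.swap, simp add: mult_ac)

lemma orth_projection_frame_projection:
  assumes "orthonormal A"
  shows "orth_projection (frame_projection A)"
proof -
  have "frame_projection A *v (frame_projection A *v x) = frame_projection A *v x" for x
    using assms by (simp add: frame_projection_mult orthonormal_inner_sum)
  then have "frame_projection A ** frame_projection A = frame_projection A"
    by (simp add: matrix_eq flip: matrix_vector_mul_assoc)
  moreover have "transpose (frame_projection A) = frame_projection A"
    by (simp add: transpose_def frame_projection_def vec_eq_iff mult.commute)
  ultimately show ?thesis by (simp add: orth_projection_def)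
qed

lemma trace_frame_projection:
  assumes "orthonormal A"
  shows "trace (frame_projection A) = real (card A)"
proof -
  have "trace (frame_projection A) = (\<Sum>a\<in>A. a \<bullet> a)"
    unfolding trace_def frame_projection_def inner_vec_def by simp (subst sum.swap, simp)
  also have "\<dots> = (\<Sum>a\<in>A. 1)"
    using assms by (intro sum.cong) (auto simp: orthonormal_inner)
  finally show ?thesis by simp
qed

lemma range_frame_projection:
  assumes "orthonormal A"
  shows "range ((*v) (frame_projection A)) = span A"
proof
  show "range ((*v) (frame_projection A)) \<subseteq> span A"
    unfolding frame_projection_mult by (intro image_subsetI span_sum span_scale span_base)
  show "span A \<subseteq> range ((*v) (frame_projection A))"
  proof
    fix x assume "x \<in> span A"
    then have "x = frame_projection A *v x"
      by (simp add: frame_projection_mult orthonormal_expand[OF assms])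
    then show "x \<in> range ((*v) (frame_projection A))" by blast
  qed
qed

lemma orth_projection_frame:
  assumes P: "orth_projection P"
  obtains A where "orthonormal A" "P = frame_projection A"
proof -
  have "subspace (range ((*v) P))"
    by (intro linear_subspace_image) auto
  then obtain A where A: "pairwise orthogonal A" "\<And>x. x \<in> A \<Longrightarrow> norm x = 1" "span A = range ((*v) P)"
    using orthonormal_basis_subspace by metis
  then have o: "orthonormal A" by (simp add: orthonormal_def)
  have Pa: "P *v a = a" if "a \<in> A" for a
  proof -
    have "a \<in> range ((*v) P)" using that A(3) span_base by blast
    then show ?thesis using P by (auto simp: orth_projection_idem)
  qed
  have "P *v x = frame_projection A *v x" for x
  proof -
    have "P *v x = (\<Sum>a\<in>A. ((P *v x) \<bullet> a) *\<^sub>R a)"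
      using orthonormal_expand[OF o, of "P *v x"] A(3) by simp
    also have "\<dots> = frame_projection A *v x"
      using P Pa by (simp add: frame_projection_mult orth_projection_inner)
    finally show ?thesis .
  qed
  then have "P = frame_projection A" by (simp add: matrix_eq)
  with o that show ?thesis by blast
qed

text \<open>
  The integral of \<^term>\<open>h\<close> over the range of an orthogonal projection \<^term>\<open>P\<close>: the Gaussian
  factor has mass 1 on the kernel of \<^term>\<open>P\<close>. Unlike a description by orthonormal frames,
  this expression is jointly measurable in \<^term>\<open>P\<close> and further parameters.
\<close>
definition flat_integral :: "real^'n^'n \<Rightarrow> (real^'n \<Rightarrow> ennreal) \<Rightarrow> ennreal" where
  "flat_integral P h = (\<integral>\<^sup>+x. h (P *v x) * ennreal (gauss (x - P *v x)) \<partial>lborel)"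

text \<open>Complete \<open>A\<close> by a frame B of the orthogonal complement. The Gaussian
  factors over the coordinates in B and each factor integrates to 1. This identifies
  \<open>flat_integral\<close> as the Lebesgue integral over \<open>span A\<close>.\<close>

lemma flat_integral_frame:
  fixes A :: "(real^'n) set"
  assumes A: "orthonormal A" and h: "h \<in> borel_measurable borel"
  shows "flat_integral (frame_projection A) h = (\<integral>\<^sup>+t. h (\<Sum>a\<in>A. t a *\<^sub>R a) \<partial>Pi\<^sub>M A (\<lambda>_. lborel))"
proof -
  obtain B where B: "A \<inter> B = {}" "orthonormal (A \<union> B)" "span (A \<union> B) = UNIV"
    using orthonormal_extend[OF A] .
  have oB: "orthonormal B" using B(2) by (rule orthonormal_subset) simp
  have fin: "finite A" "finite B" using A oB by (auto intro: orthonormal_finite)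
  let ?P = "frame_projection A"
  note [measurable] = h
  have PA: "?P *v (\<Sum>c\<in>A \<union> B. t c *\<^sub>R c) = (\<Sum>a\<in>A. t a *\<^sub>R a)" for t
    unfolding frame_projection_mult
    by (intro sum.cong) (auto simp: orthonormal_inner_sum[OF B(2)])
  have PB: "(\<Sum>c\<in>A \<union> B. t c *\<^sub>R c) - ?P *v (\<Sum>c\<in>A \<union> B. t c *\<^sub>R c) = (\<Sum>b\<in>B. t b *\<^sub>R b)" for t
    unfolding PA using B(1) fin by (simp add: sum.union_disjoint)
  have g: "ennreal (gauss (\<Sum>b\<in>B. t b *\<^sub>R b)) = (\<Prod>b\<in>B. ennreal (exp (- pi * (t b)\<^sup>2)))" for t
    unfolding gauss_def orthonormal_norm_sum[OF oB]
    using fin by (simp add: sum_distrib_left exp_sum prod_ennreal sum_negf[symmetric])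
  have "flat_integral ?P h =
      (\<integral>\<^sup>+t. h (\<Sum>a\<in>A. t a *\<^sub>R a) * (\<Prod>b\<in>B. ennreal (exp (- pi * (t b)\<^sup>2))) \<partial>Pi\<^sub>M (A \<union> B) (\<lambda>_. lborel))"
    unfolding flat_integral_def
    by (subst nn_integral_lborel_frame[OF B(2,3)]) (simp, simp only: PB g, simp only: PA)
  also have "\<dots> = (\<integral>\<^sup>+t. (\<integral>\<^sup>+s. h (\<Sum>a\<in>A. merge A B (t, s) a *\<^sub>R a) *
      (\<Prod>b\<in>B. ennreal (exp (- pi * (merge A B (t, s) b)\<^sup>2))) \<partial>Pi\<^sub>M B (\<lambda>_. lborel)) \<partial>Pi\<^sub>M A (\<lambda>_. lborel))"
    by (rule lborel_prod.product_nn_integral_fold[OF B(1) fin]) measurable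
  also have "\<dots> = (\<integral>\<^sup>+t. (\<integral>\<^sup>+s. h (\<Sum>a\<in>A. t a *\<^sub>R a) *
      (\<Prod>b\<in>B. ennreal (exp (- pi * (s b)\<^sup>2))) \<partial>Pi\<^sub>M B (\<lambda>_. lborel)) \<partial>Pi\<^sub>M A (\<lambda>_. lborel))"
    using B(1) by (intro nn_integral_cong arg_cong2[of _ _ _ _ "(*)"] arg_cong[of _ _ h] sum.cong prod.cong)
      (auto simp: merge_def)
  also have "\<dots> = (\<integral>\<^sup>+t. h (\<Sum>a\<in>A. t a *\<^sub>R a) \<partial>Pi\<^sub>M A (\<lambda>_. lborel))"
  proof (intro nn_integral_cong)
    fix t :: "real^'n \<Rightarrow> real"
    have "(\<integral>\<^sup>+s. (\<Prod>b\<in>B. ennreal (exp (- pi * (s b)\<^sup>2))) \<partial>Pi\<^sub>M B (\<lambda>_. lborel)) =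
        (\<Prod>b\<in>B. (\<integral>\<^sup>+x. ennreal (exp (- pi * x\<^sup>2)) \<partial>lborel))"
      by (rule lborel_prod.product_nn_integral_prod[OF fin(2)]) simp
    also have "\<dots> = 1" by (simp only: nn_integral_gauss_real prod.neutral_const)
    finally show "(\<integral>\<^sup>+s. h (\<Sum>a\<in>A. t a *\<^sub>R a) * (\<Prod>b\<in>B. ennreal (exp (- pi * (s b)\<^sup>2))) \<partial>Pi\<^sub>M B (\<lambda>_. lborel)) =
        h (\<Sum>a\<in>A. t a *\<^sub>R a)"
      by (subst nn_integral_cmult) auto
  qed
  finally show ?thesis .
qed

text \<open>The case of the empty frame: P = 0, the range is a point, and the flat integral of 1 is
  the whole Gaussian integral.\<close>

lemma nn_integral_gauss: "(\<integral>\<^sup>+x. ennreal (gauss (x :: real^'n)) \<partial>lborel) = 1"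
proof -
  have "flat_integral (frame_projection {} :: real^'n^'n) (\<lambda>_. 1) = 1"
    by (subst flat_integral_frame) (auto simp: orthonormal_def PiM_empty)
  then show ?thesis by (simp add: flat_integral_def frame_projection_mult)
qed

text \<open>Fubini along range and kernel of \<open>P\<close>, without choosing frames. Translations
  merge the two Gaussian weights into the single factor gauss(x - R z), where R = 1 - 2 P is the
  reflection in the kernel; its integral over z is 1 because |det R| = 1.\<close>

lemma nn_integral_lborel_split:
  fixes P :: "real^'n^'n"
  assumes P: "orth_projection P" and h: "h \<in> borel_measurable borel"
  shows "(\<integral>\<^sup>+x. h x \<partial>lborel) =
    (\<integral>\<^sup>+z. ennreal (gauss (P *v z)) * flat_integral P (\<lambda>x. h (z - P *v z + x)) \<partial>lborel)"
proof -
  note [measurable] = h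
  have pair: "pair_sigma_finite (lborel :: (real^'n) measure) (lborel :: (real^'n) measure)" ..
  note fub = pair_sigma_finite.Fubini'[OF pair]
  have [measurable]: "(*v) P \<in> borel_measurable borel" by simp
  let ?g = "\<lambda>x. ennreal (gauss x)"
  have "(\<integral>\<^sup>+z. ?g (P *v z) * flat_integral P (\<lambda>x. h (z - P *v z + x)) \<partial>lborel) =
      (\<integral>\<^sup>+z. \<integral>\<^sup>+x. ?g (P *v z) * (h (z - P *v z + P *v x) * ?g (x - P *v x)) \<partial>lborel \<partial>lborel)"
    unfolding flat_integral_def by (simp add: nn_integral_cmult)
  also have "\<dots> = (\<integral>\<^sup>+x. \<integral>\<^sup>+z. ?g (P *v z) * (h (z - P *v z + P *v x) * ?g (x - P *v x)) \<partial>lborel \<partial>lborel)"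
    by (rule fub) simp
  also have "\<dots> = (\<integral>\<^sup>+x. \<integral>\<^sup>+z. h (z - P *v z + x) * ?g (P *v z + x) \<partial>lborel \<partial>lborel)"
  proof (rule nn_integral_cong)
    fix x
    have "(\<integral>\<^sup>+z. ?g (P *v z) * (h (z - P *v z + P *v x) * ?g (x - P *v x)) \<partial>lborel) =
        (\<integral>\<^sup>+z. ?g (P *v (z + x)) * (h (z + x - P *v (z + x) + P *v x) * ?g (x - P *v x)) \<partial>lborel)"
      by (rule nn_integral_lborel_translate[symmetric]) simp
    also have "\<dots> = (\<integral>\<^sup>+z. h (z - P *v z + x) * ?g (P *v z + x) \<partial>lborel)"
    proof (rule nn_integral_cong)
      fix z
      have "gauss (P *v z + x) = gauss (P *v (z + x)) * gauss (x - P *v x)"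
        using gauss_add_orthogonal[OF orth_projection_inner_compl[OF P, of "z + x" x]]
        by (simp add: matrix_vector_right_distrib)
      then show "?g (P *v (z + x)) * (h (z + x - P *v (z + x) + P *v x) * ?g (x - P *v x)) =
          h (z - P *v z + x) * ?g (P *v z + x)"
        by (simp add: matrix_vector_right_distrib ennreal_mult' mult_ac algebra_simps)
    qed
    finally show "(\<integral>\<^sup>+z. ?g (P *v z) * (h (z - P *v z + P *v x) * ?g (x - P *v x)) \<partial>lborel) =
        (\<integral>\<^sup>+z. h (z - P *v z + x) * ?g (P *v z + x) \<partial>lborel)" .
  qed
  also have "\<dots> = (\<integral>\<^sup>+z. \<integral>\<^sup>+x. h (z - P *v z + x) * ?g (P *v z + x) \<partial>lborel \<partial>lborel)"
    by (rule fub) simp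
  \<comment> \<open>Translating x by P z - z frees h of z and leaves z only in the Gaussian.\<close>
  also have "\<dots> = (\<integral>\<^sup>+z. \<integral>\<^sup>+x. h x * ?g (x - (z - (P *v z + P *v z))) \<partial>lborel \<partial>lborel)"
  proof (rule nn_integral_cong)
    fix z
    have 1: "z - P *v z + (x + (P *v z - z)) = x" for x
      by simp
    have 2: "P *v z + (x + (P *v z - z)) = x - (z - (P *v z + P *v z))" for x
      by (simp add: algebra_simps)
    show "(\<integral>\<^sup>+x. h (z - P *v z + x) * ?g (P *v z + x) \<partial>lborel) =
        (\<integral>\<^sup>+x. h x * ?g (x - (z - (P *v z + P *v z))) \<partial>lborel)"
      using nn_integral_lborel_translate[of "\<lambda>x. h (z - P *v z + x) * ?g (P *v z + x)" "P *v z - z"]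
      unfolding 1 2 by simp
  qed
  also have "\<dots> = (\<integral>\<^sup>+x. h x * (\<integral>\<^sup>+z. ?g (x - (z - (P *v z + P *v z))) \<partial>lborel) \<partial>lborel)"
  proof -
    have "(\<integral>\<^sup>+z. \<integral>\<^sup>+x. h x * ?g (x - (z - (P *v z + P *v z))) \<partial>lborel \<partial>lborel) =
        (\<integral>\<^sup>+x. \<integral>\<^sup>+z. h x * ?g (x - (z - (P *v z + P *v z))) \<partial>lborel \<partial>lborel)"
      by (rule fub) measurable
    also have "\<dots> = (\<integral>\<^sup>+x. h x * (\<integral>\<^sup>+z. ?g (x - (z - (P *v z + P *v z))) \<partial>lborel) \<partial>lborel)"
      by (intro nn_integral_cong nn_integral_cmult) measurable
    finally show ?thesis .
  qed
  also have "\<dots> = (\<integral>\<^sup>+x. h x \<partial>lborel)"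
  proof (rule nn_integral_cong)
    fix x
    define R where "R = mat 1 - (P + P)"
    have R: "R *v z = z - (P *v z + P *v z)" for z
      by (simp only: R_def matrix_vector_mult_diff_rdistrib matrix_vector_mult_add_rdistrib matrix_vector_mul_lid)
    have "R *v (R *v z) = z" for z
    proof -
      have "P *v (z - (P *v z + P *v z)) = - (P *v z)"
        using P by (simp only: matrix_vector_mult_diff_distrib matrix_vector_right_distrib orth_projection_idem diff_add_cancel diff_diff_add[symmetric] diff_self) (simp only: diff_0)
      then show ?thesis by (simp only: R) (simp only: algebra_simps, simp)
    qed
    then have RR: "R ** R = mat 1"
      by (simp add: matrix_eq flip: matrix_vector_mul_assoc)
    then have i: "invertible R" by (auto simp: invertible_def)
    have d: "\<bar>det R\<bar> = 1"
      using arg_cong[OF RR, of det] by (auto simp: det_mul square_eq_1_iff)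
    have "(\<integral>\<^sup>+z. ?g (x - (z - (P *v z + P *v z))) \<partial>lborel) = (\<integral>\<^sup>+z. ?g (x - R *v z) \<partial>lborel)"
      by (simp only: R)
    also have "\<dots> = (\<integral>\<^sup>+z. ?g (x - z) \<partial>lborel)"
      using nn_integral_lborel_linear[OF i, of "\<lambda>z. ?g (x - z)"] by (simp add: d)
    also have "\<dots> = (\<integral>\<^sup>+z. ?g (x + z) \<partial>lborel)"
      by (subst nn_integral_lborel_reflect[symmetric]) simp_all
    also have "\<dots> = 1"
      using nn_integral_lborel_translate[of ?g x] by (simp add: nn_integral_gauss add.commute)
    finally show "h x * (\<integral>\<^sup>+z. ?g (x - (z - (P *v z + P *v z))) \<partial>lborel) = h x" by simp
  qed
  finally show ?thesis by (rule sym)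
qed

section \<open>Sections of ellipsoids by parallel flats\<close>

lemma flat_integral_cong:
  "(\<And>x. h (P *v x) = h' (P *v x)) \<Longrightarrow> flat_integral P h = flat_integral P h'"
  by (simp add: flat_integral_def)

lemma flat_integral_cmult:
  assumes "h \<in> borel_measurable borel"
  shows "flat_integral P (\<lambda>x. h x * c) = flat_integral P h * c"
proof -
  note [measurable] = assms
  have "flat_integral P (\<lambda>x. h x * c) = (\<integral>\<^sup>+x. h (P *v x) * ennreal (gauss (x - P *v x)) * c \<partial>lborel)"
    by (simp add: flat_integral_def mult_ac)
  also have "\<dots> = flat_integral P h * c"
    unfolding flat_integral_def by (intro nn_integral_multc) measurable
  finally show ?thesis .
qed

lemma flat_integral_translate:
  assumes P: "orth_projection P" and [measurable]: "h \<in> borel_measurable borel"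
  shows "flat_integral P (\<lambda>x. h (P *v a + x)) = flat_integral P h"
proof -
  have "flat_integral P h =
      (\<integral>\<^sup>+x. h (P *v (x + P *v a)) * ennreal (gauss (x + P *v a - P *v (x + P *v a))) \<partial>lborel)"
    unfolding flat_integral_def by (rule nn_integral_lborel_translate[symmetric]) measurable
  then show ?thesis
    using P by (simp add: flat_integral_def matrix_vector_right_distrib orth_projection_idem add.commute)
qed

text \<open>The summand 1 - P pads the compression of G to the range of P with ones, so this is the
  determinant of the form G on that range. For G = T^T T it is the square of the volume factor of T
  there.\<close>

definition stretch :: "real^'n^'n \<Rightarrow> real^'n^'n \<Rightarrow> real" where
  "stretch G P = det (P ** G ** P + (mat 1 - P))"

lemma dim_range_compl:
  assumes P: "orth_projection (P::real^'n^'n)"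
  shows "dim (range ((*v) (mat 1 - P))) + dim (range ((*v) P)) = CARD('n)"
proof -
  have "range ((*v) (mat 1 - P)) = {y \<in> UNIV. \<forall>x\<in>range ((*v) P). orthogonal x y}"
  proof (intro equalityI subsetI)
    fix y assume "y \<in> range ((*v) (mat 1 - P))"
    then show "y \<in> {y \<in> UNIV. \<forall>x\<in>range ((*v) P). orthogonal x y}"
      using orth_projection_inner_compl[OF P]
      by (auto simp: orthogonal_def matrix_vector_mult_diff_rdistrib)
  next
    fix y assume y: "y \<in> {y \<in> UNIV. \<forall>x\<in>range ((*v) P). orthogonal x y}"
    then have "(P *v y) \<bullet> y = 0" by (simp add: orthogonal_def)
    then have "(P *v y) \<bullet> (P *v y) = 0"
      using orth_projection_inner_compl[OF P, of y y] by (simp add: inner_diff_right)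
    then have "y = (mat 1 - P) *v y" by (simp add: matrix_vector_mult_diff_rdistrib)
    then show "y \<in> range ((*v) (mat 1 - P))" by blast
  qed
  moreover have "dim {y \<in> UNIV. \<forall>x\<in>range ((*v) P). orthogonal x y} + dim (range ((*v) P)) = dim (UNIV :: (real^'n) set)"
    by (intro dim_subspace_orthogonal_to_vectors) (auto intro: linear_subspace_image)
  ultimately show ?thesis by simp
qed

text \<open>As \<open>flat_integral\<close> integrates over the whole space, \<open>T\<close> is
  replaced by a map S that agrees with \<open>T\<close> on the range of \<open>P\<close> and maps
  the kernel of \<open>P\<close> isometrically onto that of \<open>P'\<close>. S respects both
  orthogonal splittings and keeps the Gaussian weight, and S^T S = P G P + 1 - P with G = T^T T, so
  |det S| is the square root of \<open>s\<close>.\<close>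

lemma flat_integral_linear:
  fixes T :: "real^'n^'n"
  assumes T: "invertible T" and P: "orth_projection P" and P': "orth_projection P'"
    and rng: "range ((*v) P') = (*v) T ` range ((*v) P)"
    and [measurable]: "h \<in> borel_measurable borel"
  defines "s \<equiv> stretch (transpose T ** T) P"
  shows "s > 0" "flat_integral P (\<lambda>x. h (T *v x)) = ennreal (1 / sqrt s) * flat_integral P' h"
proof -
  have inj: "inj ((*v) T)"
    using T by (metis invertible_left_inverse matrix_left_invertible_injective)
  let ?K = "range ((*v) (mat 1 - P))" and ?K' = "range ((*v) (mat 1 - P'))"
  have "dim (range ((*v) P')) = dim (range ((*v) P))"
    unfolding rng using inj by (intro dim_image_eq) (auto intro: inj_on_subset)
  then have "dim ?K = dim ?K'"
    using dim_range_compl[OF P] dim_range_compl[OF P'] by simp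
  \<comment> \<open>\<open>T\<close> is injective, so the two ranges have equal dimension, and so do
    the two kernels, which are therefore isometric.\<close>
  then obtain f where f: "linear f" "f ` ?K = ?K'" "\<And>x. x \<in> ?K \<Longrightarrow> norm (f x) = norm x"
  proof -
    have "subspace ?K" "subspace ?K'" by (auto intro: linear_subspace_image)
    from isometries_subspaces[OF this \<open>dim ?K = dim ?K'\<close>] show ?thesis
      using that by metis
  qed
  define V where "V = matrix f"
  have V: "V *v x = f x" for x using f(1) by (simp add: V_def matrix_works)
  have K: "x - P *v x \<in> ?K" for x
    by (metis matrix_vector_mul_lid matrix_vector_mult_diff_rdistrib rangeI)
  have subK: "x + y \<in> ?K" if "x \<in> ?K" "y \<in> ?K" for x y
    using that by (auto simp flip: matrix_vector_right_distrib)
  have Vinner: "(V *v x) \<bullet> (V *v y) = x \<bullet> y" if "x \<in> ?K" "y \<in> ?K" for x y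
    using f(3)[OF that(1)] f(3)[OF that(2)] f(3)[OF subK[OF that]] f(1)
    by (simp add: dot_norm V linear_add)
  have P'T: "P' *v (T *v (P *v x)) = T *v (P *v x)" for x
  proof -
    have "T *v (P *v x) \<in> range ((*v) P')" unfolding rng by blast
    then show ?thesis using P' by (auto simp: orth_projection_idem)
  qed
  have P'V: "P' *v (V *v (x - P *v x)) = 0" for x
  proof -
    have "V *v (x - P *v x) \<in> ?K'" using K f(2) V by auto
    then obtain z where "V *v (x - P *v x) = (mat 1 - P') *v z" by blast
    then have "V *v (x - P *v x) = z - P' *v z" by (simp add: matrix_vector_mult_diff_rdistrib)
    then show ?thesis
      using P' by (simp only:) (simp add: matrix_vector_mult_diff_distrib orth_projection_idem)
  qed
  define S where "S = T ** P + V ** (mat 1 - P)"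
  have S: "S *v x = T *v (P *v x) + V *v (x - P *v x)" for x
    by (simp only: S_def matrix_vector_mult_add_rdistrib matrix_vector_mult_diff_rdistrib
        matrix_vector_mul_lid flip: matrix_vector_mul_assoc)
  have PS: "P' *v (S *v x) = T *v (P *v x)" for x
    by (simp add: S matrix_vector_right_distrib P'T P'V)
  have TV: "(T *v (P *v x)) \<bullet> (V *v (y - P *v y)) = 0" for x y
    using orth_projection_inner[OF P', of "T *v (P *v x)" "V *v (y - P *v y)"] by (simp add: P'T P'V)
  have SS: "(S *v x) \<bullet> (S *v y) = (T *v (P *v x)) \<bullet> (T *v (P *v y)) + (x - P *v x) \<bullet> (y - P *v y)" for x y
    using TV[of x y] TV[of y x] by (simp add: S inner_add_left inner_add_right Vinner[OF K K] inner_commute)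
  have "x \<bullet> ((transpose S ** S) *v y) = x \<bullet> ((P ** (transpose T ** T) ** P + (mat 1 - P)) *v y)" for x y
  proof -
    have tr: "x \<bullet> (transpose A *v y) = (A *v x) \<bullet> y" for A :: "real^'n^'n" and x y
      by (metis dot_lmul_matrix inner_commute transpose_matrix_vector)
    have "x \<bullet> ((transpose S ** S) *v y) = (S *v x) \<bullet> (S *v y)"
      by (simp only: tr flip: matrix_vector_mul_assoc)
    also have "\<dots> = x \<bullet> (P *v (transpose T *v (T *v (P *v y)))) + x \<bullet> (y - P *v y)"
      using orth_projection_inner[OF P, of x "transpose T *v (T *v (P *v y))"]
        orth_projection_inner_compl[OF P, of x y]
      by (simp only: SS tr) (simp add: inner_diff_left)
    also have "\<dots> = x \<bullet> ((P ** (transpose T ** T) ** P + (mat 1 - P)) *v y)"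
      by (simp only: matrix_vector_mult_add_rdistrib matrix_vector_mult_diff_rdistrib inner_add_right
          matrix_vector_mul_lid flip: matrix_vector_mul_assoc)
    finally show ?thesis .
  qed
  then have "transpose S ** S = P ** (transpose T ** T) ** P + (mat 1 - P)"
    by (metis matrix_eq vector_eq_ldot)
  then have s: "s = (det S)\<^sup>2"
    unfolding s_def stretch_def by (metis det_mul det_transpose power2_eq_square)
  have "S *v x = 0 \<Longrightarrow> x = 0" for x
  proof -
    assume S0: "S *v x = 0"
    then have "(T *v (P *v x)) \<bullet> (T *v (P *v x)) + (x - P *v x) \<bullet> (x - P *v x) = 0"
      using SS[of x x] by simp
    then have *: "T *v (P *v x) = 0" "x - P *v x = 0"
      by (smt (verit) inner_eq_zero_iff inner_ge_zero)+
    then have "P *v x = 0" using inj by (metis injD matrix_vector_mult_0_right)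
    with * show "x = 0" by simp
  qed
  then have iS: "invertible S"
    by (metis invertible_left_inverse matrix_left_invertible_ker)
  then show "s > 0" using s by (simp add: invertible_det_nz)
  have gS: "gauss (S *v x - P' *v (S *v x)) = gauss (x - P *v x)" for x
    using f(3)[OF K, of x] by (simp add: PS) (simp add: S gauss_def V)
  have "flat_integral P (\<lambda>x. h (T *v x)) = (\<integral>\<^sup>+x. h (P' *v (S *v x)) * ennreal (gauss (S *v x - P' *v (S *v x))) \<partial>lborel)"
    unfolding flat_integral_def gS by (simp only: PS)
  also have "\<dots> = ennreal (1 / \<bar>det S\<bar>) * flat_integral P' h"
    unfolding flat_integral_def
    by (rule nn_integral_lborel_linear[OF iS, where h = "\<lambda>z. h (P' *v z) * ennreal (gauss (z - P' *v z))"]) measurable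
  finally show "flat_integral P (\<lambda>x. h (T *v x)) = ennreal (1 / sqrt s) * flat_integral P' h"
    using s by simp
qed

text \<open>For P of rank k this is the k-dimensional volume of the part of S on the flat through v
  with direction P. It is a function of P and v, not of the flat as a set, so that measurability can
  be stated in these coordinates.\<close>

definition section_volume :: "(real^'n) set \<Rightarrow> real^'n^'n \<Rightarrow> real^'n \<Rightarrow> ennreal" where
  "section_volume S P v = flat_integral P (\<lambda>x. indicator S (v + x))"

lemma measurable_section_volume [measurable]:
  assumes [measurable]: "S \<in> sets borel"
  shows "section_volume S P \<in> borel_measurable borel"
  unfolding section_volume_def flat_integral_def by measurable

lemma section_volume_translate:
  assumes P: "orth_projection P" and [measurable]: "S \<in> sets borel"
  shows "section_volume S P (v + P *v a) = section_volume S P v"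
  unfolding section_volume_def
  using flat_integral_translate[OF P, of "\<lambda>x. indicator S (v + x)" a] by (simp add: add.assoc)

text \<open>The section volume is constant along each flat, so one of the \<open>Suc m\<close>
  factors can be unfolded as an integral of the indicator along the flat while the others stay.
  Range and kernel then recombine to the whole space, at the cost of one power.\<close>

lemma section_volume_power_integral:
  assumes P: "orth_projection P" and [measurable]: "S \<in> sets borel"
  shows "(\<integral>\<^sup>+z. ennreal (gauss (P *v z)) * section_volume S P (z - P *v z) ^ Suc m \<partial>lborel) =
    (\<integral>\<^sup>+w. indicator S w * section_volume S P w ^ m \<partial>lborel)"
proof -
  have "flat_integral P (\<lambda>x. indicator S (v + x) * section_volume S P (v + x) ^ m) =
      section_volume S P v ^ Suc m" for v
  proof -
    have "flat_integral P (\<lambda>x. indicator S (v + x) * section_volume S P (v + x) ^ m) =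
        flat_integral P (\<lambda>x. indicator S (v + x) * section_volume S P v ^ m)"
      by (intro flat_integral_cong) (simp add: section_volume_translate[OF P])
    also have "\<dots> = section_volume S P v * section_volume S P v ^ m"
      unfolding section_volume_def by (intro flat_integral_cmult) measurable
    finally show ?thesis by simp
  qed
  then show ?thesis
    by (subst nn_integral_lborel_split[OF P]) simp_all
qed

lemma section_volume_ellipsoid:
  fixes T :: "real^'n^'n"
  assumes T: "invertible T" and P: "orth_projection P" and P': "orth_projection P'"
    and rng: "range ((*v) P') = (*v) T ` range ((*v) P)"
    and S: "\<And>w. w \<in> S \<longleftrightarrow> T *v (w - c) \<in> B" and [measurable]: "B \<in> sets borel"
  shows "section_volume S P w =
    ennreal (1 / sqrt (stretch (transpose T ** T) P)) * section_volume B P' (T *v (w - c))"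
proof -
  have "section_volume S P w = flat_integral P (\<lambda>x. indicator B (T *v (w - c) + T *v x))"
    unfolding section_volume_def
    by (intro flat_integral_cong)
      (simp add: S indicator_def matrix_vector_right_distrib matrix_vector_mult_diff_distrib algebra_simps)
  also have "\<dots> = ennreal (1 / sqrt (stretch (transpose T ** T) P)) *
      flat_integral P' (\<lambda>x. indicator B (T *v (w - c) + x))"
    by (rule flat_integral_linear[OF T P P' rng]) measurable
  finally show ?thesis unfolding section_volume_def .
qed

text \<open>Each of the \<open>m\<close> volume factors contributes 1 / sqrt(stretch), and the outer
  integral contributes 1 / |det T|. The projection \<open>P'\<close> survives here, but for the unit
  ball the last integral depends only on its trace.\<close>

lemma section_volume_power_integral_ellipsoid:
  fixes T :: "real^'n^'n"
  assumes T: "invertible T" and P: "orth_projection P" and P': "orth_projection P'"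
    and rng: "range ((*v) P') = (*v) T ` range ((*v) P)"
    and S: "\<And>w. w \<in> S \<longleftrightarrow> T *v (w - c) \<in> B" and B: "B \<in> sets borel"
  shows "(\<integral>\<^sup>+w. indicator S w * section_volume S P w ^ m \<partial>lborel) =
    ennreal (1 / sqrt (stretch (transpose T ** T) P)) ^ m * ennreal (1 / \<bar>det T\<bar>) *
      (\<integral>\<^sup>+w. indicator B w * section_volume B P' w ^ m \<partial>lborel)"
proof -
  note [measurable] = B
  let ?a = "ennreal (1 / sqrt (stretch (transpose T ** T) P))"
  let ?F = "\<lambda>w. indicator B w * section_volume B P' w ^ m"
  have "(\<integral>\<^sup>+w. indicator S w * section_volume S P w ^ m \<partial>lborel) =
      (\<integral>\<^sup>+w. ?a ^ m * ?F (T *v (w - c)) \<partial>lborel)"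
    unfolding section_volume_ellipsoid[OF assms]
    by (simp add: power_mult_distrib mult_ac indicator_def S)
  also have "\<dots> = ?a ^ m * (\<integral>\<^sup>+w. ?F (T *v (w + (- c))) \<partial>lborel)"
    by (subst nn_integral_cmult) simp_all
  also have "(\<integral>\<^sup>+w. ?F (T *v (w + (- c))) \<partial>lborel) = (\<integral>\<^sup>+w. ?F (T *v w) \<partial>lborel)"
    by (rule nn_integral_lborel_translate) measurable
  also have "\<dots> = ennreal (1 / \<bar>det T\<bar>) * (\<integral>\<^sup>+w. ?F w \<partial>lborel)"
    by (rule nn_integral_lborel_linear[OF T]) measurable
  finally show ?thesis by (simp add: mult.assoc)
qed

section \<open>Explicit integrals for the unit ball\<close>

lemma emeasure_PiM_cball:
  assumes A: "finite A" and r: "r \<ge> 0"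
  shows "(\<integral>\<^sup>+t. indicator {t. (\<Sum>a\<in>A. (t a)\<^sup>2) \<le> r\<^sup>2} t \<partial>Pi\<^sub>M A (\<lambda>_. lborel)) =
    ennreal (unit_ball_vol (real (card A)) * r ^ card A)"
proof -
  let ?P = "Pi\<^sub>M A (\<lambda>_. lborel)"
  let ?S = "{t. sqrt (\<Sum>a\<in>A. (t a)\<^sup>2) \<le> r} \<inter> space ?P"
  interpret finite_product_sigma_finite "\<lambda>_. lborel :: real measure" A
    by standard fact
  have "(\<integral>\<^sup>+t. indicator {t. (\<Sum>a\<in>A. (t a)\<^sup>2) \<le> r\<^sup>2} t \<partial>?P) = (\<integral>\<^sup>+t. indicator ?S t \<partial>?P)"
    using r by (intro nn_integral_cong) (auto simp: indicator_def real_sqrt_le_iff' sum_nonneg)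
  also have "\<dots> = emeasure ?P ?S"
    by (intro nn_integral_indicator) measurable
  also have "\<dots> = ennreal (unit_ball_vol (real (card A)) * r ^ card A)"
  proof (cases "r = 0")
    \<comment> \<open>A ball of radius 0 is a point, of mass 1 in dimension 0 and of mass 0
      otherwise, in agreement with 0 ^ 0 = 1.\<close>
    case True
    have "?S = Pi\<^sub>E A (\<lambda>_. {0})"
    proof -
      have "(\<Sum>a\<in>A. (t a)\<^sup>2) \<le> 0 \<longleftrightarrow> (\<forall>a\<in>A. t a = 0)" for t :: "'a \<Rightarrow> real"
        using A sum_nonneg_eq_0_iff[of A "\<lambda>a. (t a)\<^sup>2"] sum_nonneg[of A "\<lambda>a. (t a)\<^sup>2"] by auto
      then have "?S = {t \<in> extensional A. \<forall>a\<in>A. t a = 0}"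
        by (auto simp: True space_PiM PiE_iff extensional_def)
      also have "\<dots> = Pi\<^sub>E A (\<lambda>_. {0})"
        unfolding PiE_def Pi_def by blast
      finally show ?thesis .
    qed
    then have "emeasure ?P ?S = (\<Prod>a\<in>A. emeasure lborel {0::real})"
      by (simp only:) (intro measure_times, auto)
    then show ?thesis using A True by (cases "card A") auto
  next
    case False
    then show ?thesis using emeasure_cball_aux[OF A, of r] r by simp
  qed
  finally show ?thesis .
qed

text \<open>Slice the unit ball in card A + N coordinates over those in \<open>A\<close>: the slice
  at t is an N-dimensional ball of radius sqrt(1 - |t|^2). The N additional coordinates are indexed
  by spare elements of the infinite index type, and the volume of the N-dimensional unit ball is
  divided out.\<close>

lemma nn_integral_PiM_ball_power:
  assumes A: "finite (A :: 'i set)" and inf: "infinite (UNIV :: 'i set)"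
  shows "(\<integral>\<^sup>+t. indicator {t. (\<Sum>a\<in>A. (t a)\<^sup>2) \<le> 1} t * ennreal (sqrt (1 - (\<Sum>a\<in>A. (t a)\<^sup>2)) ^ N)
      \<partial>Pi\<^sub>M A (\<lambda>_. lborel)) =
    ennreal (unit_ball_vol (real (card A + N)) / unit_ball_vol (real N))"
proof -
  obtain C :: "'i set" where C: "C \<subseteq> - A" "finite C" "card C = N"
    using infinite_arbitrarily_large[of "- A" N] inf A by (metis Compl_eq_Diff_UNIV Diff_infinite_finite)
  have AC: "A \<inter> C = {}" using C(1) by auto
  let ?q = "\<lambda>t. \<Sum>a\<in>A. (t a)\<^sup>2"
  let ?\<kappa> = "unit_ball_vol (real N)"
  have "ennreal (unit_ball_vol (real (card A + N))) =
      (\<integral>\<^sup>+t. indicator {t. (\<Sum>a\<in>A \<union> C. (t a)\<^sup>2) \<le> (1::real)} t \<partial>Pi\<^sub>M (A \<union> C) (\<lambda>_. lborel))"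
    using A C AC emeasure_PiM_cball[of "A \<union> C" 1] by (simp add: card_Un_disjoint)
  also have "\<dots> = (\<integral>\<^sup>+t. \<integral>\<^sup>+s. indicator {t. (\<Sum>a\<in>A \<union> C. (t a)\<^sup>2) \<le> (1::real)} (merge A C (t, s))
      \<partial>Pi\<^sub>M C (\<lambda>_. lborel) \<partial>Pi\<^sub>M A (\<lambda>_. lborel))"
    using A C by (intro lborel_prod.product_nn_integral_fold AC) measurable
  also have "\<dots> = (\<integral>\<^sup>+t. indicator {t. ?q t \<le> 1} t * (ennreal ?\<kappa> * ennreal (sqrt (1 - ?q t) ^ N))
      \<partial>Pi\<^sub>M A (\<lambda>_. lborel))"
  proof (rule nn_integral_cong)
    fix t :: "'i \<Rightarrow> real"
    have m: "(\<Sum>a\<in>A \<union> C. (merge A C (t, s) a)\<^sup>2) = ?q t + (\<Sum>a\<in>C. (s a)\<^sup>2)" for s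
    proof -
      have "(\<Sum>a\<in>A. (merge A C (t, s) a)\<^sup>2) = ?q t" "(\<Sum>a\<in>C. (merge A C (t, s) a)\<^sup>2) = (\<Sum>a\<in>C. (s a)\<^sup>2)"
        using AC by (auto simp: merge_def intro!: sum.cong)
      then show ?thesis using A C AC by (simp add: sum.union_disjoint)
    qed
    show "(\<integral>\<^sup>+s. indicator {t. (\<Sum>a\<in>A \<union> C. (t a)\<^sup>2) \<le> (1::real)} (merge A C (t, s)) \<partial>Pi\<^sub>M C (\<lambda>_. lborel)) =
        indicator {t. ?q t \<le> 1} t * (ennreal ?\<kappa> * ennreal (sqrt (1 - ?q t) ^ N))"
    proof (cases "?q t \<le> 1")
      case True
      have "(\<integral>\<^sup>+s. indicator {t. (\<Sum>a\<in>A \<union> C. (t a)\<^sup>2) \<le> (1::real)} (merge A C (t, s)) \<partial>Pi\<^sub>M C (\<lambda>_. lborel)) =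
          (\<integral>\<^sup>+s. indicator {s. (\<Sum>a\<in>C. (s a)\<^sup>2) \<le> (sqrt (1 - ?q t))\<^sup>2} s \<partial>Pi\<^sub>M C (\<lambda>_. lborel))"
        using True by (intro nn_integral_cong) (auto simp: indicator_def m)
      also have "\<dots> = ennreal (?\<kappa> * sqrt (1 - ?q t) ^ N)"
        using True C by (subst emeasure_PiM_cball) auto
      finally show ?thesis using True by (simp add: ennreal_mult')
    next
      case False
      have "\<not> ?q t + (\<Sum>a\<in>C. (s a)\<^sup>2) \<le> 1" for s
        using False sum_nonneg[of C "\<lambda>a. (s a)\<^sup>2"] by auto
      then show ?thesis using False by (simp add: m)
    qed
  qed
  also have "\<dots> = ennreal ?\<kappa> * (\<integral>\<^sup>+t. indicator {t. ?q t \<le> 1} t * ennreal (sqrt (1 - ?q t) ^ N) \<partial>Pi\<^sub>M A (\<lambda>_. lborel))"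
    by (subst nn_integral_cmult[symmetric]) (auto simp: mult_ac)
  finally have *: "ennreal (unit_ball_vol (real (card A + N))) = ennreal ?\<kappa> *
    (\<integral>\<^sup>+t. indicator {t. ?q t \<le> 1} t * ennreal (sqrt (1 - ?q t) ^ N) \<partial>Pi\<^sub>M A (\<lambda>_. lborel))" (is "_ = _ * ?I") .
  have "?\<kappa> > 0" by simp
  then have "?\<kappa> \<noteq> 0" by linarith
  then have "?I = ennreal (1 / ?\<kappa>) * (ennreal ?\<kappa> * ?I)"
    by (simp add: mult.assoc[symmetric] ennreal_mult'[symmetric])
  also have "\<dots> = ennreal (1 / ?\<kappa>) * ennreal (unit_ball_vol (real (card A + N)))"
    by (simp only: *)
  also have "\<dots> = ennreal (unit_ball_vol (real (card A + N)) / ?\<kappa>)"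
    by (simp add: ennreal_mult'[symmetric])
  finally show ?thesis .
qed

text \<open>Frames are indexed by their own vectors, so the spare indices for the slicing argument
  are vectors as well.\<close>

lemma infinite_UNIV_vec: "infinite (UNIV :: (real^'n) set)"
proof -
  have "inj (vec :: real \<Rightarrow> real^'n)" by (auto simp: inj_def vec_eq_iff)
  then show ?thesis using infinite_UNIV_char_0 by (metis finite_imageD finite_subset subset_UNIV)
qed

text \<open>The weighted integral is the flat integral for 1 - P, that is, an integral over the
  kernel of \<open>P\<close>, which a frame of the kernel turns into coordinates. The trace of a
  projection counts the vectors of a frame, whence the cardinality of C.\<close>

lemma nn_integral_gauss_frame_compl:
  fixes P :: "real^'n^'n"
  assumes P: "orth_projection P" and tr: "trace P = real k" and h[measurable]: "h \<in> borel_measurable borel"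
  obtains C where "orthonormal C" "card C = CARD('n) - k" "k \<le> CARD('n)"
    "\<And>t. P *v (\<Sum>c\<in>C. t c *\<^sub>R c) = 0"
    "(\<integral>\<^sup>+z. ennreal (gauss (P *v z)) * h (z - P *v z) \<partial>lborel) =
      (\<integral>\<^sup>+t. h (\<Sum>c\<in>C. t c *\<^sub>R c) \<partial>Pi\<^sub>M C (\<lambda>_. lborel))"
proof -
  obtain C where C: "orthonormal C" "mat 1 - P = frame_projection C"
    using orth_projection_frame[OF orth_projection_compl[OF P]] by metis
  have "real (card C) = real CARD('n) - real k"
    using trace_frame_projection[OF C(1)] trace_sub[of "mat 1" P] trace_I[where ?'a = real and 'n = 'n] tr C(2) by simp
  then have "card C = CARD('n) - k" "k \<le> CARD('n)" by linarith+
  moreover have "P *v (\<Sum>c\<in>C. t c *\<^sub>R c) = 0" for t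
  proof -
    let ?x = "\<Sum>c\<in>C. t c *\<^sub>R c"
    have "(mat 1 - P) *v ?x = ?x"
      unfolding C(2) frame_projection_mult by (intro sum.cong) (simp_all add: orthonormal_inner_sum[OF C(1)])
    then show ?thesis by (simp add: matrix_vector_mult_diff_rdistrib)
  qed
  moreover have "(\<integral>\<^sup>+z. ennreal (gauss (P *v z)) * h (z - P *v z) \<partial>lborel) = flat_integral (mat 1 - P) h"
    by (simp add: flat_integral_def matrix_vector_mult_diff_rdistrib mult.commute)
  moreover have "flat_integral (mat 1 - P) h = (\<integral>\<^sup>+t. h (\<Sum>c\<in>C. t c *\<^sub>R c) \<partial>Pi\<^sub>M C (\<lambda>_. lborel))"
    unfolding C(2) by (rule flat_integral_frame[OF C(1) h])
  ultimately show ?thesis by (intro that[OF C(1)]) simp_all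
qed

text \<open>The value equals the normalization of \<mu>; comparing the two later shows that the
  measure on directions has total mass 1.\<close>

lemma nn_integral_gauss_unit_ball:
  fixes P :: "real^'n^'n"
  assumes P: "orth_projection P" and tr: "trace P = real k"
  shows "(\<integral>\<^sup>+z. ennreal (gauss (P *v z)) * indicator (cball 0 1) (z - P *v z) \<partial>lborel) =
    ennreal (unit_ball_vol (real CARD('n) - real k))"
proof -
  obtain C :: "(real^'n) set" where C: "orthonormal C" "card C = CARD('n) - k" "k \<le> CARD('n)"
    "(\<integral>\<^sup>+z. ennreal (gauss (P *v z)) * indicator (cball 0 1) (z - P *v z) \<partial>lborel) =
      (\<integral>\<^sup>+t. indicator (cball 0 1) (\<Sum>c\<in>C. t c *\<^sub>R c) \<partial>Pi\<^sub>M C (\<lambda>_. lborel))"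
    using nn_integral_gauss_frame_compl[OF P tr, OF borel_measurable_indicator[OF cball_sets_borel]] by blast
  have "indicator (cball 0 1) (\<Sum>c\<in>C. t c *\<^sub>R c) = (indicator {t. (\<Sum>c\<in>C. (t c)\<^sup>2) \<le> 1} t :: ennreal)" for t
    using orthonormal_norm_sum[OF C(1), of t] abs_square_le_1[of "norm (\<Sum>c\<in>C. t c *\<^sub>R c)"]
    by (auto simp: indicator_def)
  then show ?thesis
    using C emeasure_PiM_cball[OF orthonormal_finite[OF C(1)], of 1] by (simp add: of_nat_diff)
qed

lemma section_volume_unit_ball:
  fixes P :: "real^'n^'n"
  assumes P: "orth_projection P" and tr: "trace P = real k" and y: "P *v y = 0"
  shows "section_volume (cball 0 1) P y =
    indicator (cball 0 1) y * ennreal (unit_ball_vol (real k) * sqrt (1 - (norm y)\<^sup>2) ^ k)"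
proof -
  obtain A where A: "orthonormal A" "P = frame_projection A"
    using orth_projection_frame[OF P] .
  have cA: "card A = k" using trace_frame_projection[OF A(1)] A(2) tr by simp
  have sp: "(norm (y + (\<Sum>a\<in>A. t a *\<^sub>R a)))\<^sup>2 = (norm y)\<^sup>2 + (\<Sum>a\<in>A. (t a)\<^sup>2)" for t
  proof -
    let ?x = "\<Sum>a\<in>A. t a *\<^sub>R a"
    have "P *v ?x = ?x"
      unfolding A(2) frame_projection_mult by (intro sum.cong) (simp_all add: orthonormal_inner_sum[OF A(1)])
    then have "y \<bullet> ?x = 0" using orth_projection_inner[OF P, of y ?x] y by simp
    then show ?thesis
      by (simp add: norm_add_Pythagorean orthogonal_def orthonormal_norm_sum[OF A(1)])
  qed
  have sv: "section_volume (cball 0 1) P y =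
      (\<integral>\<^sup>+t. indicator (cball 0 1) (y + (\<Sum>a\<in>A. t a *\<^sub>R a)) \<partial>Pi\<^sub>M A (\<lambda>_. lborel))"
    unfolding section_volume_def A(2) by (rule flat_integral_frame[OF A(1)]) measurable
  have iff: "y + (\<Sum>a\<in>A. t a *\<^sub>R a) \<in> cball 0 1 \<longleftrightarrow> (norm y)\<^sup>2 + (\<Sum>a\<in>A. (t a)\<^sup>2) \<le> 1" for t
    using abs_square_le_1[of "norm (y + (\<Sum>a\<in>A. t a *\<^sub>R a))"] by (simp add: sp)
  have iffy: "norm y \<le> 1 \<longleftrightarrow> (norm y)\<^sup>2 \<le> 1" using abs_square_le_1[of "norm y"] by simp
  show ?thesis
  proof (cases "norm y \<le> 1")
    case True
    then have y1: "(norm y)\<^sup>2 \<le> 1" by (simp add: iffy)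
    have "section_volume (cball 0 1) P y =
        (\<integral>\<^sup>+t. indicator {t. (\<Sum>a\<in>A. (t a)\<^sup>2) \<le> (sqrt (1 - (norm y)\<^sup>2))\<^sup>2} t \<partial>Pi\<^sub>M A (\<lambda>_. lborel))"
      unfolding sv using y1 by (intro nn_integral_cong) (auto simp: indicator_def iff simp del: mem_cball mem_cball_0)
    also have "\<dots> = ennreal (unit_ball_vol (real k) * sqrt (1 - (norm y)\<^sup>2) ^ k)"
      using y1 A(1) by (subst emeasure_PiM_cball) (auto simp: cA orthonormal_finite)
    finally show ?thesis using True by simp
  next
    case False
    have "\<not> (norm y)\<^sup>2 + (\<Sum>a\<in>A. (t a)\<^sup>2) \<le> 1" for t
      using False iffy sum_nonneg[of A "\<lambda>a. (t a)\<^sup>2"] by auto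
    then have "(indicator (cball 0 1) (y + (\<Sum>a\<in>A. t a *\<^sub>R a)) :: ennreal) = 0" for t
      by (auto simp: indicator_def iff simp del: mem_cball mem_cball_0)
    then show ?thesis unfolding sv using False by simp
  qed
qed

text \<open>Origin of the constant. A section at distance r from the centre is a k-dimensional ball
  of radius sqrt(1 - r^2). This gives \<kappa>_k^(m+1) times the integral, over the unit ball of the
  kernel, of that radius to the power k (m + 1), which is evaluated by slicing.\<close>

lemma section_volume_power_integral_unit_ball:
  fixes P :: "real^'n^'n"
  assumes P: "orth_projection P" and tr: "trace P = real k"
  shows "(\<integral>\<^sup>+w. indicator (cball 0 1) w * section_volume (cball 0 1) P w ^ m \<partial>lborel) =
    ennreal (unit_ball_vol (real k) ^ Suc m *
      (unit_ball_vol (real (CARD('n) - k + k * Suc m)) / unit_ball_vol (real (k * Suc m))))"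
proof -
  let ?V = "section_volume (cball 0 1) P"
  let ?\<kappa> = "unit_ball_vol (real k)"
  obtain C :: "(real^'n) set" where C: "orthonormal C" "card C = CARD('n) - k" "\<And>t. P *v (\<Sum>c\<in>C. t c *\<^sub>R c) = 0"
    "(\<integral>\<^sup>+z. ennreal (gauss (P *v z)) * ?V (z - P *v z) ^ Suc m \<partial>lborel) =
      (\<integral>\<^sup>+t. ?V (\<Sum>c\<in>C. t c *\<^sub>R c) ^ Suc m \<partial>Pi\<^sub>M C (\<lambda>_. lborel))"
  proof (rule nn_integral_gauss_frame_compl[OF P tr, of "\<lambda>y. ?V y ^ Suc m"])
    show "(\<lambda>y. ?V y ^ Suc m) \<in> borel_measurable borel" by measurable
  qed blast
  have fC: "finite C" using C(1) by (rule orthonormal_finite)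
  let ?q = "\<lambda>t. \<Sum>c\<in>C. (t c)\<^sup>2"
  have V: "?V (\<Sum>c\<in>C. t c *\<^sub>R c) ^ Suc m =
      ennreal (?\<kappa> ^ Suc m) * (indicator {t. ?q t \<le> 1} t * ennreal (sqrt (1 - ?q t) ^ (k * Suc m)))" for t
  proof -
    have iff: "(\<Sum>c\<in>C. t c *\<^sub>R c) \<in> cball 0 1 \<longleftrightarrow> ?q t \<le> 1"
      using abs_square_le_1[of "norm (\<Sum>c\<in>C. t c *\<^sub>R c)"] by (simp add: orthonormal_norm_sum[OF C(1)])
    show ?thesis
    proof (cases "?q t \<le> 1")
      case True
      then have "?V (\<Sum>c\<in>C. t c *\<^sub>R c) = ennreal (?\<kappa> * sqrt (1 - ?q t) ^ k)"
        unfolding section_volume_unit_ball[OF P tr C(3)] by (simp add: iff orthonormal_norm_sum[OF C(1)] del: mem_cball mem_cball_0)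
      then have "?V (\<Sum>c\<in>C. t c *\<^sub>R c) ^ Suc m = ennreal ((?\<kappa> * sqrt (1 - ?q t) ^ k) ^ Suc m)"
        using True by (simp only:) (rule ennreal_power, simp)
      also have "\<dots> = ennreal (?\<kappa> ^ Suc m * sqrt (1 - ?q t) ^ (k * Suc m))"
        by (simp only: power_mult_distrib power_mult)
      finally show ?thesis using True by (simp add: ennreal_mult')
    next
      case False
      then show ?thesis
        unfolding section_volume_unit_ball[OF P tr C(3)] by (simp add: iff del: mem_cball mem_cball_0)
    qed
  qed
  have "(\<integral>\<^sup>+w. indicator (cball 0 1) w * ?V w ^ m \<partial>lborel) =
      (\<integral>\<^sup>+t. ?V (\<Sum>c\<in>C. t c *\<^sub>R c) ^ Suc m \<partial>Pi\<^sub>M C (\<lambda>_. lborel))"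
    using section_volume_power_integral[OF P, of "cball 0 1" m] C(4) by simp
  also have "\<dots> = ennreal (?\<kappa> ^ Suc m) *
      (\<integral>\<^sup>+t. indicator {t. ?q t \<le> 1} t * ennreal (sqrt (1 - ?q t) ^ (k * Suc m)) \<partial>Pi\<^sub>M C (\<lambda>_. lborel))"
    unfolding V by (intro nn_integral_cmult) measurable
  also have "\<dots> = ennreal (?\<kappa> ^ Suc m) *
      ennreal (unit_ball_vol (real (card C + k * Suc m)) / unit_ball_vol (real (k * Suc m)))"
    by (simp only: nn_integral_PiM_ball_power[OF fC infinite_UNIV_vec])
  also have "\<dots> = ennreal (?\<kappa> ^ Suc m * (unit_ball_vol (real (card C + k * Suc m)) / unit_ball_vol (real (k * Suc m))))"
    by (rule ennreal_mult'[symmetric]) simp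
  finally show ?thesis by (simp only: C(2))
qed

section \<open>Invariant measures on the affine Grassmannian\<close>

definition foot :: "(real^'n) set \<Rightarrow> real^'n" where
  "foot E = closest_point E 0"

text \<open>The nearest-point map of a flat is affine, and its linear part is the orthogonal
  projection onto the direction space. Encoding the direction this way involves no choice of a
  frame.\<close>

definition direction :: "(real^'n) set \<Rightarrow> real^'n^'n" where
  "direction E = matrix (\<lambda>z. closest_point E z - foot E)"

text \<open>All data of a flat can be read off a pair (P, y). That y + P z is the point nearest to z
  is Pythagoras; the distance formula is what later makes P and y measurable functions of the
  flat.\<close>

lemma orth_projection_flat:
  fixes P :: "real^'n^'n"
  assumes P: "orth_projection P" and y: "P *v y = 0" and E: "E = range (\<lambda>x. y + P *v x)"
  shows "closest_point E z = y + P *v z" "foot E = y" "direction E = P"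
    "infdist z E = norm (z - P *v z - y)"
proof -
  have sub: "subspace (range ((*v) P))" by (auto intro: linear_subspace_image)
  have E': "E = (+) y ` range ((*v) P)" by (auto simp: E)
  have cl: "closed E" unfolding E' by (intro closed_translation closed_subspace sub)
  have cv: "convex E" unfolding E' by (intro convex_translation subspace_imp_convex sub)
  have le: "dist z (y + P *v z) \<le> dist z (y + P *v x)" for z x
  proof -
    have "z - (y + P *v x) = (z - P *v z - y) + P *v (z - x)"
      by (simp add: matrix_vector_mult_diff_distrib)
    moreover have "(z - P *v z - y) \<bullet> (P *v (z - x)) = 0"
      using orth_projection_inner_compl[OF P, of "z - x" z] orth_projection_inner[OF P, of "z - x" y] y
      by (simp add: inner_diff_left inner_commute inner_diff_right)
    ultimately have "(norm (z - (y + P *v x)))\<^sup>2 = (norm (z - P *v z - y))\<^sup>2 + (norm (P *v (z - x)))\<^sup>2"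
      by (simp only: norm_add_Pythagorean orthogonal_def)
    then have "(norm (z - (y + P *v z)))\<^sup>2 \<le> (norm (z - (y + P *v x)))\<^sup>2"
      by (simp add: algebra_simps)
    then show ?thesis unfolding dist_norm by (rule power2_le_imp_le) simp
  qed
  show cp: "closest_point E z = y + P *v z" for z
    by (rule closest_point_unique[symmetric, OF cv cl]) (auto simp: E le)
  show "foot E = y" by (simp add: foot_def cp)
  then show "direction E = P" by (simp add: direction_def cp)
  have "infdist z E = dist z (closest_point E z)"
    using setdist_closest_point[OF cl, of z] by (auto simp: infdist_eq_setdist E)
  then show "infdist z E = norm (z - P *v z - y)" by (simp add: cp dist_norm algebra_simps)
qed

lemma orthonormal_frame_flat:
  fixes E :: "(real^'n) set"
  assumes "orthonormal_frame E p B"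
  shows "orthonormal B" "direction E = frame_projection B" "foot E = p - frame_projection B *v p"
    "E = range (\<lambda>x. foot E + direction E *v x)" "direction E *v foot E = 0"
    "aff_dim E = int (card B)"
proof -
  let ?P = "frame_projection B"
  show B: "orthonormal B" using assms by (simp add: orthonormal_frame_def orthonormal_def)
  have P: "orth_projection ?P" using B by (rule orth_projection_frame_projection)
  have E: "E = (+) p ` span B" using assms by (simp add: orthonormal_frame_def)
  have y: "?P *v (p - ?P *v p) = 0"
    using P by (simp add: matrix_vector_mult_diff_distrib orth_projection_idem)
  have E': "E = range (\<lambda>x. (p - ?P *v p) + ?P *v x)"
  proof -
    have 1: "p + ?P *v x = p - ?P *v p + ?P *v (p + x)" and 2: "p - ?P *v p + ?P *v x = p + ?P *v (x - p)" for x
      by (simp_all add: matrix_vector_right_distrib matrix_vector_mult_diff_distrib)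
    show ?thesis
      unfolding E range_frame_projection[OF B, symmetric] image_image
    proof (intro equalityI image_subsetI)
      fix x show "p + ?P *v x \<in> range (\<lambda>x. p - ?P *v p + ?P *v x)" unfolding 1 by (rule rangeI)
      show "p - ?P *v p + ?P *v x \<in> range (\<lambda>x. p + ?P *v x)" unfolding 2 by (rule rangeI)
    qed
  qed
  show d: "direction E = ?P" and f: "foot E = p - ?P *v p"
    using orth_projection_flat[OF P y E'] by auto
  show "E = range (\<lambda>x. foot E + direction E *v x)" unfolding d f by (rule E')
  show "direction E *v foot E = 0" unfolding d f by (rule y)
  have "independent B"
    using B by (intro pairwise_orthogonal_independent) (auto simp: orthonormal_def)
  then show "aff_dim E = int (card B)"
    unfolding E by (simp add: aff_dim_translation_eq aff_dim_subspace dim_eq_card_independent)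
qed

lemma affine_grassmannian_flat:
  assumes E: "E \<in> affine_grassmannian k"
  shows "orth_projection (direction E)" "trace (direction E) = real k" "direction E *v foot E = 0"
    "E = range (\<lambda>x. foot E + direction E *v x)"
proof -
  have "affine E" "E \<noteq> {}" using E by (auto simp: affine_grassmannian_def)
  then obtain p B where f: "orthonormal_frame E p B" using orthonormal_frame_exists by blast
  have c: "card B = k" using orthonormal_frame_flat(6)[OF f] E by (simp add: affine_grassmannian_def)
  show "orth_projection (direction E)" "trace (direction E) = real k" "direction E *v foot E = 0"
    "E = range (\<lambda>x. foot E + direction E *v x)"
    using orthonormal_frame_flat[OF f] c
    by (simp_all add: orth_projection_frame_projection trace_frame_projection)
qed

text \<open>Whichever frame the choice operator in \<open>flat_lborel\<close> returns, it is a frame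
  of \<open>E\<close> and determines the same projection, so the value depends on the flat
  alone.\<close>

lemma emeasure_flat_lborel:
  assumes E: "E \<in> affine_grassmannian k" and [measurable]: "S \<in> sets borel"
  shows "emeasure (flat_lborel E) (S \<inter> E) = section_volume S (direction E) (foot E)"
proof -
  have aE: "affine E" "E \<noteq> {}" using E by (auto simp: affine_grassmannian_def)
  define pB where "pB = (SOME (p, B). orthonormal_frame E p B)"
  obtain p B where pB: "pB = (p, B)" by fastforce
  have "case pB of (p, B) \<Rightarrow> orthonormal_frame E p B"
    unfolding pB_def using orthonormal_frame_exists[OF aE] by (intro someI_ex[of "\<lambda>(p, B). orthonormal_frame E p B"]) auto
  then have f: "orthonormal_frame E p B" by (simp add: pB)
  note F = orthonormal_frame_flat[OF f]
  have P: "orth_projection (direction E)" using F by (simp add: orth_projection_frame_projection)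
  let ?f = "\<lambda>t. p + (\<Sum>b\<in>B. t b *\<^sub>R b)"
  have fl: "flat_lborel E = distr (Pi\<^sub>M B (\<lambda>_. lborel)) borel ?f"
    unfolding flat_lborel_def pB_def[symmetric] pB by simp
  have [measurable]: "E \<in> sets borel"
    using aE(1) by (intro borel_closed affine_closed)
  have inE: "?f t \<in> E" for t
  proof -
    have "(\<Sum>b\<in>B. t b *\<^sub>R b) \<in> span B" by (intro span_sum span_scale span_base)
    then show ?thesis using f unfolding orthonormal_frame_def by auto
  qed
  have "emeasure (flat_lborel E) (S \<inter> E) = (\<integral>\<^sup>+x. indicator (S \<inter> E) x \<partial>flat_lborel E)"
    by (rule nn_integral_indicator[symmetric]) (simp add: fl)
  also have "\<dots> = (\<integral>\<^sup>+t. indicator S (?f t) \<partial>Pi\<^sub>M B (\<lambda>_. lborel))"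
    unfolding fl using inE by (subst nn_integral_distr) (auto simp: indicator_def)
  also have "\<dots> = section_volume S (direction E) p"
    unfolding section_volume_def F(2) by (rule flat_integral_frame[OF F(1), symmetric]) measurable
  \<comment> \<open>The base point of the chosen frame need not be the foot; the two differ by a
    vector along the flat, which leaves the section volume unchanged.\<close>
  also have "p = foot E + direction E *v p" by (simp add: F(2,3))
  also have "section_volume S (direction E) (foot E + direction E *v p) = section_volume S (direction E) (foot E)"
    by (rule section_volume_translate[OF P]) measurable
  finally show ?thesis .
qed

lemma borel_measurable_vecI:
  fixes f :: "'a \<Rightarrow> ('b::euclidean_space)^'n"
  assumes "\<And>i. (\<lambda>x. f x $ i) \<in> borel_measurable M"
  shows "f \<in> borel_measurable M"
proof -
  note [measurable] = assms
  have "f = (\<lambda>x. \<Sum>i\<in>UNIV. axis i (f x $ i))"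
    by (simp add: fun_eq_iff vec_eq_iff axis_def if_distrib cong: if_cong)
  moreover have "(axis i :: 'b \<Rightarrow> 'b^'n) \<in> borel_measurable borel" for i
  proof -
    have "linear (axis i :: 'b \<Rightarrow> 'b^'n)"
      by (intro linearI) (auto simp: axis_def vec_eq_iff)
    then have "bounded_linear (axis i :: 'b \<Rightarrow> 'b^'n)" by (simp add: linear_conv_bounded_linear)
    then show ?thesis
      by (intro borel_measurable_continuous_onI linear_continuous_on)
  qed
  then have "(\<lambda>x. \<Sum>i\<in>UNIV. axis i (f x $ i)) \<in> borel_measurable M" by measurable
  ultimately show ?thesis by simp
qed

lemma matrix_vector_mult_neg: "A *v (- x) = - (A *v x)"
  for A :: "real^'n^'m"
  by (metis matrix_vector_mult_diff_distrib matrix_vector_mult_0_right diff_0)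

lemma borel_measurable_vec_nth [measurable (raw)]:
  fixes f :: "'a \<Rightarrow> 'b::euclidean_space^'n"
  assumes "f \<in> borel_measurable M"
  shows "(\<lambda>x. f x $ i) \<in> borel_measurable M"
  using assms by (rule measurable_compose) (intro borel_measurable_continuous_onI continuous_intros)

lemma borel_measurable_matrix_vector_mult' [measurable (raw)]:
  fixes A :: "'a \<Rightarrow> real^'n^'m"
  assumes [measurable]: "A \<in> borel_measurable M" "x \<in> borel_measurable M"
  shows "(\<lambda>\<omega>. A \<omega> *v x \<omega>) \<in> borel_measurable M"
proof (rule borel_measurable_vecI)
  show "(\<lambda>\<omega>. (A \<omega> *v x \<omega>) $ i) \<in> borel_measurable M" for i
    unfolding matrix_vector_mult_def by simp
qed

lemma borel_measurable_matrix_mult [measurable (raw)]: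
  fixes A :: "'a \<Rightarrow> real^'n^'m" and B :: "'a \<Rightarrow> real^'l^'n"
  assumes [measurable]: "A \<in> borel_measurable M" "B \<in> borel_measurable M"
  shows "(\<lambda>\<omega>. A \<omega> ** B \<omega>) \<in> borel_measurable M"
proof (intro borel_measurable_vecI)
  show "(\<lambda>\<omega>. (A \<omega> ** B \<omega>) $ i $ j) \<in> borel_measurable M" for i j
    unfolding matrix_matrix_mult_def by simp
qed

section \<open>Measurable coordinates, invariance and disintegration of \<mu>\<close>

context
  fixes k :: nat and \<mu> :: "(real^'n) set measure"
  assumes mu: "is_affine_grassmannian_measure k \<mu>"
begin

lemma sets_mu: "sets \<mu> = sets (affine_grassmannian_borel k)"
  using mu by (simp add: is_affine_grassmannian_measure_def)

lemma space_mu: "space \<mu> = affine_grassmannian k"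
  using sets_eq_imp_space_eq[OF sets_mu] by (simp add: space_affine_grassmannian_borel)

lemma open_sets_mu:
  assumes "openin (affine_grassmannian_topology k) W"
  shows "W \<in> sets \<mu>"
proof -
  have "{W. openin (affine_grassmannian_topology k) W} \<subseteq> Pow (affine_grassmannian k)"
    using openin_subset topspace_affine_grassmannian_topology by fastforce
  then show ?thesis
    unfolding sets_mu affine_grassmannian_borel_def using assms by (intro in_measure_of) auto
qed

lemma hit_sets_mu:
  assumes "open U"
  shows "{E \<in> space \<mu>. E \<inter> U \<noteq> {}} \<in> sets \<mu>"
  unfolding space_mu
  by (intro open_sets_mu, unfold affine_grassmannian_topology_def, intro topology_generated_by_Basis)
    (use assms in blast)

text \<open>A flat meets an open ball exactly when its distance from the centre is below the radius,
  and the flats hitting an open set form an open set of the Fell topology. Distances thus give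
  numerical access to a sigma-algebra defined without coordinates.\<close>

lemma measurable_infdist_mu: "infdist z \<in> borel_measurable \<mu>"
proof (rule borel_measurable_iff_less[THEN iffD2], intro allI)
  fix r :: real
  have "infdist z E < r \<longleftrightarrow> E \<inter> ball z r \<noteq> {}" if "E \<in> space \<mu>" for E
  proof -
    have ne: "E \<noteq> {}" using that by (auto simp: space_mu affine_grassmannian_def)
    show ?thesis
    proof
      assume "infdist z E < r"
      then obtain a where "a \<in> E" "dist z a < r"
        using cINF_less_iff[of E "dist z" r] ne by (auto simp: infdist_notempty intro: bdd_belowI2[of _ 0])
      then show "E \<inter> ball z r \<noteq> {}" by auto
    next
      assume "E \<inter> ball z r \<noteq> {}"
      then show "infdist z E < r" by (auto intro: le_less_trans[OF infdist_le])
    qed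
  qed
  then have "{E \<in> space \<mu>. infdist z E < r} = {E \<in> space \<mu>. E \<inter> ball z r \<noteq> {}}" by blast
  then show "{E \<in> space \<mu>. infdist z E < r} \<in> sets \<mu>" by (simp add: hit_sets_mu)
qed

lemma flat_mu:
  assumes "E \<in> space \<mu>"
  shows "orth_projection (direction E)" "trace (direction E) = real k" "direction E *v foot E = 0"
    "E = range (\<lambda>x. foot E + direction E *v x)"
  using affine_grassmannian_flat[of E k] assms by (simp_all add: space_mu)

text \<open>
  The squared distance to a flat is the quadratic polynomial
  \<open>|z|\<^sup>2 - z \<bullet> P z - 2 z \<bullet> y + |y|\<^sup>2\<close>, from which \<open>P\<close> and \<open>y\<close> are recovered by polarization.
\<close>
lemma infdist_flat_mu:
  assumes "E \<in> space \<mu>"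
  shows "(infdist z E)\<^sup>2 = z \<bullet> z - z \<bullet> (direction E *v z) - 2 * (z \<bullet> foot E) + foot E \<bullet> foot E"
proof -
  let ?P = "direction E" and ?y = "foot E"
  note F = flat_mu[OF assms]
  have "(infdist z E)\<^sup>2 = (z - ?P *v z - ?y) \<bullet> (z - ?P *v z - ?y)"
    unfolding orth_projection_flat(4)[OF F(1,3,4)] power2_norm_eq_inner ..
  moreover have "(?P *v z) \<bullet> ?y = 0" using orth_projection_inner[OF F(1), of z ?y] F(3) by simp
  moreover have "(?P *v z) \<bullet> (?P *v z) = z \<bullet> (?P *v z)"
    using orth_projection_inner[OF F(1), of z "?P *v z"] orth_projection_idem[OF F(1), of z] by simp
  ultimately show ?thesis
    by (simp add: inner_diff_left inner_diff_right inner_commute)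
qed

lemma measurable_foot_mu [measurable]: "foot \<in> borel_measurable \<mu>"
proof (rule borel_measurable_vecI)
  fix i :: 'n
  note [measurable] = measurable_infdist_mu
  \<comment> \<open>Only the term -2 (z \<bullet> y) of the quadratic polynomial is odd in z, so its
    values at -e_i and e_i differ by 4 y_i.\<close>
  have "(\<lambda>E. ((infdist (- axis i 1) E)\<^sup>2 - (infdist (axis i 1) E)\<^sup>2) / 4) \<in> borel_measurable \<mu>"
    by measurable
  moreover have "((infdist (- axis i 1) E)\<^sup>2 - (infdist (axis i 1) E)\<^sup>2) / 4 = foot E $ i"
    if "E \<in> space \<mu>" for E
    using that by (simp add: infdist_flat_mu inner_axis' matrix_vector_mult_neg)
  ultimately show "(\<lambda>E. foot E $ i) \<in> borel_measurable \<mu>"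
    by (simp cong: measurable_cong)
qed

lemma measurable_direction_mu [measurable]: "direction \<in> borel_measurable \<mu>"
proof (intro borel_measurable_vecI)
  fix i j :: 'n
  note [measurable] = measurable_infdist_mu
  let ?q = "\<lambda>z E. (infdist z E)\<^sup>2 :: real"
  let ?a = "axis i 1 + axis j 1 :: real^'n" and ?b = "axis i 1 - axis j 1 :: real^'n"
  \<comment> \<open>Adding the values at z and -z removes the linear term, and the difference
    between u + v and u - v removes the constant. Polarization leaves 8 (u \<bullet> v - u \<bullet>
    P v), here with u = e_i and v = e_j.\<close>
  let ?r = "\<lambda>E. axis i 1 \<bullet> (axis j 1 :: real^'n) - (?q ?a E + ?q (- ?a) E - ?q ?b E - ?q (- ?b) E) / 8"
  have "?r \<in> borel_measurable \<mu>" by measurable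
  moreover have "?r E = direction E $ i $ j" if E: "E \<in> space \<mu>" for E
  proof -
    let ?P = "direction E"
    have pol: "u \<bullet> v - (?q (u + v) E + ?q (- (u + v)) E - ?q (u - v) E - ?q (- (u - v)) E) / 8 = u \<bullet> (?P *v v)"
      for u v :: "real^'n"
    proof -
      have sym: "v \<bullet> (?P *v u) = u \<bullet> (?P *v v)"
        using orth_projection_inner[OF flat_mu(1)[OF E], of u v] by (simp add: inner_commute)
      show ?thesis
        unfolding infdist_flat_mu[OF E] matrix_vector_mult_neg matrix_vector_right_distrib matrix_vector_mult_diff_distrib
          inner_add_left inner_add_right inner_diff_left inner_diff_right inner_minus_left inner_minus_right sym inner_commute[of v u]
        by (simp add: diff_divide_distrib)
    qed
    then have "?r E = axis i 1 \<bullet> (?P *v axis j 1)" .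
    also have "\<dots> = ?P $ i $ j"
      by (simp add: inner_axis' matrix_vector_mul_component inner_axis)
    finally show ?thesis .
  qed
  ultimately show "(\<lambda>E. direction E $ i $ j) \<in> borel_measurable \<mu>"
    using measurable_cong[of \<mu> ?r "\<lambda>E. direction E $ i $ j" borel] by blast
qed


lemma compact_hit_sets_mu:
  assumes "compact C"
  shows "{E \<in> space \<mu>. E \<inter> C \<noteq> {}} \<in> sets \<mu>"
proof -
  have "{E \<in> space \<mu>. E \<inter> C = {}} \<in> sets \<mu>"
    unfolding space_mu
    by (intro open_sets_mu, unfold affine_grassmannian_topology_def, intro topology_generated_by_Basis)
      (use assms in blast)
  then have "space \<mu> - {E \<in> space \<mu>. E \<inter> C = {}} \<in> sets \<mu>" by (rule sets.compl_sets)
  also have "space \<mu> - {E \<in> space \<mu>. E \<inter> C = {}} = {E \<in> space \<mu>. E \<inter> C \<noteq> {}}" by auto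
  finally show ?thesis .
qed

text \<open>The action of a rigid motion in the coordinates (P, y): P is conjugated, and only the
  component of \<open>v\<close> orthogonal to the rotated direction moves the foot.\<close>

lemma rigid_motion_flat:
  fixes Q :: "real^'n^'n" and v :: "real^'n"
  assumes Q: "orthogonal_matrix Q" and E: "E \<in> space \<mu>"
  defines "g \<equiv> \<lambda>x. Q *v x + v"
  shows "g ` E \<in> space \<mu>" "direction (g ` E) = Q ** direction E ** transpose Q"
    "foot (g ` E) = Q *v foot E + (v - (Q ** direction E ** transpose Q) *v v)"
proof -
  let ?P = "direction E" and ?y = "foot E"
  let ?P' = "Q ** ?P ** transpose Q"
  let ?y' = "Q *v ?y + (v - ?P' *v v)"
  note F = flat_mu[OF E]
  have QQ: "transpose Q ** Q = mat 1" "Q ** transpose Q = mat 1"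
    using Q by (auto simp: orthogonal_matrix_def)
  have QQv: "transpose Q *v (Q *v x) = x" "Q *v (transpose Q *v x) = x" for x
    by (simp_all only: matrix_vector_mul_assoc QQ matrix_vector_mul_lid)
  have P'v: "?P' *v x = Q *v (?P *v (transpose Q *v x))" for x
    by (simp only: matrix_vector_mul_assoc matrix_mul_assoc)
  have "transpose ?P' = ?P'"
    using F(1) by (simp add: orth_projection_def matrix_transpose_mul matrix_mul_assoc)
  moreover have "?P' ** ?P' = ?P'"
  proof -
    have "?P' *v (?P' *v x) = ?P' *v x" for x
      by (simp only: P'v QQv orth_projection_idem[OF F(1)])
    then show ?thesis by (simp add: matrix_eq del: transpose_matrix_vector flip: matrix_vector_mul_assoc)
  qed
  ultimately have P': "orth_projection ?P'" by (simp add: orth_projection_def)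
  have y': "?P' *v ?y' = 0"
    unfolding matrix_vector_right_distrib matrix_vector_mult_diff_distrib orth_projection_idem[OF P']
    by (simp only: P'v QQv F(3)) simp
  have gE: "g ` E = range (\<lambda>x. ?y' + ?P' *v x)"
  proof -
    have 1: "g (?y + ?P *v x) = ?y' + ?P' *v (v + Q *v x)" for x
      unfolding g_def matrix_vector_right_distrib P'v QQv by simp
    have 2: "?y' + ?P' *v x = g (?y + ?P *v (transpose Q *v (x - v)))" for x
      unfolding g_def matrix_vector_right_distrib matrix_vector_mult_diff_distrib P'v QQv by simp
    have "g ` range (\<lambda>x. ?y + ?P *v x) = range (\<lambda>x. ?y' + ?P' *v x)"
      unfolding image_image
    proof (intro equalityI image_subsetI)
      fix x show "g (?y + ?P *v x) \<in> range (\<lambda>x. ?y' + ?P' *v x)" unfolding 1 by (rule rangeI)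
      show "?y' + ?P' *v x \<in> range (\<lambda>x. g (?y + ?P *v x))" unfolding 2 by (rule rangeI)
    qed
    then show ?thesis using F(4) by simp
  qed
  show "direction (g ` E) = ?P'" "foot (g ` E) = ?y'"
    using orth_projection_flat[OF P' y' gE] by auto
  have inj: "inj ((*v) Q)" using QQv(1) by (metis injI)
  have "g ` E = (+) v ` ((*v) Q ` E)" by (auto simp: g_def image_image add.commute)
  moreover have "aff_dim E = int k" using E by (auto simp: space_mu affine_grassmannian_def)
  moreover have "affine (g ` E)"
  proof -
    have "g ` E = (+) ?y' ` range ((*v) ?P')" by (auto simp: gE)
    moreover have "affine (range ((*v) ?P'))"
      by (intro subspace_imp_affine linear_subspace_image) auto
    ultimately show ?thesis by (simp only: affine_translation[symmetric])
  qed
  ultimately show "g ` E \<in> space \<mu>"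
    using inj by (simp add: space_mu affine_grassmannian_def aff_dim_translation_eq
        aff_dim_injective_linear_image)
qed

text \<open>Invariance of \<mu> is stated for images of sets of flats, whereas measurable sets arise
  as preimages; converting one into the other needs the motion to act surjectively.\<close>

lemma rigid_motion_bij_mu:
  assumes Q: "orthogonal_matrix (Q :: real^'n^'n)" and E: "E \<in> space \<mu>"
  obtains E' where "E' \<in> space \<mu>" "(\<lambda>x. Q *v x + v) ` E' = E"
proof
  let ?h = "\<lambda>x. transpose Q *v x + (- (transpose Q *v v))"
  have QQ: "Q ** transpose Q = mat 1"
    using Q by (auto simp: orthogonal_matrix_def)
  have QQv: "Q *v (transpose Q *v x) = x" for x
    by (simp only: matrix_vector_mul_assoc QQ matrix_vector_mul_lid)
  show "?h ` E \<in> space \<mu>"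
    using Q by (intro rigid_motion_flat(1) E) (auto simp: orthogonal_matrix_transpose)
  have "(\<lambda>x. Q *v x + v) (?h x) = x" for x
    by (simp only: matrix_vector_right_distrib matrix_vector_mult_neg QQv) simp
  then show "(\<lambda>x. Q *v x + v) ` (?h ` E) = E"
    by (simp only: image_image) simp
qed

text \<open>Invariance of \<mu> passes to the joint image measure under direction and foot: the
  motion carries the set of flats whose moved coordinates lie in S onto the set of flats whose own
  coordinates lie in S.\<close>

lemma nn_integral_mu_rigid_motion:
  fixes Q :: "real^'n^'n"
  assumes Q: "rotation_matrix Q" and f[measurable]: "f \<in> borel_measurable (borel \<Otimes>\<^sub>M borel)"
  shows "(\<integral>\<^sup>+E. f (Q ** direction E ** transpose Q,
      Q *v foot E + (v - (Q ** direction E ** transpose Q) *v v)) \<partial>\<mu>) = (\<integral>\<^sup>+E. f (direction E, foot E) \<partial>\<mu>)"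
proof -
  let ?B = "borel \<Otimes>\<^sub>M borel :: ((real^'n^'n) \<times> (real^'n)) measure"
  let ?Z = "\<lambda>E. (direction E, foot E)"
  let ?A = "\<lambda>E. (Q ** direction E ** transpose Q, Q *v foot E + (v - (Q ** direction E ** transpose Q) *v v))"
  let ?g = "\<lambda>x. Q *v x + v"
  have oQ: "orthogonal_matrix Q" using Q by (simp add: rotation_matrix_def)
  have [measurable]: "(\<lambda>E. Q ** direction E ** transpose Q) \<in> borel_measurable \<mu>"
    by measurable
  have A: "?A \<in> \<mu> \<rightarrow>\<^sub>M ?B" by measurable
  have Z: "?Z \<in> \<mu> \<rightarrow>\<^sub>M ?B" by measurable
  have AZ: "?A E = ?Z (?g ` E)" if "E \<in> space \<mu>" for E
    using rigid_motion_flat[OF oQ that, of v] by simp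
  have "distr \<mu> ?B ?A = distr \<mu> ?B ?Z"
  proof (rule measure_eqI)
    fix S assume "S \<in> sets (distr \<mu> ?B ?A)"
    then have S: "S \<in> sets ?B" by simp
    let ?W = "?A -` S \<inter> space \<mu>"
    have W: "?W \<in> sets \<mu>" using measurable_sets[OF A S] .
    have "(\<lambda>E. ?g ` E) ` ?W = ?Z -` S \<inter> space \<mu>"
    proof (intro equalityI subsetI)
      fix E assume "E \<in> (\<lambda>E. ?g ` E) ` ?W"
      then obtain E0 where "E0 \<in> ?W" "E = ?g ` E0" by blast
      then show "E \<in> ?Z -` S \<inter> space \<mu>"
        using AZ[of E0] rigid_motion_flat(1)[OF oQ, of E0 v] by auto
    next
      fix E assume E: "E \<in> ?Z -` S \<inter> space \<mu>"
      then obtain E0 where E0: "E0 \<in> space \<mu>" "?g ` E0 = E"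
        using rigid_motion_bij_mu[OF oQ] by blast
      then have "?A E0 = ?Z E" using AZ[of E0] by (simp only:)
      then have "E0 \<in> ?W" using E E0(1) by auto
      then show "E \<in> (\<lambda>E. ?g ` E) ` ?W" using E0(2) by blast
    qed
    moreover have "emeasure \<mu> ((\<lambda>E. ?g ` E) ` ?W) = emeasure \<mu> ?W"
    proof -
      have "rigid_motion ?g" using Q by (auto simp: rigid_motion_def)
      then show ?thesis using mu W by (auto simp: is_affine_grassmannian_measure_def)
    qed
    ultimately show "emeasure (distr \<mu> ?B ?A) S = emeasure (distr \<mu> ?B ?Z) S"
      using A Z S by (simp add: emeasure_distr)
  qed simp
  then have "(\<integral>\<^sup>+x. f x \<partial>distr \<mu> ?B ?A) = (\<integral>\<^sup>+x. f x \<partial>distr \<mu> ?B ?Z)" by simp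
  then show ?thesis using A Z f by (simp add: nn_integral_distr)
qed

lemma emeasure_hit_cball_mu:
  "emeasure \<mu> {E \<in> space \<mu>. E \<inter> cball a 1 \<noteq> {}} = ennreal (unit_ball_vol (real CARD('n) - real k))"
proof -
  let ?W = "{E \<in> space \<mu>. E \<inter> cball 0 1 \<noteq> {}}"
  let ?g = "\<lambda>x. mat 1 *v x + a"
  have o: "orthogonal_matrix (mat 1 :: real^'n^'n)" by (simp add: orthogonal_matrix_def transpose_mat)
  have "rigid_motion ?g" unfolding rigid_motion_def rotation_matrix_def
    using o by (intro exI[of _ "mat 1"] exI[of _ a]) simp
  then have "emeasure \<mu> ((\<lambda>E. ?g ` E) ` ?W) = emeasure \<mu> ?W"
    using mu compact_hit_sets_mu[of "cball 0 1"] by (auto simp: is_affine_grassmannian_measure_def)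
  moreover have "(\<lambda>E. ?g ` E) ` ?W = {E \<in> space \<mu>. E \<inter> cball a 1 \<noteq> {}}"
  proof (intro equalityI subsetI)
    fix E assume "E \<in> (\<lambda>E. ?g ` E) ` ?W"
    then obtain E0 where E0: "E0 \<in> ?W" "E = ?g ` E0" by blast
    then obtain x where x: "x \<in> E0" "norm x \<le> 1" by auto
    have E0s: "E0 \<in> space \<mu>" using E0(1) by blast
    then have "x + a \<in> E \<inter> cball a 1" using x E0(2) by (auto simp: dist_norm)
    then show "E \<in> {E \<in> space \<mu>. E \<inter> cball a 1 \<noteq> {}}"
      using rigid_motion_flat(1)[OF o E0s, of a] E0(2) by blast
  next
    fix E assume E: "E \<in> {E \<in> space \<mu>. E \<inter> cball a 1 \<noteq> {}}"
    then obtain E0 where E0: "E0 \<in> space \<mu>" "?g ` E0 = E"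
      using rigid_motion_bij_mu[OF o] by blast
    from E obtain x where x: "x \<in> E" "dist a x \<le> 1" by auto
    then obtain x0 where "x0 \<in> E0" "x = x0 + a" using E0(2) by auto
    then have "x0 \<in> E0 \<inter> cball 0 1" using x(2) by (simp add: dist_norm)
    then show "E \<in> (\<lambda>E. ?g ` E) ` ?W" using E0 by blast
  qed
  ultimately show ?thesis
    using mu by (simp add: is_affine_grassmannian_measure_def space_mu)
qed

text \<open>Every flat meets some unit ball centred in a countable dense set, and the flats meeting
  a given unit ball have the finite measure prescribed by the normalization, translated to its
  centre.\<close>

lemma sigma_finite_mu: "sigma_finite_measure \<mu>"
proof
  obtain D :: "(real^'n) set" where D: "countable D" "\<And>X. open X \<Longrightarrow> X \<noteq> {} \<Longrightarrow> \<exists>d\<in>D. d \<in> X"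
    using countable_dense_setE by blast
  let ?H = "\<lambda>d. {E \<in> space \<mu>. E \<inter> cball d 1 \<noteq> {}}"
  have "\<exists>d\<in>D. E \<in> ?H d" if "E \<in> space \<mu>" for E
  proof -
    have "E \<noteq> {}" using that by (auto simp: space_mu affine_grassmannian_def)
    then obtain x where "x \<in> E" by blast
    moreover obtain d where "d \<in> D" "d \<in> ball x 1" using D(2)[of "ball x 1"] by auto
    ultimately have "x \<in> E \<inter> cball d 1" by (auto simp: dist_commute intro: less_imp_le)
    then show ?thesis using that \<open>d \<in> D\<close> by blast
  qed
  then have "(\<Union>d\<in>D. ?H d) = space \<mu>" by blast
  moreover have "?H ` D \<subseteq> sets \<mu>" using compact_hit_sets_mu[OF compact_cball] by blast
  ultimately show "\<exists>A. countable A \<and> A \<subseteq> sets \<mu> \<and> \<Union> A = space \<mu> \<and> (\<forall>a\<in>A. emeasure \<mu> a \<noteq> \<infinity>)"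
    using D(1) by (intro exI[of _ "?H ` D"]) (auto simp: emeasure_hit_cball_mu)
qed

text \<open>Write y for the foot. After a shift of z the right side integrates gauss(y) gauss(P w)
  f(P, y + (w - P w)) over flats and over w. For fixed w the argument y + (w - P w) is the foot of
  the flat translated by w, so invariance turns it into y and moves w into the first weight. The two
  weights then form gauss(w - y), whose integral over w is 1.\<close>

lemma nn_integral_mu_disintegration:
  assumes f[measurable]: "f \<in> borel_measurable (borel \<Otimes>\<^sub>M borel)"
  shows "(\<integral>\<^sup>+E. f (direction E, foot E) \<partial>\<mu>) =
    (\<integral>\<^sup>+E. ennreal (gauss (foot E)) *
      (\<integral>\<^sup>+z. ennreal (gauss (direction E *v z)) * f (direction E, z - direction E *v z) \<partial>lborel) \<partial>\<mu>)"
proof -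
  interpret sigma_finite_measure \<mu> by (rule sigma_finite_mu)
  interpret pair_sigma_finite \<mu> "lborel :: (real^'n) measure" ..
  let ?g = "\<lambda>x. ennreal (gauss x)" and ?P = direction and ?y = foot
  have "(\<integral>\<^sup>+E. ?g (?y E) * (\<integral>\<^sup>+z. ?g (?P E *v z) * f (?P E, z - ?P E *v z) \<partial>lborel) \<partial>\<mu>) =
      (\<integral>\<^sup>+E. \<integral>\<^sup>+w. ?g (?y E) * (?g (?P E *v w) * f (?P E, ?y E + (w - ?P E *v w))) \<partial>lborel \<partial>\<mu>)"
  proof (rule nn_integral_cong)
    fix E assume E: "E \<in> space \<mu>"
    have "(\<integral>\<^sup>+z. ?g (?P E *v z) * f (?P E, z - ?P E *v z) \<partial>lborel) =
        (\<integral>\<^sup>+w. ?g (?P E *v (w + ?y E)) * f (?P E, w + ?y E - ?P E *v (w + ?y E)) \<partial>lborel)"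
      by (rule nn_integral_lborel_translate[symmetric]) measurable
    also have "\<dots> = (\<integral>\<^sup>+w. ?g (?P E *v w) * f (?P E, ?y E + (w - ?P E *v w)) \<partial>lborel)"
      by (simp add: flat_mu(3)[OF E] algebra_simps)
    finally show "?g (?y E) * (\<integral>\<^sup>+z. ?g (?P E *v z) * f (?P E, z - ?P E *v z) \<partial>lborel) =
        (\<integral>\<^sup>+w. ?g (?y E) * (?g (?P E *v w) * f (?P E, ?y E + (w - ?P E *v w))) \<partial>lborel)"
      by (simp add: nn_integral_cmult)
  qed
  also have "\<dots> = (\<integral>\<^sup>+w. \<integral>\<^sup>+E. ?g (?y E) * (?g (?P E *v w) * f (?P E, ?y E + (w - ?P E *v w))) \<partial>\<mu> \<partial>lborel)"
    by (rule Fubini'[symmetric]) measurable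
  also have "\<dots> = (\<integral>\<^sup>+w. \<integral>\<^sup>+E. ?g (?y E - (w - ?P E *v w)) * (?g (?P E *v w) * f (?P E, ?y E)) \<partial>\<mu> \<partial>lborel)"
  proof (rule nn_integral_cong)
    fix w :: "real^'n"
    let ?F = "\<lambda>(P, y). ?g (y - (w - P *v w)) * (?g (P *v w) * f (P, y))"
    have [measurable]: "?F \<in> borel_measurable (borel \<Otimes>\<^sub>M borel)" by measurable
    \<comment> \<open>The motion is the translation by w alone, with trivial rotation.\<close>
    have r: "rotation_matrix (mat 1 :: real^'n^'n)"
      by (simp add: rotation_matrix_def orthogonal_matrix_def transpose_mat)
    show "(\<integral>\<^sup>+E. ?g (?y E) * (?g (?P E *v w) * f (?P E, ?y E + (w - ?P E *v w))) \<partial>\<mu>) =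
        (\<integral>\<^sup>+E. ?g (?y E - (w - ?P E *v w)) * (?g (?P E *v w) * f (?P E, ?y E)) \<partial>\<mu>)"
      using nn_integral_mu_rigid_motion[OF r, of ?F w] by (simp add: transpose_mat)
  qed
  also have "\<dots> = (\<integral>\<^sup>+E. \<integral>\<^sup>+w. ?g (?y E - (w - ?P E *v w)) * (?g (?P E *v w) * f (?P E, ?y E)) \<partial>lborel \<partial>\<mu>)"
    by (rule Fubini') measurable
  also have "\<dots> = (\<integral>\<^sup>+E. f (?P E, ?y E) \<partial>\<mu>)"
  proof (rule nn_integral_cong)
    fix E assume E: "E \<in> space \<mu>"
    note F = flat_mu[OF E]
    \<comment> \<open>w - P w - y lies in the kernel and P w in the range, so the two weights
      multiply to one Gaussian in w centred at the foot.\<close>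
    have g: "?g (?y E - (w - ?P E *v w)) * (?g (?P E *v w) * f (?P E, ?y E)) = ?g (w + - ?y E) * f (?P E, ?y E)" for w
    proof -
      have "(w - ?P E *v w - ?y E) \<bullet> (?P E *v w) = 0"
        using orth_projection_inner_compl[OF F(1), of w w] orth_projection_inner[OF F(1), of w "?y E"] F(3)
        by (simp add: inner_diff_left inner_diff_right inner_commute)
      then have "gauss (w - ?P E *v w - ?y E + ?P E *v w) = gauss (w - ?P E *v w - ?y E) * gauss (?P E *v w)"
        by (rule gauss_add_orthogonal)
      then have "gauss (w + - ?y E) = gauss (?y E - (w - ?P E *v w)) * gauss (?P E *v w)"
        using gauss_minus[of "w - ?P E *v w - ?y E"] by (simp add: algebra_simps)
      then show ?thesis by (simp add: ennreal_mult' mult_ac)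
    qed
    have "(\<integral>\<^sup>+w. ?g (w + - ?y E) * f (?P E, ?y E) \<partial>lborel) = (\<integral>\<^sup>+w. ?g (w + - ?y E) \<partial>lborel) * f (?P E, ?y E)"
      by (rule nn_integral_multc) measurable
    also have "\<dots> = f (?P E, ?y E)"
      by (subst nn_integral_lborel_translate) (simp_all add: nn_integral_gauss)
    finally show "(\<integral>\<^sup>+w. ?g (?y E - (w - ?P E *v w)) * (?g (?P E *v w) * f (?P E, ?y E)) \<partial>lborel) = f (?P E, ?y E)"
      by (simp only: g)
  qed
  finally show ?thesis by (rule sym)
qed

text \<open>Apply the disintegration to the indicator of the flats that meet the unit ball, that is,
  whose foot lies in it. The inner integral is \<kappa>_(d-k) for every direction, and the left side
  has the same value by the normalization; this positive finite number cancels.\<close>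

lemma nn_integral_gauss_foot:
  assumes "k \<le> CARD('n)"
  shows "(\<integral>\<^sup>+E. ennreal (gauss (foot E)) \<partial>\<mu>) = 1"
proof -
  let ?\<kappa> = "unit_ball_vol (real CARD('n) - real k)"
  have \<kappa>: "?\<kappa> > 0" using assms by simp
  have iff: "E \<inter> cball 0 1 \<noteq> {} \<longleftrightarrow> foot E \<in> cball 0 1" if E: "E \<in> space \<mu>" for E
  proof
    note F = flat_mu[OF E]
    assume "E \<inter> cball 0 1 \<noteq> {}"
    then obtain x where "x \<in> E" "norm x \<le> 1" by auto
    moreover have "infdist 0 E = norm (foot E)"
      using orth_projection_flat(4)[OF F(1,3,4), of 0] by simp
    ultimately show "foot E \<in> cball 0 1" using infdist_le[of x E 0] by simp
  next
    note F = flat_mu[OF E]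
    assume "foot E \<in> cball 0 1"
    moreover have "foot E \<in> E"
      using F(4) by (metis add.right_neutral matrix_vector_mult_0_right rangeI)
    ultimately show "E \<inter> cball 0 1 \<noteq> {}" by blast
  qed
  have "ennreal ?\<kappa> = (\<integral>\<^sup>+E. indicator {E \<in> space \<mu>. E \<inter> cball 0 1 \<noteq> {}} E \<partial>\<mu>)"
    using emeasure_hit_cball_mu[of 0] compact_hit_sets_mu[of "cball 0 1"] by simp
  also have "\<dots> = (\<integral>\<^sup>+E. (\<lambda>(P :: real^'n^'n, y). indicator (cball 0 1) y) (direction E, foot E) \<partial>\<mu>)"
    by (intro nn_integral_cong) (auto simp: iff indicator_def)
  also have "\<dots> = (\<integral>\<^sup>+E. ennreal (gauss (foot E)) * ennreal ?\<kappa> \<partial>\<mu>)"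
    by (subst nn_integral_mu_disintegration)
      (measurable, auto intro!: nn_integral_cong simp: nn_integral_gauss_unit_ball[OF flat_mu(1,2)] simp del: mem_cball mem_cball_0)
  also have "\<dots> = (\<integral>\<^sup>+E. ennreal (gauss (foot E)) \<partial>\<mu>) * ennreal ?\<kappa>"
    by (rule nn_integral_multc) measurable
  finally have "1 * ennreal ?\<kappa> = (\<integral>\<^sup>+E. ennreal (gauss (foot E)) \<partial>\<mu>) * ennreal ?\<kappa>" by simp
  then show ?thesis
    using \<kappa> ennreal_mult_cancel_left[of "ennreal ?\<kappa>" 1 "\<integral>\<^sup>+E. ennreal (gauss (foot E)) \<partial>\<mu>"]
    by (simp add: mult.commute)
qed

end

section \<open>Calculus of determinants of compressions\<close>

text \<open>Dominated convergence: \<open>u'\<close> is bounded on the compact set [a, b] x K, so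
  the mean value inequality bounds all difference quotients by one constant, which is integrable
  because the measure is finite.\<close>

lemma has_real_derivative_integral_compact:
  fixes X :: "'a \<Rightarrow> 'b::euclidean_space" and u :: "real \<Rightarrow> 'b \<Rightarrow> real"
  assumes M: "finite_measure M" and X[measurable]: "X \<in> borel_measurable M"
    and K: "compact K" and XK: "\<And>\<omega>. \<omega> \<in> space M \<Longrightarrow> X \<omega> \<in> K"
    and deriv: "\<And>t x. t \<in> {a..b} \<Longrightarrow> x \<in> K \<Longrightarrow> ((\<lambda>t. u t x) has_real_derivative u' t x) (at t within {a..b})"
    and cont: "\<And>t. t \<in> {a..b} \<Longrightarrow> continuous_on K (u t)"
    and cont': "continuous_on ({a..b} \<times> K) (\<lambda>z. u' (fst z) (snd z))"
    and t: "t \<in> {a..b}"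
  shows "((\<lambda>t. LINT \<omega>|M. u t (X \<omega>)) has_real_derivative (LINT \<omega>|M. u' t (X \<omega>))) (at t within {a..b})"
proof -
  interpret finite_measure M by fact
  have [measurable]: "K \<in> sets borel" using K by (simp add: borel_compact)
  have meas: "(\<lambda>\<omega>. f (X \<omega>)) \<in> borel_measurable M" if "continuous_on K f" for f :: "'b \<Rightarrow> real"
  proof -
    \<comment> \<open>f is continuous on \<open>K\<close> only; its extension by zero is Borel and
      agrees with it along \<open>X\<close>.\<close>
    have "(\<lambda>x. indicator K x *\<^sub>R f x) \<in> borel_measurable borel"
      using that by (intro borel_measurable_continuous_on_indicator) auto
    then have "(\<lambda>\<omega>. indicator K (X \<omega>) *\<^sub>R f (X \<omega>)) \<in> borel_measurable M" by measurable
    moreover have "indicator K (X \<omega>) *\<^sub>R f (X \<omega>) = f (X \<omega>)" if "\<omega> \<in> space M" for \<omega>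
      using XK[OF that] by simp
    ultimately show ?thesis
      using measurable_cong[of M "\<lambda>\<omega>. indicator K (X \<omega>) *\<^sub>R f (X \<omega>)" "\<lambda>\<omega>. f (X \<omega>)" borel] by blast
  qed
  have int: "integrable M (\<lambda>\<omega>. f (X \<omega>))" if f: "continuous_on K f" for f :: "'b \<Rightarrow> real"
  proof -
    obtain B where "\<And>x. x \<in> K \<Longrightarrow> norm (f x) \<le> B"
      using compact_imp_bounded[OF compact_continuous_image[OF f K]] by (auto simp: bounded_iff)
    then show ?thesis using meas[OF f] XK by (intro integrable_const_bound[of _ B]) auto
  qed
  have cu': "continuous_on K (u' s)" if "s \<in> {a..b}" for s
    using that by (intro continuous_on_compose2[OF cont', of K "\<lambda>x. (s, x)", simplified] continuous_intros) auto
  have "compact ({a..b} \<times> K)" using K by (intro compact_Times) auto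
  from compact_imp_bounded[OF compact_continuous_image[OF cont' this]]
  obtain C where C: "\<And>s x. s \<in> {a..b} \<Longrightarrow> x \<in> K \<Longrightarrow> norm (u' s x) \<le> C"
    by (fastforce simp: bounded_iff)
  show ?thesis
    unfolding has_field_derivative_iff tendsto_at_iff_sequentially
  proof (intro allI impI)
    fix y :: "nat \<Rightarrow> real"
    assume y: "\<forall>i. y i \<in> {a..b} - {t}" and lim: "y \<longlonglongrightarrow> t"
    have ab: "y i \<in> {a..b}" "y i \<noteq> t" for i using y by auto
    let ?q = "\<lambda>i \<omega>. (u (y i) (X \<omega>) - u t (X \<omega>)) / (y i - t)"
    have "(\<lambda>i. LINT \<omega>|M. ?q i \<omega>) \<longlonglongrightarrow> (LINT \<omega>|M. u' t (X \<omega>))"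
    proof (rule integral_dominated_convergence[where w = "\<lambda>_. C"])
      show "(\<lambda>\<omega>. u' t (X \<omega>)) \<in> borel_measurable M" using t by (intro meas cu')
      show "?q i \<in> borel_measurable M" for i
        using meas[OF cont[OF t]] meas[OF cont[OF ab(1)[of i]]] by measurable
      show "integrable M (\<lambda>_. C)" by simp
      show "AE \<omega> in M. (\<lambda>i. ?q i \<omega>) \<longlonglongrightarrow> u' t (X \<omega>)"
      proof (rule AE_I2)
        fix \<omega> assume "\<omega> \<in> space M"
        then have "((\<lambda>s. (u s (X \<omega>) - u t (X \<omega>)) / (s - t)) \<longlongrightarrow> u' t (X \<omega>)) (at t within {a..b})"
          using deriv[OF t XK] by (simp add: has_field_derivative_iff)
        then show "(\<lambda>i. ?q i \<omega>) \<longlonglongrightarrow> u' t (X \<omega>)"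
          using y lim unfolding tendsto_at_iff_sequentially o_def by blast
      qed
      show "AE \<omega> in M. norm (?q i \<omega>) \<le> C" for i
      proof (rule AE_I2)
        fix \<omega> assume \<omega>: "\<omega> \<in> space M"
        have "norm (u (y i) (X \<omega>) - u t (X \<omega>)) \<le> C * norm (y i - t)"
          by (rule field_differentiable_bound[where S = "{a..b}" and f' = "\<lambda>s. u' s (X \<omega>)"])
            (use deriv C XK[OF \<omega>] ab t in auto)
        then show "norm (?q i \<omega>) \<le> C"
          using ab(2)[of i] by (simp add: divide_le_eq)
      qed
    qed
    moreover have "(LINT \<omega>|M. ?q i \<omega>) = ((LINT \<omega>|M. u (y i) (X \<omega>)) - (LINT \<omega>|M. u t (X \<omega>))) / (y i - t)" for i
      using int[OF cont[OF t]] int[OF cont[OF ab(1)[of i]]] by simp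
    ultimately show "((\<lambda>s. ((LINT \<omega>|M. u s (X \<omega>)) - (LINT \<omega>|M. u t (X \<omega>))) / (s - t)) \<circ> y) \<longlonglongrightarrow>
        (LINT \<omega>|M. u' t (X \<omega>))"
      by (simp only: o_def)
  qed
qed

section \<open>Matrix operations and the derivative of the determinant\<close>

lemma bounded_bilinear_matrix_mult:
  "bounded_bilinear ((**) :: real^'n^'m \<Rightarrow> real^'l^'n \<Rightarrow> real^'l^'m)"
  unfolding bilinear_conv_bounded_bilinear[symmetric] bilinear_def
  by (auto intro!: linearI simp: matrix_matrix_mult_def vec_eq_iff distrib_left distrib_right sum.distrib
      sum_distrib_left mult_ac)

interpretation matrix_mult: bounded_bilinear "(**) :: real^'n^'m \<Rightarrow> real^'l^'n \<Rightarrow> real^'l^'m"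
  by (rule bounded_bilinear_matrix_mult)

lemma bounded_linear_transpose: "bounded_linear (transpose :: real^'n^'m \<Rightarrow> real^'m^'n)"
  unfolding linear_conv_bounded_linear[symmetric]
  by (intro linearI) (simp_all add: transpose_def vec_eq_iff)

lemma bounded_linear_trace: "bounded_linear (trace :: real^'n^'n \<Rightarrow> real)"
  unfolding linear_conv_bounded_linear[symmetric]
  by (intro linearI) (simp_all add: trace_def sum.distrib sum_distrib_left)

lemma continuous_on_det [continuous_intros]:
  fixes A :: "'a::topological_space \<Rightarrow> real^'n^'n"
  shows "continuous_on S A \<Longrightarrow> continuous_on S (\<lambda>x. det (A x))"
  unfolding det_def by (intro continuous_intros)

text \<open>The Leibniz formula differentiated at A in direction C. As a polynomial in the entries
  it is continuous in both arguments, also at singular A.\<close>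

definition det_deriv :: "real^'n^'n \<Rightarrow> real^'n^'n \<Rightarrow> real" where
  "det_deriv A C = (\<Sum>p | p permutes UNIV. of_int (sign p) *
     (\<Sum>i\<in>UNIV. C $ i $ p i * (\<Prod>j\<in>UNIV - {i}. A $ j $ p j)))"

lemma continuous_on_det_deriv [continuous_intros]:
  assumes "continuous_on S A" "continuous_on S C"
  shows "continuous_on S (\<lambda>x. det_deriv (A x) (C x))"
  unfolding det_deriv_def by (intro continuous_intros assms)

lemma has_real_derivative_prod:
  fixes f :: "'i \<Rightarrow> real \<Rightarrow> real"
  assumes "\<And>i. i \<in> I \<Longrightarrow> (f i has_real_derivative f' i) (at t within S)"
  shows "((\<lambda>t. \<Prod>i\<in>I. f i t) has_real_derivative (\<Sum>i\<in>I. f' i * (\<Prod>j\<in>I - {i}. f j t))) (at t within S)"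
proof -
  have "((\<lambda>t. \<Prod>i\<in>I. f i t) has_derivative (\<lambda>y. \<Sum>i\<in>I. f' i * y * (\<Prod>j\<in>I - {i}. f j t))) (at t within S)"
    using assms by (intro has_derivative_prod) (simp add: has_field_derivative_def)
  moreover have "(\<lambda>y. \<Sum>i\<in>I. f' i * y * (\<Prod>j\<in>I - {i}. f j t)) = (*) (\<Sum>i\<in>I. f' i * (\<Prod>j\<in>I - {i}. f j t))"
    by (auto simp: fun_eq_iff sum_distrib_left sum_distrib_right mult_ac intro!: sum.cong)
  ultimately show ?thesis by (simp add: has_field_derivative_def)
qed

lemma has_vector_derivative_entry:
  fixes A :: "real \<Rightarrow> real^'n^'m"
  assumes "(A has_vector_derivative A') (at t within S)"
  shows "((\<lambda>t. A t $ i $ j) has_real_derivative A' $ i $ j) (at t within S)"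
proof -
  have "bounded_linear (\<lambda>M :: real^'n^'m. M $ i $ j)"
    unfolding linear_conv_bounded_linear[symmetric] by (intro linearI) auto
  from bounded_linear.has_vector_derivative[OF this assms]
  show ?thesis by (simp add: has_real_derivative_iff_has_vector_derivative)
qed

lemma has_real_derivative_det:
  fixes A :: "real \<Rightarrow> real^'n^'n"
  assumes "(A has_vector_derivative A') (at t within S)"
  shows "((\<lambda>t. det (A t)) has_real_derivative det_deriv (A t) A') (at t within S)"
  unfolding det_def det_deriv_def
  by (intro DERIV_sum DERIV_cmult has_real_derivative_prod has_vector_derivative_entry assms)

text \<open>A permutation other than the identity moves at least two points, so even with index i
  left out, an off-diagonal entry of the identity matrix remains in the product.\<close>

lemma det_deriv_one:
  fixes C :: "real^'n^'n"
  shows "det_deriv (mat 1) C = trace C"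
proof -
  have "(\<Sum>i\<in>UNIV. C $ i $ p i * (\<Prod>j\<in>UNIV - {i}. (mat 1 :: real^'n^'n) $ j $ p j)) = 0"
    if p: "p permutes UNIV" "p \<noteq> id" for p
  proof (intro sum.neutral ballI)
    fix i
    have "\<exists>j. j \<noteq> i \<and> p j \<noteq> j"
    proof (rule ccontr)
      assume *: "\<not> ?thesis"
      then have "p i = i"
        using p(1) by (metis permutes_def)
      with * have "p = id" by (auto simp: fun_eq_iff)
      then show False using p(2) by simp
    qed
    then obtain j where "j \<noteq> i" "p j \<noteq> j" by blast
    then have "\<exists>j\<in>UNIV - {i}. (mat 1 :: real^'n^'n) $ j $ p j = 0"
      by (intro bexI[of _ j]) (auto simp: mat_def)
    then have "(\<Prod>j\<in>UNIV - {i}. (mat 1 :: real^'n^'n) $ j $ p j) = 0"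
      by (intro prod_zero) auto
    then show "C $ i $ p i * (\<Prod>j\<in>UNIV - {i}. (mat 1 :: real^'n^'n) $ j $ p j) = 0" by simp
  qed
  then have "det_deriv (mat 1) C = (\<Sum>p\<in>{id}. of_int (sign p) *
     (\<Sum>i\<in>UNIV. C $ i $ p i * (\<Prod>j\<in>UNIV - {i}. (mat 1 :: real^'n^'n) $ j $ p j)))"
    unfolding det_deriv_def by (intro sum.mono_neutral_right) (auto simp: permutes_id)
  also have "\<dots> = trace C" by (simp add: trace_def mat_def sign_id)
  finally show ?thesis .
qed

lemma has_vector_derivative_line:
  "((\<lambda>t. A + t *\<^sub>R C) has_vector_derivative C) (at (t::real) within S)"
  by (auto intro!: derivative_eq_intros)

text \<open>Jacobi's formula. The factorization A + t C = A (1 + t W C) and uniqueness of the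
  derivative at t = 0 reduce it to the identity matrix.\<close>

lemma det_deriv_invertible:
  fixes A W C :: "real^'n^'n"
  assumes "A ** W = mat 1"
  shows "det_deriv A C = det A * trace (W ** C)"
proof -
  have "det (A + t *\<^sub>R C) = det A * det (mat 1 + t *\<^sub>R (W ** C))" for t
  proof -
    have "A ** (mat 1 + t *\<^sub>R (W ** C)) = A + t *\<^sub>R C"
      using assms by (simp add: matrix_mult.add_right matrix_mult.scaleR_right matrix_mul_assoc)
    then show ?thesis by (metis det_mul)
  qed
  moreover have "((\<lambda>t. det (A + t *\<^sub>R C)) has_real_derivative det_deriv A C) (at 0)"
    using has_real_derivative_det[OF has_vector_derivative_line, of A C 0 UNIV] by simp
  moreover have "((\<lambda>t. det A * det (mat 1 + t *\<^sub>R (W ** C))) has_real_derivative det A * trace (W ** C)) (at 0)"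
    using DERIV_cmult[OF has_real_derivative_det[OF has_vector_derivative_line, of "mat 1" "W ** C" 0 UNIV], of "det A"]
    by (simp add: det_deriv_one)
  ultimately show ?thesis using DERIV_unique by (metis (no_types, lifting) ext)
qed

section \<open>The Grassmannian as a compact set of matrices, and positive definite forms on
  it\<close>

definition grassmannian_projections :: "real \<Rightarrow> (real^'n^'n) set" where
  "grassmannian_projections \<kappa> = {P. orth_projection P \<and> trace P = \<kappa>}"

text \<open>The defining equations are closed conditions, and the sum of the squared entries of P is
  tr(P P^T) = tr P, which bounds the set.\<close>

lemma compact_grassmannian_projections: "compact (grassmannian_projections \<kappa> :: (real^'n^'n) set)"
proof -
  let ?K = "grassmannian_projections \<kappa> :: (real^'n^'n) set"
  have "?K = {P. transpose P = P} \<inter> {P. P ** P = P} \<inter> {P. trace P = \<kappa>}"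
    by (auto simp: grassmannian_projections_def orth_projection_def)
  moreover have "closed {P :: real^'n^'n. transpose P = P}"
    by (intro closed_Collect_eq continuous_intros linear_continuous_on bounded_linear_transpose)
  moreover have "closed {P :: real^'n^'n. P ** P = P}"
    by (intro closed_Collect_eq continuous_intros matrix_mult.continuous_on)
  moreover have "closed {P :: real^'n^'n. trace P = \<kappa>}"
    by (intro closed_Collect_eq continuous_intros linear_continuous_on bounded_linear_trace)
  ultimately have cl: "closed ?K" by (simp only: closed_Int)
  have "norm P \<le> sqrt \<kappa>" if "P \<in> ?K" for P
  proof -
    have "P \<bullet> P = trace (P ** transpose P)"
      by (simp add: inner_vec_def trace_def matrix_matrix_mult_def transpose_def)
    also have "\<dots> = \<kappa>" using that by (simp add: grassmannian_projections_def orth_projection_def)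
    finally show ?thesis by (simp add: norm_eq_sqrt_inner)
  qed
  then have "bounded ?K" by (auto simp: bounded_iff)
  with cl show ?thesis by (simp add: compact_eq_bounded_closed)
qed

definition pos_def :: "real^'n^'n \<Rightarrow> bool" where
  "pos_def G \<longleftrightarrow> transpose G = G \<and> (\<forall>x. x \<noteq> 0 \<longrightarrow> x \<bullet> (G *v x) > 0)"

lemma pos_def_one: "pos_def (mat 1)"
  by (simp add: pos_def_def transpose_mat)

lemma transpose_add: "transpose (A + B) = transpose A + transpose (B :: real^'n^'m)"
  by (simp add: transpose_def vec_eq_iff)

lemma transpose_diff: "transpose (A - B) = transpose A - transpose (B :: real^'n^'m)"
  by (simp add: transpose_def vec_eq_iff)

lemma transpose_scaleR: "transpose (c *\<^sub>R A) = c *\<^sub>R transpose (A :: real^'n^'m)"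
  by (simp add: transpose_def vec_eq_iff)

lemma pos_def_segment:
  fixes G H :: "real^'n^'n"
  assumes "pos_def G" "pos_def H" "0 \<le> s" "s \<le> 1"
  shows "pos_def (G + s *\<^sub>R (H - G))"
  unfolding pos_def_def
proof (intro conjI allI impI)
  show "transpose (G + s *\<^sub>R (H - G)) = G + s *\<^sub>R (H - G)"
    using assms by (simp add: pos_def_def transpose_add transpose_diff transpose_scaleR)
  fix x :: "real^'n" assume x: "x \<noteq> 0"
  have "x \<bullet> ((G + s *\<^sub>R (H - G)) *v x) = (1 - s) * (x \<bullet> (G *v x)) + s * (x \<bullet> (H *v x))"
    by (simp add: matrix_vector_mult_add_rdistrib matrix_vector_mult_diff_rdistrib inner_add_right
        inner_diff_right algebra_simps flip: scaleR_matrix_vector_assoc)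
  also have "\<dots> > 0"
  proof (cases "s = 0")
    case False
    have "0 < x \<bullet> (G *v x)" "0 < x \<bullet> (H *v x)" using assms(1,2) x by (auto simp: pos_def_def)
    then have "0 \<le> (1 - s) * (x \<bullet> (G *v x))" "0 < s * (x \<bullet> (H *v x))"
      using False assms(3,4) by auto
    then show ?thesis by linarith
  qed (use assms x in \<open>auto simp: pos_def_def\<close>)
  finally show "x \<bullet> ((G + s *\<^sub>R (H - G)) *v x) > 0" .
qed

text \<open>The quadratic form of the padded matrix at x is that of \<open>G\<close> at P x plus |x
  - P x|^2, which vanishes only at x = 0.\<close>

lemma stretch_nonzero:
  assumes G: "pos_def G" and P: "orth_projection P"
  shows "stretch G P \<noteq> 0"
proof -
  let ?B = "P ** G ** P + (mat 1 - P)"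
  have "x = 0" if "?B *v x = 0" for x
  proof -
    have "0 = x \<bullet> (?B *v x)" using that by simp
    also have "\<dots> = x \<bullet> (P *v (G *v (P *v x))) + x \<bullet> (x - P *v x)"
      by (simp only: matrix_vector_mult_add_rdistrib matrix_vector_mult_diff_rdistrib inner_add_right
          matrix_vector_mul_lid flip: matrix_vector_mul_assoc)
    also have "x \<bullet> (P *v (G *v (P *v x))) = (P *v x) \<bullet> (G *v (P *v x))"
      using orth_projection_inner[OF P] by metis
    also have "x \<bullet> (x - P *v x) = (x - P *v x) \<bullet> (x - P *v x)"
      using orth_projection_inner_compl[OF P, of x x] by (simp add: inner_diff_left)
    finally have *: "(P *v x) \<bullet> (G *v (P *v x)) + (x - P *v x) \<bullet> (x - P *v x) = 0" by simp
    have "P *v x = 0"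
    proof (rule ccontr)
      assume "P *v x \<noteq> 0"
      then have "(P *v x) \<bullet> (G *v (P *v x)) > 0" using G by (simp add: pos_def_def)
      then show False using * inner_ge_zero[of "x - P *v x"] by linarith
    qed
    then show "x = 0" using * by simp
  qed
  then have "invertible ?B"
    by (metis invertible_left_inverse matrix_left_invertible_ker)
  then show ?thesis by (simp add: stretch_def invertible_det_nz)
qed

text \<open>Along the segment from the identity to \<open>G\<close> the determinant starts at 1 and
  never vanishes, so by the intermediate value theorem it stays positive.\<close>

lemma stretch_pos:
  assumes G: "pos_def G" and P: "orth_projection P"
  shows "stretch G P > 0"
proof (rule ccontr)
  assume "\<not> stretch G P > 0"
  then have neg: "stretch G P \<le> 0" by simp
  let ?f = "\<lambda>s. stretch (mat 1 + s *\<^sub>R (G - mat 1)) P"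
  have "continuous_on {0..1} ?f"
    unfolding stretch_def by (intro continuous_intros matrix_mult.continuous_on)
  moreover have f0: "?f 0 = 1" using P by (simp add: stretch_def orth_projection_def)
  moreover have "?f 1 = stretch G P" by simp
  ultimately obtain s where "0 \<le> s" "s \<le> 1" "?f s = 0"
    using IVT2'[of ?f 1 0 0] neg by auto
  then show False using stretch_nonzero[OF pos_def_segment[OF pos_def_one G] P] by blast
qed

lemma pos_def_det_pos: "pos_def G \<Longrightarrow> det G > 0"
  using stretch_pos[of G "mat 1"] by (simp add: stretch_def orth_projection_def transpose_mat)

lemma pos_def_congruence:
  fixes G Q :: "real^'n^'n"
  assumes G: "pos_def G" and Q: "orthogonal_matrix Q"
  shows "pos_def (transpose Q ** G ** Q)"
  unfolding pos_def_def
proof (intro conjI allI impI)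
  show "transpose (transpose Q ** G ** Q) = transpose Q ** G ** Q"
    using G by (simp add: pos_def_def matrix_transpose_mul matrix_mul_assoc)
  fix x :: "real^'n" assume x: "x \<noteq> 0"
  have "transpose Q *v (Q *v x) = x"
    using Q by (simp only: matrix_vector_mul_assoc orthogonal_matrix_def matrix_vector_mul_lid)
  then have "Q *v x \<noteq> 0" using x by (metis matrix_vector_mult_0_right)
  moreover have "x \<bullet> (transpose Q *v y) = (Q *v x) \<bullet> y" for y
    by (metis dot_lmul_matrix inner_commute transpose_matrix_vector)
  ultimately show "x \<bullet> ((transpose Q ** G ** Q) *v x) > 0"
    using G by (simp only: matrix_vector_mul_assoc[symmetric]) (simp add: pos_def_def del: transpose_matrix_vector)
qed

text \<open>The padded matrices on the two sides are conjugate under \<open>Q\<close>. This moves a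
  rotation of the projection into the form, where the derivative of \<open>stretch\<close> is
  available.\<close>

lemma stretch_congruence:
  assumes Q: "orthogonal_matrix Q"
  shows "stretch G (Q ** P ** transpose Q) = stretch (transpose Q ** G ** Q) P"
proof -
  have QQ: "transpose Q ** Q = mat 1" "Q ** transpose Q = mat 1"
    using Q by (auto simp: orthogonal_matrix_def)
  have "(Q ** P ** transpose Q) ** G ** (Q ** P ** transpose Q) + (mat 1 - Q ** P ** transpose Q) =
      Q ** (P ** (transpose Q ** G ** Q) ** P + (mat 1 - P)) ** transpose Q"
    by (simp add: matrix_mult.add_left matrix_mult.add_right matrix_mult.diff_left matrix_mult.diff_right
        matrix_mul_assoc QQ)
  then have "stretch G (Q ** P ** transpose Q) = det Q * stretch (transpose Q ** G ** Q) P * det Q"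
    by (simp add: stretch_def det_mul)
  also have "det Q * det Q = 1"
    using arg_cong[OF QQ(1), of det] by (simp add: det_mul)
  then have "det Q * stretch (transpose Q ** G ** Q) P * det Q = stretch (transpose Q ** G ** Q) P"
    by (simp add: mult.commute mult.left_commute)
  finally show ?thesis .
qed

section \<open>The mean stretch factor of a linear map\<close>

definition unit_matrix :: "'n \<Rightarrow> 'n \<Rightarrow> real^'n^'n" where
  "unit_matrix i j = (\<chi> a b. if a = i \<and> b = j then 1 else 0)"

lemma unit_matrix_sandwich: "(A ** unit_matrix i j ** B) $ a $ b = A $ a $ i * B $ j $ b"
proof -
  have "(A ** unit_matrix i j) $ a $ l = (if l = j then A $ a $ i else 0)" for l
    by (simp add: matrix_matrix_mult_def unit_matrix_def if_distrib[of "\<lambda>x. y * x" for y] cong: if_cong)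
  then show ?thesis
    by (simp add: matrix_matrix_mult_def[of "A ** unit_matrix i j" B] if_distrib[of "\<lambda>x. x * y" for y] cong: if_cong)
qed

lemma unit_matrix_mult: "unit_matrix i j ** unit_matrix k l = (if j = k then unit_matrix i l else 0)"
  using unit_matrix_sandwich[of "unit_matrix i j" k l "mat 1"]
  by (simp add: vec_eq_iff) (auto simp: unit_matrix_def mat_def)

lemma transpose_unit_matrix: "transpose (unit_matrix i j) = unit_matrix j i"
  by (auto simp: transpose_def unit_matrix_def vec_eq_iff)

definition plane_generator :: "'n \<Rightarrow> 'n \<Rightarrow> real^'n^'n" where
  "plane_generator i j = unit_matrix i j - unit_matrix j i"

text \<open>For distinct i and j this is the exponential of t E with E =
  \<open>plane_generator i j\<close>, summed by means of
  \<open>E ** E = - (unit_matrix i i + unit_matrix j j)\<close>.\<close>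

definition plane_rotation :: "'n \<Rightarrow> 'n \<Rightarrow> real \<Rightarrow> real^'n^'n" where
  "plane_rotation i j t = mat 1 + (cos t - 1) *\<^sub>R (unit_matrix i i + unit_matrix j j) + sin t *\<^sub>R plane_generator i j"

definition plane_rotation_deriv :: "'n \<Rightarrow> 'n \<Rightarrow> real \<Rightarrow> real^'n^'n" where
  "plane_rotation_deriv i j t = (- sin t) *\<^sub>R (unit_matrix i i + unit_matrix j j) + cos t *\<^sub>R plane_generator i j"

lemma transpose_plane_generator: "transpose (plane_generator i j) = - plane_generator i j"
  by (simp add: plane_generator_def transpose_diff transpose_unit_matrix)

lemma plane_rotation_0: "plane_rotation i j 0 = mat 1" "plane_rotation_deriv i j 0 = plane_generator i j"
  by (simp_all add: plane_rotation_def plane_rotation_deriv_def)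

lemma plane_rotation_add:
  assumes "i \<noteq> j"
  shows "plane_rotation i j s ** plane_rotation i j t = plane_rotation i j (s + t)"
proof -
  define D where "D = unit_matrix i i + unit_matrix j j"
  define E where "E = plane_generator i j"
  have DE: "D ** D = D" "D ** E = E" "E ** D = E" "E ** E = - D"
    using assms by (auto simp: D_def E_def plane_generator_def matrix_mult.add_left matrix_mult.add_right
        matrix_mult.diff_left matrix_mult.diff_right unit_matrix_mult)
  have Q: "plane_rotation i j t = mat 1 + (cos t - 1) *\<^sub>R D + sin t *\<^sub>R E" for t
    by (simp add: plane_rotation_def D_def E_def)
  have mul: "(mat 1 + a *\<^sub>R D + b *\<^sub>R E) ** (mat 1 + c *\<^sub>R D + d *\<^sub>R E) =
      mat 1 + (a + c + a * c - b * d) *\<^sub>R D + (b + d + a * d + b * c) *\<^sub>R E" for a b c d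
    by (simp add: matrix_mult.add_left matrix_mult.add_right matrix_mult.scaleR_left matrix_mult.scaleR_right DE
        algebra_simps)
  have "(cos s - 1) + (cos t - 1) + (cos s - 1) * (cos t - 1) - sin s * sin t = cos (s + t) - 1"
    "sin s + sin t + (cos s - 1) * sin t + sin s * (cos t - 1) = sin (s + t)"
    by (simp_all add: cos_add sin_add algebra_simps)
  then show ?thesis
    unfolding Q mul by (simp only:)
qed

lemma transpose_plane_rotation: "transpose (plane_rotation i j t) = plane_rotation i j (- t)"
  by (simp add: plane_rotation_def transpose_add transpose_scaleR transpose_unit_matrix
      transpose_plane_generator transpose_mat)

text \<open>The determinant is the square of the one at angle t / 2, which excludes the value
  -1.\<close>

lemma rotation_matrix_plane_rotation:
  assumes "i \<noteq> j"
  shows "rotation_matrix (plane_rotation i j t)"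
proof -
  have o: "orthogonal_matrix (plane_rotation i j t)" for t
    unfolding orthogonal_matrix_def transpose_plane_rotation
    by (simp add: plane_rotation_add[OF assms] plane_rotation_0)
  have "det (plane_rotation i j t) = det (plane_rotation i j (t / 2)) * det (plane_rotation i j (t / 2))"
    using plane_rotation_add[OF assms, of "t / 2" "t / 2"] by (simp flip: det_mul)
  then have "det (plane_rotation i j t) \<ge> 0" by simp
  then have "det (plane_rotation i j t) = 1" using det_orthogonal_matrix[OF o[of t]] by auto
  then show ?thesis using o by (simp add: rotation_matrix_def)
qed

lemma has_vector_derivative_plane_rotation:
  "(plane_rotation i j has_vector_derivative plane_rotation_deriv i j t) (at t within S)"
  unfolding plane_rotation_def[abs_def] plane_rotation_deriv_def
  by (auto intro!: derivative_eq_intros)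

lemma continuous_on_plane_rotation [continuous_intros]:
  fixes f :: "'a::t2_space \<Rightarrow> real"
  shows "continuous_on S f \<Longrightarrow> continuous_on S (\<lambda>x. plane_rotation i j (f x))"
  "continuous_on S f \<Longrightarrow> continuous_on S (\<lambda>x. plane_rotation_deriv i j (f x))"
  unfolding plane_rotation_def plane_rotation_deriv_def by (auto intro!: continuous_intros)

lemma continuous_on_transpose [continuous_intros]:
  fixes f :: "'a::topological_space \<Rightarrow> real^'n^'m"
  shows "continuous_on S f \<Longrightarrow> continuous_on S (\<lambda>x. transpose (f x))"
  unfolding transpose_def by (intro continuous_intros)

lemmas continuous_on_matrix_mult [continuous_intros] = matrix_mult.continuous_on

lemma continuous_on_stretch [continuous_intros]:
  "continuous_on S G \<Longrightarrow> continuous_on S P \<Longrightarrow> continuous_on S (\<lambda>x. stretch (G x) (P x))"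
  unfolding stretch_def by (intro continuous_intros)

definition stretch_deriv :: "real^'n^'n \<Rightarrow> real^'n^'n \<Rightarrow> real^'n^'n \<Rightarrow> real" where
  "stretch_deriv G H P = det_deriv (P ** G ** P + (mat 1 - P)) (P ** H ** P)"

lemma continuous_on_stretch_deriv [continuous_intros]:
  "continuous_on S G \<Longrightarrow> continuous_on S H \<Longrightarrow> continuous_on S P \<Longrightarrow>
    continuous_on S (\<lambda>x. stretch_deriv (G x) (H x) (P x))"
  unfolding stretch_deriv_def by (intro continuous_intros)

lemma has_real_derivative_stretch_powr:
  fixes P :: "real^'n^'n"
  assumes G: "(G has_vector_derivative G') (at t within S)" and pd: "pos_def (G t)" and P: "orth_projection P"
  shows "((\<lambda>t. stretch (G t) P powr c) has_real_derivative
    c * stretch (G t) P powr (c - 1) * stretch_deriv (G t) G' P) (at t within S)"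
proof -
  have "((\<lambda>t. P ** G t ** P + (mat 1 - P)) has_vector_derivative P ** G' ** P) (at t within S)"
    by (auto intro!: derivative_eq_intros matrix_mult.has_vector_derivative[THEN has_vector_derivative_eq_rhs] G)
  from has_real_derivative_det[OF this]
  have "((\<lambda>t. stretch (G t) P) has_real_derivative stretch_deriv (G t) G' P) (at t within S)"
    by (simp add: stretch_def stretch_deriv_def)
  from DERIV_chain2[OF has_real_derivative_powr[OF stretch_pos[OF pd P]] this]
  show ?thesis .
qed

text \<open>With W the inverse of the padded matrix, N = P W P is the inverse of the compression of
  \<open>G\<close> on the range of \<open>P\<close>, extended by zero to the kernel. Jacobi's
  formula expresses the derivative through N; the listed relations are what the trace computations
  below need of it.\<close>

lemma stretch_deriv_trace:
  assumes G: "pos_def G" and P: "orth_projection P"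
  shows "\<exists>N. transpose N = N \<and> P ** N = N \<and> N ** P = N \<and> N ** G ** P = P \<and> P ** G ** N = P \<and>
    (\<forall>H. stretch_deriv G H P = stretch G P * trace (N ** H))"
proof -
  let ?B = "P ** G ** P + (mat 1 - P)"
  have PP: "P ** P = P" "transpose P = P" using P by (auto simp: orth_projection_def)
  have "invertible ?B"
    using stretch_nonzero[OF G P] by (simp add: stretch_def invertible_det_nz)
  then obtain W where W: "?B ** W = mat 1" "W ** ?B = mat 1" by (auto simp: invertible_def)
  have "transpose ?B = ?B"
    using G PP by (simp add: pos_def_def transpose_add transpose_diff transpose_mat matrix_transpose_mul matrix_mul_assoc)
  then have "transpose W ** ?B = mat 1"
    using arg_cong[OF W(1), of transpose] by (simp add: matrix_transpose_mul transpose_mat)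
  then have Ws: "transpose W = W"
    using W by (metis matrix_mul_assoc matrix_mul_lid matrix_mul_rid)
  have BP: "?B ** P = P ** G ** P" and PB: "P ** ?B = P ** G ** P"
    by (simp_all add: matrix_mult.add_left matrix_mult.add_right matrix_mult.diff_left matrix_mult.diff_right
        PP matrix_mul_assoc flip: matrix_mul_assoc[of _ P P])
  let ?N = "P ** W ** P"
  have 1: "transpose ?N = ?N" by (simp add: matrix_transpose_mul Ws PP matrix_mul_assoc)
  have 2: "P ** ?N = ?N" by (simp add: matrix_mul_assoc PP)
  have 3: "?N ** P = ?N" by (simp add: PP flip: matrix_mul_assoc)
  have 4: "?N ** G ** P = P"
  proof -
    have "?N ** G ** P = P ** W ** (P ** G ** P)" by (simp add: matrix_mul_assoc)
    also have "\<dots> = P ** W ** (?B ** P)" by (simp only: BP)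
    also have "\<dots> = P ** (W ** ?B) ** P" by (simp only: matrix_mul_assoc)
    finally show ?thesis by (simp add: W PP)
  qed
  have 5: "P ** G ** ?N = P"
  proof -
    have "P ** G ** ?N = (P ** G ** P) ** W ** P" by (simp add: matrix_mul_assoc)
    also have "\<dots> = P ** ?B ** W ** P" by (simp only: PB)
    also have "\<dots> = P ** (?B ** W) ** P" by (simp only: matrix_mul_assoc)
    finally show ?thesis by (simp add: W PP)
  qed
  have 6: "stretch_deriv G H P = stretch G P * trace (?N ** H)" for H
  proof -
    have "stretch_deriv G H P = stretch G P * trace (W ** (P ** H ** P))"
      by (simp add: stretch_deriv_def det_deriv_invertible[OF W(1)] stretch_def)
    also have "trace (W ** (P ** H ** P)) = trace (?N ** H)"
      using trace_mul_sym[of "W ** P ** H" P] by (simp add: matrix_mul_assoc)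
    finally show ?thesis .
  qed
  show ?thesis using 1 2 3 4 5 6 by blast
qed

section \<open>Integration by parts against infinitesimal rotations\<close>

lemma sum_diagonal_entries:
  fixes A B :: "real^'n^'n"
  shows "(\<Sum>i\<in>UNIV. \<Sum>j\<in>UNIV. A $ i $ i * B $ j $ j) = trace A * trace B"
    and "(\<Sum>i\<in>UNIV. \<Sum>j\<in>UNIV. A $ i $ j * B $ j $ i) = trace (A ** B)"
    and "(\<Sum>i\<in>UNIV. \<Sum>j\<in>UNIV. A $ i $ j * B $ i $ j) = trace (A ** transpose B)"
  by (simp_all add: trace_def sum_product matrix_matrix_mult_def transpose_def)

lemma trace_transpose: "trace (transpose A) = trace (A :: real^'n^'n)"
  by (simp add: trace_def transpose_def)

lemma trace_minus: "trace (- A) = - trace (A :: real^'n^'n)"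
  by (simp add: trace_def sum_negf)

lemma trace_unit_matrix: "trace (M ** unit_matrix i j) = M $ j $ i"
proof -
  have "trace (M ** unit_matrix i j) = (\<Sum>a\<in>UNIV. (M ** unit_matrix i j ** mat 1) $ a $ a)"
    by (simp add: trace_def)
  also have "\<dots> = M $ j $ i"
    unfolding unit_matrix_sandwich by (simp add: mat_def if_distrib cong: if_cong)
  finally show ?thesis .
qed

text \<open>
  The generators \<^term>\<open>plane_generator i j\<close> span the antisymmetric matrices. The next two identities are
  the divergence and the directional derivative that occur when the vector field
  \<open>P \<mapsto> [R P - P R\<^sup>T, P]\<close>, which moves the range of \<open>P\<close> by the linear map \<open>R\<close>, is expanded in these generators.
\<close>
lemma sum_plane_generator_divergence:
  fixes P R :: "real^'n^'n"
  assumes P: "transpose P = P"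
  defines "S \<equiv> \<lambda>i j. plane_generator i j ** P - P ** plane_generator i j"
  shows "(\<Sum>i\<in>UNIV. \<Sum>j\<in>UNIV. (R ** S i j - S i j ** transpose R) $ i $ j) =
    2 * (trace R * trace P - real CARD('n) * trace (R ** P))"
proof -
  let ?I = "mat 1 :: real^'n^'n" and ?T = "transpose R"
  \<comment> \<open>With the generator written as a difference of unit matrices, every entry becomes
    a combination of products of two entries, whose double sums are traces.\<close>
  have S: "(R ** S i j - S i j ** ?T) $ i $ j =
      (R $ i $ i * P $ j $ j - R $ i $ j * P $ i $ j) - ((R ** P) $ i $ i * ?I $ j $ j - (R ** P) $ i $ j * ?I $ i $ j)
      - ((?I $ i $ i * (P ** ?T) $ j $ j - ?I $ i $ j * (P ** ?T) $ i $ j) - (P $ i $ i * ?T $ j $ j - P $ i $ j * ?T $ i $ j))"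
    for i j
  proof -
    have "R ** S i j - S i j ** ?T =
        (R ** unit_matrix i j ** P - R ** unit_matrix j i ** P)
        - ((R ** P) ** unit_matrix i j ** ?I - (R ** P) ** unit_matrix j i ** ?I)
        - ((?I ** unit_matrix i j ** (P ** ?T) - ?I ** unit_matrix j i ** (P ** ?T))
        - (P ** unit_matrix i j ** ?T - P ** unit_matrix j i ** ?T))"
      by (simp add: S_def plane_generator_def matrix_mult.diff_left matrix_mult.diff_right matrix_mul_assoc)
    then show ?thesis
      by (simp only: vector_minus_component unit_matrix_sandwich)
  qed
  have tr: "trace (P ** ?T) = trace (R ** P)"
    using trace_transpose[of "P ** ?T"] P by (simp add: matrix_transpose_mul)
  have tr2: "trace (P ** R) = trace (R ** P)" by (rule trace_mul_sym)
  show ?thesis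
    unfolding S sum_subtractf sum_diagonal_entries
    using P by (simp add: transpose_mat trace_I tr tr2 trace_transpose algebra_simps)
qed

lemma sum_plane_generator_trace:
  fixes P R N G :: "real^'n^'n"
  assumes P: "transpose P = P" and G: "transpose G = G" and N: "transpose N = N" "P ** N = N" "N ** P = N"
    "N ** G ** P = P" "P ** G ** N = P"
  shows "(\<Sum>i\<in>UNIV. \<Sum>j\<in>UNIV. (R ** P - P ** transpose R) $ i $ j *
      trace (N ** (G ** plane_generator i j - plane_generator i j ** G))) =
    4 * (trace (R ** N ** G) - trace (R ** P))"
proof -
  let ?Y = "R ** P - P ** transpose R" and ?M = "N ** G - G ** N" and ?T = "transpose R"
  have "trace (N ** (G ** plane_generator i j - plane_generator i j ** G)) = ?M $ j $ i - ?M $ i $ j" for i j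
  proof -
    have "trace (N ** (G ** E - E ** G)) = trace (?M ** E)" for E :: "real^'n^'n"
      using trace_mul_sym[of "N ** E" G]
      by (simp add: matrix_mult.diff_left matrix_mult.diff_right trace_sub matrix_mul_assoc)
    note this[of "plane_generator i j"]
    also have "trace (?M ** plane_generator i j) = ?M $ j $ i - ?M $ i $ j"
      by (simp only: plane_generator_def matrix_mult.diff_right trace_sub trace_unit_matrix)
    finally show ?thesis .
  qed
  then have "(\<Sum>i\<in>UNIV. \<Sum>j\<in>UNIV. ?Y $ i $ j * trace (N ** (G ** plane_generator i j - plane_generator i j ** G))) =
      (\<Sum>i\<in>UNIV. \<Sum>j\<in>UNIV. ?Y $ i $ j * ?M $ j $ i) - (\<Sum>i\<in>UNIV. \<Sum>j\<in>UNIV. ?Y $ i $ j * ?M $ i $ j)"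
    by (simp only: right_diff_distrib sum_subtractf)
  also have "\<dots> = trace (?Y ** ?M) - trace (?Y ** transpose ?M)"
    by (simp only: sum_diagonal_entries)
  \<comment> \<open>The commutator-like matrix N G - G N is antisymmetric, so the two traces are
    opposite and their difference doubles the first.\<close>
  also have "transpose ?M = - ?M"
    using G N(1) by (simp add: transpose_diff matrix_transpose_mul)
  also have "trace (?Y ** ?M) - trace (?Y ** (- ?M)) = 2 * trace (?Y ** ?M)"
    by (simp only: matrix_mult.minus_right trace_minus)
  also have "trace (?Y ** ?M) = 2 * (trace (R ** N ** G) - trace (R ** P))"
  proof -
    have "?Y ** ?M = R ** (P ** N) ** G - R ** (P ** G ** N) - P ** (?T ** N ** G) + P ** (?T ** G ** N)"
      by (simp add: matrix_mult.diff_left matrix_mult.diff_right matrix_mul_assoc)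
    moreover have "trace (P ** (?T ** N ** G)) = trace (R ** P)"
    proof -
      have "trace (P ** (?T ** N ** G)) = trace (?T ** (N ** G ** P))"
        using trace_mul_sym[of P "?T ** N ** G"] by (simp add: matrix_mul_assoc)
      also have "\<dots> = trace (transpose (?T ** P))" using N by (simp add: trace_transpose)
      also have "\<dots> = trace (R ** P)" using P trace_mul_sym[of P R] by (simp add: matrix_transpose_mul)
      finally show ?thesis .
    qed
    moreover have "trace (P ** (?T ** G ** N)) = trace (R ** N ** G)"
    proof -
      have "trace (P ** (?T ** G ** N)) = trace (?T ** G ** (N ** P))"
        using trace_mul_sym[of P "?T ** G ** N"] by (simp add: matrix_mul_assoc)
      also have "\<dots> = trace (transpose (?T ** G ** N))" using N by (simp add: trace_transpose)
      also have "\<dots> = trace (N ** G ** R)" using G N by (simp add: matrix_transpose_mul matrix_mul_assoc)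
      also have "\<dots> = trace (R ** N ** G)" using trace_mul_sym[of "N ** G" R] by (simp add: matrix_mul_assoc)
      finally show ?thesis .
    qed
    ultimately show ?thesis using N by (simp add: trace_add trace_sub)
  qed
  finally show ?thesis by simp
qed

text \<open>The measure on projections is never identified; rotation invariance of the law of
  \<open>X\<close> suffices. In the application \<open>X\<close> is \<open>direction\<close> and
  \<open>M\<close> is \<mu> weighted by the Gaussian of the foot.\<close>

locale rotation_invariant_projection = finite_measure M
  for M :: "'a measure" +
  fixes X :: "'a \<Rightarrow> real^'n^'n" and \<kappa> :: real
  assumes measurable_X [measurable]: "X \<in> borel_measurable M"
    and X_mem: "\<And>\<omega>. \<omega> \<in> space M \<Longrightarrow> X \<omega> \<in> grassmannian_projections \<kappa>"
    and invariant: "\<And>Q. rotation_matrix Q \<Longrightarrow> distr M borel (\<lambda>\<omega>. Q ** X \<omega> ** transpose Q) = distr M borel X"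
begin

abbreviation "K \<equiv> grassmannian_projections \<kappa> :: (real^'n^'n) set"

lemma X_proj: "\<omega> \<in> space M \<Longrightarrow> orth_projection (X \<omega>)" "\<omega> \<in> space M \<Longrightarrow> trace (X \<omega>) = \<kappa>"
  using X_mem by (auto simp: grassmannian_projections_def)

lemma K_rotate:
  assumes Q: "rotation_matrix Q" and P: "P \<in> K"
  shows "Q ** P ** transpose Q \<in> K"
proof -
  have QQ: "transpose Q ** Q = mat 1" using Q by (auto simp: rotation_matrix_def orthogonal_matrix_def)
  have PP: "P ** P = P" "transpose P = P" "trace P = \<kappa>"
    using P by (auto simp: grassmannian_projections_def orth_projection_def)
  have "Q ** P ** transpose Q ** (Q ** P ** transpose Q) = Q ** P ** (transpose Q ** Q) ** P ** transpose Q"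
    by (simp add: matrix_mul_assoc)
  also have "\<dots> = Q ** (P ** P) ** transpose Q" by (simp add: QQ matrix_mul_assoc)
  finally have 1: "Q ** P ** transpose Q ** (Q ** P ** transpose Q) = Q ** P ** transpose Q"
    by (simp add: PP)
  have 2: "transpose (Q ** P ** transpose Q) = Q ** P ** transpose Q"
    by (simp add: matrix_transpose_mul PP matrix_mul_assoc)
  have "trace (Q ** P ** transpose Q) = trace (transpose Q ** Q ** P)"
    using trace_mul_sym[of "Q ** P" "transpose Q"] by (simp add: matrix_mul_assoc)
  then have 3: "trace (Q ** P ** transpose Q) = \<kappa>" by (simp add: QQ PP)
  show ?thesis using 1 2 3 by (simp add: grassmannian_projections_def orth_projection_def)
qed

lemma integral_rotate:
  fixes g :: "real^'n^'n \<Rightarrow> real"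
  assumes Q: "rotation_matrix Q" and g: "continuous_on K g"
  shows "(LINT \<omega>|M. g (Q ** X \<omega> ** transpose Q)) = (LINT \<omega>|M. g (X \<omega>))"
proof -
  have [measurable]: "K \<in> sets borel" by (intro borel_compact compact_grassmannian_projections)
  let ?g = "\<lambda>P. indicator K P *\<^sub>R g P"
  have [measurable]: "?g \<in> borel_measurable borel"
    using g by (intro borel_measurable_continuous_on_indicator) auto
  have "(LINT \<omega>|M. g (Q ** X \<omega> ** transpose Q)) = (LINT \<omega>|M. ?g (Q ** X \<omega> ** transpose Q))"
    using K_rotate[OF Q X_mem] by (intro Bochner_Integration.integral_cong) auto
  also have "\<dots> = (LINT P|distr M borel (\<lambda>\<omega>. Q ** X \<omega> ** transpose Q). ?g P)"
    by (rule integral_distr[symmetric]) measurable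
  also have "\<dots> = (LINT \<omega>|M. ?g (X \<omega>))"
    unfolding invariant[OF Q] by (rule integral_distr) measurable
  also have "\<dots> = (LINT \<omega>|M. g (X \<omega>))"
    using X_mem by (intro Bochner_Integration.integral_cong) auto
  finally show ?thesis .
qed

lemma integrable_continuous:
  fixes g :: "real^'n^'n \<Rightarrow> real"
  assumes g: "continuous_on K g"
  shows "integrable M (\<lambda>\<omega>. g (X \<omega>))"
proof -
  have [measurable]: "K \<in> sets borel" by (intro borel_compact compact_grassmannian_projections)
  let ?g = "\<lambda>P. indicator K P *\<^sub>R g P"
  have [measurable]: "?g \<in> borel_measurable borel"
    using g by (intro borel_measurable_continuous_on_indicator) auto
  obtain B where B: "\<And>P. P \<in> K \<Longrightarrow> norm (g P) \<le> B"
    using compact_imp_bounded[OF compact_continuous_image[OF g compact_grassmannian_projections]]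
    by (auto simp: bounded_iff)
  have "(\<lambda>\<omega>. ?g (X \<omega>)) \<in> borel_measurable M" by measurable
  then have "integrable M (\<lambda>\<omega>. ?g (X \<omega>))"
    using B X_mem by (intro integrable_const_bound[of _ B] AE_I2) auto
  then show ?thesis
    by (rule Bochner_Integration.integrable_cong[THEN iffD1, rotated -1]) (use X_mem in auto)
qed

text \<open>Let g(P) be an entry of R P - P R^T times stretch(G, P)^c. By invariance the integral of
  g(Q X Q^T) is the same for all rotations Q, so its derivative along the plane rotations at angle 0
  vanishes. The first summand comes from the entry, the second from the power.\<close>

lemma rotation_variation:
  fixes G R :: "real^'n^'n"
  assumes G: "pos_def G"
  defines "S \<equiv> \<lambda>i j P. plane_generator i j ** P - P ** plane_generator i j"
  shows "(LINT \<omega>|M. (R ** S i j (X \<omega>) - S i j (X \<omega>) ** transpose R) $ i $ j * stretch G (X \<omega>) powr c +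
      (R ** X \<omega> - X \<omega> ** transpose R) $ i $ j * (c * stretch G (X \<omega>) powr (c - 1) *
        stretch_deriv G (G ** plane_generator i j - plane_generator i j ** G) (X \<omega>))) = 0"
proof (cases "i = j")
  case True
  then show ?thesis
    by (simp add: S_def plane_generator_def stretch_deriv_def det_deriv_def matrix_mult.zero_left matrix_mult.zero_right)
next
  case False
  define Q where "Q = plane_rotation i j"
  define Q' where "Q' = plane_rotation_deriv i j"
  have rot: "rotation_matrix (Q t)" for t
    using rotation_matrix_plane_rotation[OF False] by (simp add: Q_def)
  then have ortho: "orthogonal_matrix (Q t)" for t by (simp add: rotation_matrix_def)
  have dQ: "(Q has_vector_derivative Q' t) (at t within T)" for t T
    by (simp add: Q_def Q'_def has_vector_derivative_plane_rotation)
  have dQt: "((\<lambda>t. transpose (Q t)) has_vector_derivative transpose (Q' t)) (at t within T)" for t T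
    by (rule bounded_linear.has_vector_derivative[OF bounded_linear_transpose dQ])
  have [continuous_intros]: "continuous_on T (\<lambda>x. Q (f x))" "continuous_on T (\<lambda>x. Q' (f x))"
    if "continuous_on T f" for T and f :: "'b::t2_space \<Rightarrow> real"
    using that unfolding Q_def Q'_def by (auto intro: continuous_on_plane_rotation)
  define Y where "Y = (\<lambda>P. R ** P - P ** transpose R)"
  define g where "g = (\<lambda>P. Y P $ i $ j * stretch G P powr c)"
  define GG where "GG = (\<lambda>t. transpose (Q t) ** G ** Q t)"
  define GG' where "GG' = (\<lambda>t. transpose (Q t) ** G ** Q' t + transpose (Q' t) ** G ** Q t)"
  define PP where "PP = (\<lambda>t P. Q t ** P ** transpose (Q t))"
  define PP' where "PP' = (\<lambda>t P. Q t ** P ** transpose (Q' t) + Q' t ** P ** transpose (Q t))"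
  have pd: "pos_def (GG t)" for t unfolding GG_def by (intro pos_def_congruence G ortho)
  have dGG: "(GG has_vector_derivative GG' t) (at t within T)" for t T
    unfolding GG_def GG'_def
    by (rule matrix_mult.has_vector_derivative[THEN has_vector_derivative_eq_rhs,
          OF matrix_mult.has_vector_derivative[OF dQt has_vector_derivative_const] dQ]) simp
  have dPP: "((\<lambda>t. PP t P) has_vector_derivative PP' t P) (at t within T)" for t T P
    unfolding PP_def PP'_def
    by (rule matrix_mult.has_vector_derivative[THEN has_vector_derivative_eq_rhs,
          OF matrix_mult.has_vector_derivative[OF dQ has_vector_derivative_const] dQt]) simp
  have bY: "bounded_linear Y"
    unfolding Y_def by (intro bounded_linear_sub matrix_mult.bounded_linear_right matrix_mult.bounded_linear_left)
  \<comment> \<open>Inside the matrix entry the projection itself is rotated; inside the power the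
    rotation is shifted onto G by \<open>stretch_congruence\<close>.\<close>
  define u where "u = (\<lambda>t P. Y (PP t P) $ i $ j * stretch (GG t) P powr c)"
  define u' where "u' = (\<lambda>t P. Y (PP' t P) $ i $ j * stretch (GG t) P powr c +
      (c * stretch (GG t) P powr (c - 1) * stretch_deriv (GG t) (GG' t) P) * Y (PP t P) $ i $ j)"
  have pos: "stretch (GG t) P \<noteq> 0" if "P \<in> K" for t P
    using stretch_nonzero[OF pd, of P t] that by (simp add: grassmannian_projections_def)
  have "((\<lambda>t. LINT \<omega>|M. u t (X \<omega>)) has_real_derivative (LINT \<omega>|M. u' 0 (X \<omega>))) (at 0 within {-1..1})"
  proof (rule has_real_derivative_integral_compact[OF finite_measure_axioms measurable_X compact_grassmannian_projections X_mem])
    fix t :: real and P :: "real^'n^'n" assume "P \<in> K"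
    then have P: "orth_projection P" by (simp add: grassmannian_projections_def)
    show "((\<lambda>t. u t P) has_real_derivative u' t P) (at t within {-1..1})"
      unfolding u_def u'_def
      by (intro DERIV_mult has_vector_derivative_entry bounded_linear.has_vector_derivative[OF bY dPP]
          has_real_derivative_stretch_powr dGG pd P)
  next
    fix t :: real
    show "continuous_on K (u t)"
      unfolding u_def Y_def PP_def using pos by (intro continuous_intros) auto
  next
    show "continuous_on ({-1..1} \<times> K) (\<lambda>z. u' (fst z) (snd z))"
      unfolding u'_def Y_def PP_def PP'_def GG_def GG'_def
      using pos by (intro continuous_intros) (auto simp: GG_def)
  qed auto
  moreover have "(LINT \<omega>|M. u t (X \<omega>)) = (LINT \<omega>|M. g (X \<omega>))" for t
  proof -
    have "u t P = g (Q t ** P ** transpose (Q t))" for P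
      by (simp add: u_def g_def PP_def GG_def stretch_congruence[OF ortho])
    moreover have "continuous_on K g"
      unfolding g_def Y_def using stretch_nonzero[OF G]
      by (intro continuous_intros) (auto simp: grassmannian_projections_def)
    ultimately show ?thesis using integral_rotate[OF rot, of g t] by simp
  qed
  ultimately have "((\<lambda>t. LINT \<omega>|M. g (X \<omega>)) has_real_derivative (LINT \<omega>|M. u' 0 (X \<omega>))) (at 0 within {-1..1})"
    by simp
  moreover have "at (0::real) within {-1..1} = at 0" by (rule at_within_interior) simp
  ultimately have "((\<lambda>t. LINT \<omega>|M. g (X \<omega>)) has_real_derivative (LINT \<omega>|M. u' 0 (X \<omega>))) (at 0)" by simp
  then have "(LINT \<omega>|M. u' 0 (X \<omega>)) = 0" using DERIV_const DERIV_unique by blast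
  moreover have "u' 0 P = (R ** S i j P - S i j P ** transpose R) $ i $ j * stretch G P powr c +
      (R ** P - P ** transpose R) $ i $ j * (c * stretch G P powr (c - 1) *
        stretch_deriv G (G ** plane_generator i j - plane_generator i j ** G) P)" for P
    by (simp add: u'_def Y_def PP_def PP'_def GG_def GG'_def S_def Q_def Q'_def plane_rotation_0 transpose_mat
        transpose_plane_generator matrix_mult.minus_left matrix_mult.minus_right mult.commute)
  ultimately show ?thesis by simp
qed

text \<open>Sum the rotation identities over all generators with R = G^(-1) H. Up to the factor
  stretch^c the integrand becomes 2 (\<kappa> tr R - d tr(R P)) + 4 c (tr(N H) - tr(R P)). For c =
  -d/2 the terms tr(R P) cancel; \<kappa> tr R is constant, and tr(N H) is the wanted
  derivative.\<close>

lemma stretch_variation: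
  fixes G H Gi :: "real^'n^'n"
  assumes G: "pos_def G" and Gi: "G ** Gi = mat 1"
  defines "c \<equiv> - real CARD('n) / 2"
  shows "(LINT \<omega>|M. c * stretch G (X \<omega>) powr (c - 1) * stretch_deriv G H (X \<omega>)) =
    - (\<kappa> / 2) * trace (Gi ** H) * (LINT \<omega>|M. stretch G (X \<omega>) powr c)"
proof -
  let ?R = "Gi ** H"
  let ?S = "\<lambda>i j P. plane_generator i j ** P - P ** plane_generator i j"
  let ?f = "\<lambda>i j P. (?R ** ?S i j P - ?S i j P ** transpose ?R) $ i $ j * stretch G P powr c +
      (?R ** P - P ** transpose ?R) $ i $ j * (c * stretch G P powr (c - 1) *
        stretch_deriv G (G ** plane_generator i j - plane_generator i j ** G) P)"
  have nz: "stretch G P \<noteq> 0" if "P \<in> K" for P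
    using stretch_nonzero[OF G, of P] that by (simp add: grassmannian_projections_def)
  have int: "integrable M (\<lambda>\<omega>. ?f i j (X \<omega>))" for i j
    by (rule integrable_continuous) (use nz in \<open>intro continuous_intros; auto\<close>)
  have int1: "integrable M (\<lambda>\<omega>. stretch G (X \<omega>) powr c)"
    by (rule integrable_continuous) (use nz in \<open>intro continuous_intros; auto\<close>)
  have int2: "integrable M (\<lambda>\<omega>. c * stretch G (X \<omega>) powr (c - 1) * stretch_deriv G H (X \<omega>))"
    by (rule integrable_continuous) (use nz in \<open>intro continuous_intros; auto\<close>)
  have "0 = (\<Sum>i\<in>UNIV. \<Sum>j\<in>UNIV. LINT \<omega>|M. ?f i j (X \<omega>))"
    using rotation_variation[OF G, of ?R _ _ c] by simp
  also have "\<dots> = (LINT \<omega>|M. (\<Sum>i\<in>UNIV. \<Sum>j\<in>UNIV. ?f i j (X \<omega>)))"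
    using int by (simp add: Bochner_Integration.integral_sum)
  also have "\<dots> = (LINT \<omega>|M. 2 * \<kappa> * trace ?R * stretch G (X \<omega>) powr c +
      4 * (c * stretch G (X \<omega>) powr (c - 1) * stretch_deriv G H (X \<omega>)))"
  proof (rule Bochner_Integration.integral_cong)
    fix \<omega> assume \<omega>: "\<omega> \<in> space M"
    let ?P = "X \<omega>"
    have P: "orth_projection ?P" and trP: "trace ?P = \<kappa>" using X_proj[OF \<omega>] by auto
    obtain N where N: "transpose N = N" "?P ** N = N" "N ** ?P = N" "N ** G ** ?P = ?P" "?P ** G ** N = ?P"
      "\<And>H. stretch_deriv G H ?P = stretch G ?P * trace (N ** H)"
      using stretch_deriv_trace[OF G P] by blast
    have Ps: "transpose ?P = ?P" and Gs: "transpose G = G"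
      using P G by (auto simp: orth_projection_def pos_def_def)
    have pw: "stretch G ?P powr (c - 1) * stretch G ?P = stretch G ?P powr c"
      using stretch_pos[OF G P] by (simp add: powr_diff)
    let ?\<phi> = "stretch G ?P powr c"
    have sd: "c * stretch G ?P powr (c - 1) * stretch_deriv G H' ?P = c * ?\<phi> * trace (N ** H')" for H'
      unfolding N(6) pw[symmetric] by (simp add: mult_ac)
    have "(\<Sum>i\<in>UNIV. \<Sum>j\<in>UNIV. ?f i j ?P) =
        ?\<phi> * (\<Sum>i\<in>UNIV. \<Sum>j\<in>UNIV. (?R ** ?S i j ?P - ?S i j ?P ** transpose ?R) $ i $ j) +
        c * ?\<phi> * (\<Sum>i\<in>UNIV. \<Sum>j\<in>UNIV. (?R ** ?P - ?P ** transpose ?R) $ i $ j *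
          trace (N ** (G ** plane_generator i j - plane_generator i j ** G)))"
      unfolding sd by (simp add: sum.distrib sum_distrib_left mult_ac)
    also have "\<dots> = ?\<phi> * (2 * (trace ?R * \<kappa> - real CARD('n) * trace (?R ** ?P))) +
        c * ?\<phi> * (4 * (trace (?R ** N ** G) - trace (?R ** ?P)))"
      unfolding sum_plane_generator_divergence[OF Ps] sum_plane_generator_trace[OF Ps Gs N(1-5)] trP ..
    \<comment> \<open>This is the reason for choosing R = G^(-1) H: under the cyclic trace the outer
      G cancels its inverse.\<close>
    also have "trace (?R ** N ** G) = trace (N ** H)"
    proof -
      have "trace (?R ** N ** G) = trace (G ** Gi ** H ** N)"
        using trace_mul_sym[of "?R ** N" G] by (simp add: matrix_mul_assoc)
      also have "\<dots> = trace (N ** H)" using trace_mul_sym[of H N] by (simp add: Gi)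
      finally show ?thesis .
    qed
    also have "?\<phi> * (2 * (trace ?R * \<kappa> - real CARD('n) * trace (?R ** ?P))) +
        c * ?\<phi> * (4 * (trace (N ** H) - trace (?R ** ?P))) =
        2 * \<kappa> * trace ?R * ?\<phi> + 4 * (c * ?\<phi> * trace (N ** H))"
      by (simp add: c_def algebra_simps)
    finally show "(\<Sum>i\<in>UNIV. \<Sum>j\<in>UNIV. ?f i j ?P) =
        2 * \<kappa> * trace ?R * ?\<phi> + 4 * (c * stretch G ?P powr (c - 1) * stretch_deriv G H ?P)"
      unfolding sd .
  qed simp
  also have "\<dots> = 2 * \<kappa> * trace ?R * (LINT \<omega>|M. stretch G (X \<omega>) powr c) +
      4 * (LINT \<omega>|M. c * stretch G (X \<omega>) powr (c - 1) * stretch_deriv G H (X \<omega>))"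
    using int1 int2 by (subst Bochner_Integration.integral_add) auto
  finally show ?thesis by (simp add: field_simps)
qed

text \<open>On the segment G_s from the identity to \<open>G\<close> the mean F satisfies F' =
  -(\<kappa>/2) tr(G_s^(-1) H) F, while L = det(G_s)^(\<kappa>/2) satisfies the same equation with
  the opposite sign, so F L is constant. At the identity every stretch is 1, so F starts at the
  total mass.\<close>

lemma integral_stretch:
  fixes G :: "real^'n^'n"
  assumes G: "pos_def G"
  shows "(LINT \<omega>|M. stretch G (X \<omega>) powr (- real CARD('n) / 2)) = det G powr (- \<kappa> / 2) * measure M (space M)"
proof -
  define c where "c = - real CARD('n) / 2"
  define H where "H = G - mat 1"
  define GG where "GG = (\<lambda>s::real. mat 1 + s *\<^sub>R H)"
  have pd: "pos_def (GG s)" if "s \<in> {0..1}" for s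
    unfolding GG_def H_def using that by (intro pos_def_segment pos_def_one G) auto
  have dGG: "(GG has_vector_derivative H) (at s within T)" for s T
    unfolding GG_def by (rule has_vector_derivative_line)
  have nz: "stretch (GG s) P \<noteq> 0" if "s \<in> {0..1}" "P \<in> K" for s P
    using stretch_nonzero[OF pd[OF that(1)], of P] that(2) by (simp add: grassmannian_projections_def)
  define F where "F = (\<lambda>s. LINT \<omega>|M. stretch (GG s) (X \<omega>) powr c)"
  define L where "L = (\<lambda>s. det (GG s) powr (\<kappa> / 2))"
  have "((\<lambda>s. F s * L s) has_real_derivative 0) (at s within {0..1})" if s: "s \<in> {0..1}" for s
  proof -
    have inv: "invertible (GG s)" using pos_def_det_pos[OF pd[OF s]] by (simp add: invertible_det_nz)
    then obtain Gi where Gi: "GG s ** Gi = mat 1" by (auto simp: invertible_def)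
    have dF: "(F has_real_derivative (LINT \<omega>|M. c * stretch (GG s) (X \<omega>) powr (c - 1) * stretch_deriv (GG s) H (X \<omega>)))
        (at s within {0..1})"
      unfolding F_def
    proof (rule has_real_derivative_integral_compact[OF finite_measure_axioms measurable_X compact_grassmannian_projections X_mem _ _ _ s])
      fix t :: real and P :: "real^'n^'n" assume t: "t \<in> {0..1}" and "P \<in> K"
      then have P: "orth_projection P" by (simp add: grassmannian_projections_def)
      show "((\<lambda>t. stretch (GG t) P powr c) has_real_derivative
          c * stretch (GG t) P powr (c - 1) * stretch_deriv (GG t) H P) (at t within {0..1})"
        by (intro has_real_derivative_stretch_powr dGG pd[OF t] P)
    next
      fix t :: real assume t: "t \<in> {0..1}"
      show "continuous_on K (\<lambda>P. stretch (GG t) P powr c)"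
        using nz[OF t] by (intro continuous_intros) auto
    next
      show "continuous_on ({0..1} \<times> K) (\<lambda>z. c * stretch (GG (fst z)) (snd z) powr (c - 1) * stretch_deriv (GG (fst z)) H (snd z))"
        unfolding GG_def using nz by (intro continuous_intros) (auto simp: GG_def)
    qed
    have dL: "(L has_real_derivative \<kappa> / 2 * trace (Gi ** H) * L s) (at s within {0..1})"
    proof -
      have pos: "det (GG s) > 0" by (rule pos_def_det_pos[OF pd[OF s]])
      have "(L has_real_derivative \<kappa> / 2 * det (GG s) powr (\<kappa> / 2 - 1) * det_deriv (GG s) H) (at s within {0..1})"
        unfolding L_def by (rule DERIV_chain2[OF has_real_derivative_powr[OF pos] has_real_derivative_det[OF dGG]])
      also have "\<kappa> / 2 * det (GG s) powr (\<kappa> / 2 - 1) * det_deriv (GG s) H = \<kappa> / 2 * trace (Gi ** H) * L s"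
        using pos by (simp add: det_deriv_invertible[OF Gi] L_def powr_diff)
      finally show ?thesis .
    qed
    have "(LINT \<omega>|M. c * stretch (GG s) (X \<omega>) powr (c - 1) * stretch_deriv (GG s) H (X \<omega>)) =
        - (\<kappa> / 2) * trace (Gi ** H) * F s"
      using stretch_variation[OF pd[OF s] Gi, of H] by (simp only: F_def c_def)
    then show ?thesis
      using DERIV_mult[OF dF dL] by (simp add: mult_ac)
  qed
  then have "\<exists>a. \<forall>s\<in>{0..1}. F s * L s = a"
    by (intro has_field_derivative_zero_constant) auto
  then have "F 1 * L 1 = F 0 * L 0" by force
  moreover have "F 0 = measure M (space M)"
  proof -
    have "F 0 = (LINT \<omega>|M. 1)"
      unfolding F_def
    proof (rule Bochner_Integration.integral_cong)
      fix \<omega> assume "\<omega> \<in> space M"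
      then have "X \<omega> ** X \<omega> = X \<omega>" using X_proj by (simp add: orth_projection_def)
      then show "stretch (GG 0) (X \<omega>) powr c = 1" by (simp add: GG_def stretch_def)
    qed simp
    then show ?thesis by simp
  qed
  moreover have "L 0 = 1" by (simp add: L_def GG_def)
  moreover have "GG 1 = G" by (simp add: GG_def H_def)
  ultimately have *: "(LINT \<omega>|M. stretch G (X \<omega>) powr c) * det G powr (\<kappa> / 2) = measure M (space M)"
    by (simp add: F_def L_def)
  have "det G > 0" by (rule pos_def_det_pos[OF G])
  then have "det G powr (\<kappa> / 2) * det G powr (- \<kappa> / 2) = 1" by (simp add: powr_add[symmetric])
  then have "(LINT \<omega>|M. stretch G (X \<omega>) powr c) =
      (LINT \<omega>|M. stretch G (X \<omega>) powr c) * (det G powr (\<kappa> / 2) * det G powr (- \<kappa> / 2))"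
    by simp
  also have "\<dots> = det G powr (- \<kappa> / 2) * measure M (space M)"
    by (simp only: *[symmetric] mult_ac)
  finally show ?thesis by (simp only: c_def)
qed

end

section \<open>Assembly of the formula for an ellipsoid\<close>

lemma orth_projection_linear_image:
  fixes T P :: "real^'n^'n"
  assumes T: "invertible T" and P: "orth_projection P"
  obtains P' where "orth_projection P'" "range ((*v) P') = (*v) T ` range ((*v) P)" "trace P' = trace P"
proof -
  have tr: "trace P = real (dim (range ((*v) P)))" if P: "orth_projection P" for P :: "real^'n^'n"
  proof -
    obtain A where A: "orthonormal A" "P = frame_projection A"
      using orth_projection_frame[OF P] .
    have "independent A"
      using A(1) by (intro pairwise_orthogonal_independent) (auto simp: orthonormal_def)
    then show ?thesis
      unfolding A(2) by (simp add: trace_frame_projection[OF A(1)] range_frame_projection[OF A(1)] dim_eq_card_independent)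
  qed
  have inj: "inj ((*v) T)"
    using T by (metis invertible_left_inverse matrix_left_invertible_injective)
  define V where "V = (*v) T ` range ((*v) P)"
  have "subspace V" unfolding V_def by (intro linear_subspace_image) auto
  then obtain A where A: "pairwise orthogonal A" "\<And>x. x \<in> A \<Longrightarrow> norm x = 1" "span A = V"
    using orthonormal_basis_subspace by metis
  then have o: "orthonormal A" by (simp add: orthonormal_def)
  have r: "range ((*v) (frame_projection A)) = V" using A(3) by (simp add: range_frame_projection[OF o])
  have "dim V = dim (range ((*v) P))"
    unfolding V_def using inj by (intro dim_image_eq) (auto intro: inj_on_subset)
  then have "trace (frame_projection A) = trace P"
    by (simp add: tr[OF orth_projection_frame_projection[OF o]] tr[OF P] r)
  then show ?thesis
    using that[OF orth_projection_frame_projection[OF o]] r by (simp add: V_def)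
qed

lemma pos_def_gram:
  fixes T :: "real^'n^'n"
  assumes "invertible T"
  shows "pos_def (transpose T ** T)"
  unfolding pos_def_def
proof (intro conjI allI impI)
  show "transpose (transpose T ** T) = transpose T ** T" by (simp add: matrix_transpose_mul)
  fix x :: "real^'n" assume "x \<noteq> 0"
  moreover have "inj ((*v) T)"
    using assms by (metis invertible_left_inverse matrix_left_invertible_injective)
  ultimately have "T *v x \<noteq> 0" by (metis injD matrix_vector_mult_0_right)
  moreover have "x \<bullet> (transpose T *v (T *v x)) = (T *v x) \<bullet> (T *v x)"
    by (metis dot_lmul_matrix inner_commute transpose_matrix_vector)
  ultimately show "x \<bullet> ((transpose T ** T) *v x) > 0"
    by (simp only: matrix_vector_mul_assoc[symmetric]) simp
qed

text \<open>The disintegration requires measurability jointly in direction and foot. The Gaussian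
  form of \<open>flat_integral\<close> yields it, since P enters only as a parameter under one fixed
  measure.\<close>

lemma measurable_section_volume_pair:
  assumes [measurable]: "S \<in> sets borel"
  shows "(\<lambda>(P, y). section_volume S P y ^ m) \<in> borel_measurable (borel \<Otimes>\<^sub>M borel)"
  unfolding section_volume_def flat_integral_def by measurable

theorem corollary1p13:
  fixes \<E> :: "(real ^ 'n) set"
    and \<mu> :: "(real ^ 'n) set measure"
    and d k :: nat
  defines "d \<equiv> CARD('n)"
  assumes "k \<le> d"
    and "nondegenerate_ellipsoid \<E>"
    and "is_affine_grassmannian_measure k \<mu>"
  shows "(\<integral>\<^sup>+ E. emeasure (flat_lborel E) (\<E> \<inter> E) ^ (d + 1) \<partial>\<mu>) =
    ennreal (unit_ball_vol (real k) ^ (d + 1) / unit_ball_vol (real d) ^ (k + 1) *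
      (unit_ball_vol (real (d * (k + 1))) / unit_ball_vol (real (k * (d + 1)))) *
      measure lborel \<E> ^ (k + 1))"
proof -
  note mu = assms(4)
  note [measurable] = measurable_foot_mu[OF mu] measurable_direction_mu[OF mu]
  have kd: "k \<le> CARD('n)" using assms(2) by (simp add: d_def)
  obtain A :: "real^'n^'n" and c where A: "invertible A" and \<E>: "\<E> = (\<lambda>x. A *v x + c) ` cball 0 1"
    using assms(3) by (auto simp: nondegenerate_ellipsoid_def)
  obtain T where T: "A ** T = mat 1" "T ** A = mat 1" using A by (auto simp: invertible_def)
  have iT: "invertible T" using T by (auto simp: invertible_def)
  have AT: "A *v (T *v x) = x" "T *v (A *v x) = x" for x
    by (simp_all only: matrix_vector_mul_assoc T matrix_vector_mul_lid)
  have mem: "w \<in> \<E> \<longleftrightarrow> T *v (w - c) \<in> cball 0 1" for w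
  proof
    assume "w \<in> \<E>"
    then obtain x where "x \<in> cball 0 1" "w = A *v x + c" unfolding \<E> by blast
    then show "T *v (w - c) \<in> cball 0 1" by (simp add: AT)
  next
    assume "T *v (w - c) \<in> cball 0 1"
    then have "A *v (T *v (w - c)) + c \<in> \<E>" unfolding \<E> by blast
    then show "w \<in> \<E>" by (simp add: AT)
  qed
  have [measurable]: "\<E> \<in> sets borel"
  proof -
    have "\<E> = {w. T *v (w - c) \<in> cball 0 1}" using mem by auto
    moreover have "(\<lambda>w. T *v (w - c)) -` cball 0 1 \<in> sets borel"
      by (intro measurable_sets_borel[of _ borel]) measurable
    ultimately show ?thesis by (simp add: vimage_def)
  qed
  define a where "a = \<bar>det T\<bar>"
  have a: "a > 0" using iT by (simp add: a_def invertible_det_nz)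
  let ?\<kappa> = unit_ball_vol
  have \<kappa>: "?\<kappa> (real n) > 0" for n by simp
  have vol: "measure lborel \<E> = ?\<kappa> (real d) / a"
  proof -
    have "emeasure lborel \<E> = (\<integral>\<^sup>+w. indicator (cball 0 1) (T *v (w + - c)) \<partial>lborel)"
    proof -
      have "emeasure lborel \<E> = (\<integral>\<^sup>+w. indicator \<E> w \<partial>lborel)" by simp
      also have "\<dots> = (\<integral>\<^sup>+w. indicator (cball 0 1) (T *v (w + - c)) \<partial>lborel)"
        by (intro nn_integral_cong) (simp only: indicator_def mem diff_conv_add_uminus)
      finally show ?thesis .
    qed
    also have "\<dots> = (\<integral>\<^sup>+w. indicator (cball 0 1) (T *v w) \<partial>lborel)"
      by (rule nn_integral_lborel_translate) measurable
    also have "\<dots> = ennreal (1 / a) * (\<integral>\<^sup>+w. indicator (cball 0 1) (w::real^'n) \<partial>lborel)"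
      unfolding a_def by (rule nn_integral_lborel_linear[OF iT]) measurable
    also have "\<dots> = ennreal (?\<kappa> (real d) / a)"
      using a by (simp add: emeasure_cball d_def ennreal_mult'[symmetric])
    finally show ?thesis using a by (simp add: measure_def)
  qed
  define G where "G = transpose T ** T"
  have G: "pos_def G" unfolding G_def by (rule pos_def_gram[OF iT])
  have detG: "det G = a\<^sup>2" by (simp add: G_def det_mul a_def power2_eq_square)
  define r where "r = - real CARD('n) / 2"
  \<comment> \<open>The value for the unit ball at m = d, where the dimension d - k + k (d + 1)
    simplifies to d (k + 1).\<close>
  define C where "C = ?\<kappa> (real k) ^ Suc d *
      (?\<kappa> (real (d * (k + 1))) / ?\<kappa> (real (k * Suc d)))"
  have C: "C \<ge> 0" unfolding C_def using \<kappa> by (simp add: less_imp_le)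
  have inner: "(\<integral>\<^sup>+z. ennreal (gauss (P *v z)) * section_volume \<E> P (z - P *v z) ^ Suc d \<partial>lborel) =
      ennreal (C / a) * ennreal (stretch G P powr r)"
    if P: "orth_projection P" and tr: "trace P = real k" for P
  proof -
    \<comment> \<open>T P T^(-1) has the right range but need not be symmetric, so P' is a new
      orthogonal projection onto the image. The unit ball integral sees only its trace.\<close>
    obtain P' where P': "orth_projection P'" "range ((*v) P') = (*v) T ` range ((*v) P)" "trace P' = real k"
      using orth_projection_linear_image[OF iT P] tr by metis
    have s: "stretch G P > 0" by (rule stretch_pos[OF G P])
    have "(1 / sqrt (stretch G P)) ^ d = stretch G P powr r"
    proof -
      have "stretch G P powr r = (stretch G P powr (- (1 / 2))) powr real d"
        by (simp add: powr_powr r_def d_def)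
      also have "\<dots> = (1 / sqrt (stretch G P)) powr real d"
        by (simp only: powr_minus powr_half_sqrt[OF less_imp_le[OF s]] inverse_eq_divide)
      also have "\<dots> = (1 / sqrt (stretch G P)) ^ d"
        using s by (simp add: powr_realpow)
      finally show ?thesis by (rule sym)
    qed
    then have 1: "ennreal (1 / sqrt (stretch G P)) ^ d = ennreal (stretch G P powr r)"
      using s by (simp only: ennreal_power[of "1 / sqrt (stretch G P)"] less_imp_le real_sqrt_gt_0_iff zero_le_divide_1_iff)
    have dk: "CARD('n) - k + k * Suc d = d * (k + 1)"
      using kd by (simp add: d_def algebra_simps)
    have 2: "(\<integral>\<^sup>+w. indicator (cball 0 1) w * section_volume (cball 0 1) P' w ^ d \<partial>lborel) = ennreal C"
      unfolding section_volume_power_integral_unit_ball[OF P'(1,3)] C_def dk ..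
    have "(\<integral>\<^sup>+z. ennreal (gauss (P *v z)) * section_volume \<E> P (z - P *v z) ^ Suc d \<partial>lborel) =
        (\<integral>\<^sup>+w. indicator \<E> w * section_volume \<E> P w ^ d \<partial>lborel)"
      by (rule section_volume_power_integral[OF P]) measurable
    also have "\<dots> = ennreal (1 / sqrt (stretch G P)) ^ d * ennreal (1 / \<bar>det T\<bar>) * ennreal C"
      unfolding 2[symmetric] G_def
      by (rule section_volume_power_integral_ellipsoid[OF iT P P'(1,2) mem]) measurable
    also have "\<dots> = ennreal (C / a) * ennreal (stretch G P powr r)"
      unfolding 1 using a C by (simp add: a_def[symmetric] ennreal_mult'[symmetric] mult_ac)
    finally show ?thesis .
  qed
  \<comment> \<open>The weight has total integral 1, so M is a probability measure; its image under
    \<open>direction\<close> is the \<nu> of the overview.\<close>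
  define M where "M = density \<mu> (\<lambda>E. ennreal (gauss (foot E)))"
  have spM: "space M = space \<mu>" and [measurable_cong]: "sets M = sets \<mu>" by (simp_all add: M_def)
  have M1: "emeasure M (space M) = 1"
    using nn_integral_gauss_foot[OF mu kd] by (simp add: M_def emeasure_density)
  have "finite_measure M" by (rule finite_measureI) (simp add: M1)
  interpret rotation_invariant_projection M direction "real k"
  proof (intro rotation_invariant_projection.intro rotation_invariant_projection_axioms.intro)
    show "finite_measure M" by fact
    show "direction \<in> borel_measurable M" by measurable
    show "direction E \<in> grassmannian_projections (real k)" if "E \<in> space M" for E
      using flat_mu(1,2)[OF mu] that by (simp add: grassmannian_projections_def spM)
    fix Q :: "real^'n^'n" assume Q: "rotation_matrix Q"
    show "distr M borel (\<lambda>E. Q ** direction E ** transpose Q) = distr M borel direction"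
    proof (rule measure_eqI)
      fix S assume "S \<in> sets (distr M borel (\<lambda>E. Q ** direction E ** transpose Q))"
      then have [measurable]: "S \<in> sets borel" by simp
      have em: "emeasure (distr M borel X) S = (\<integral>\<^sup>+E. ennreal (gauss (foot E)) * indicator S (X E) \<partial>\<mu>)"
        if [measurable]: "X \<in> borel_measurable \<mu>" for X :: "_ \<Rightarrow> real^'n^'n"
      proof -
        have "emeasure (distr M borel X) S = (\<integral>\<^sup>+x. indicator S x \<partial>distr M borel X)" by simp
        also have "\<dots> = (\<integral>\<^sup>+E. indicator S (X E) \<partial>M)" by (rule nn_integral_distr) measurable
        also have "\<dots> = (\<integral>\<^sup>+E. ennreal (gauss (foot E)) * indicator S (X E) \<partial>\<mu>)"
          unfolding M_def by (rule nn_integral_density) measurable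
        finally show ?thesis .
      qed
      \<comment> \<open>A rotation carries the foot of a flat to the foot of its image and preserves
        the norm, so the Gaussian weight does not disturb the invariance of \<mu>.\<close>
      have ng: "gauss (Q *v y) = gauss y" for y
      proof -
        have "orthogonal_transformation ((*v) Q)"
          using Q by (simp add: orthogonal_transformation_matrix rotation_matrix_def)
        then show ?thesis by (simp add: gauss_def orthogonal_transformation_norm)
      qed
      let ?f = "\<lambda>(P, y). ennreal (gauss y) * indicator S P"
      have [measurable]: "?f \<in> borel_measurable (borel \<Otimes>\<^sub>M borel)" by measurable
      show "emeasure (distr M borel (\<lambda>E. Q ** direction E ** transpose Q)) S = emeasure (distr M borel direction) S"
        using nn_integral_mu_rigid_motion[OF mu Q, of ?f 0] by (simp add: em ng)
    qed simp
  qed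
  have nz: "stretch G P \<noteq> 0" if "P \<in> K" for P
    using stretch_nonzero[OF G, of P] that by (simp add: grassmannian_projections_def)
  have int: "integrable M (\<lambda>E. stretch G (direction E) powr r)"
    by (rule integrable_continuous) (use nz in \<open>intro continuous_intros; auto\<close>)
  have [measurable]: "(\<lambda>E. stretch G (direction E) powr r) \<in> borel_measurable \<mu>"
    using borel_measurable_integrable[OF int] by measurable
  have "(\<integral>\<^sup>+ E. emeasure (flat_lborel E) (\<E> \<inter> E) ^ (d + 1) \<partial>\<mu>) =
      (\<integral>\<^sup>+E. (\<lambda>(P, y). section_volume \<E> P y ^ Suc d) (direction E, foot E) \<partial>\<mu>)"
    by (intro nn_integral_cong) (simp add: space_mu[OF mu] emeasure_flat_lborel)
  also have "\<dots> = (\<integral>\<^sup>+E. ennreal (gauss (foot E)) * (\<integral>\<^sup>+z. ennreal (gauss (direction E *v z)) *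
      (\<lambda>(P, y). section_volume \<E> P y ^ Suc d) (direction E, z - direction E *v z) \<partial>lborel) \<partial>\<mu>)"
    by (rule nn_integral_mu_disintegration[OF mu measurable_section_volume_pair]) measurable
  also have "\<dots> = (\<integral>\<^sup>+E. ennreal (gauss (foot E)) * (ennreal (C / a) * ennreal (stretch G (direction E) powr r)) \<partial>\<mu>)"
    using flat_mu(1,2)[OF mu] by (intro nn_integral_cong) (simp only: prod.case inner)
  also have "\<dots> = ennreal (C / a) * (\<integral>\<^sup>+E. ennreal (gauss (foot E)) * ennreal (stretch G (direction E) powr r) \<partial>\<mu>)"
    by (subst nn_integral_cmult[symmetric]) (auto simp: mult_ac)
  also have "(\<integral>\<^sup>+E. ennreal (gauss (foot E)) * ennreal (stretch G (direction E) powr r) \<partial>\<mu>) =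
      (\<integral>\<^sup>+E. ennreal (stretch G (direction E) powr r) \<partial>M)"
    unfolding M_def by (rule nn_integral_density[symmetric]) measurable
  also have "\<dots> = ennreal (LINT E|M. stretch G (direction E) powr r)"
    using int by (intro nn_integral_eq_integral) auto
  also have "(LINT E|M. stretch G (direction E) powr r) = det G powr (- real k / 2)"
    using integral_stretch[OF G] M1 by (simp add: r_def measure_def)
  also have "det G powr (- real k / 2) = 1 / a ^ k"
  proof -
    have "det G powr (- real k / 2) = (a powr 2) powr (- real k / 2)"
      unfolding detG using powr_realpow[OF a, of 2] by simp
    also have "\<dots> = a powr (- real k)" by (simp add: powr_powr)
    also have "\<dots> = 1 / a ^ k" by (simp only: powr_minus powr_realpow[OF a] inverse_eq_divide)
    finally show ?thesis .
  qed
  also have "ennreal (C / a) * ennreal (1 / a ^ k) = ennreal (C / a * (1 / a ^ k))"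
    using a C by (intro ennreal_mult[symmetric]) auto
  also have "C / a * (1 / a ^ k) = ?\<kappa> (real k) ^ (d + 1) / ?\<kappa> (real d) ^ (k + 1) *
      (?\<kappa> (real (d * (k + 1))) / ?\<kappa> (real (k * (d + 1)))) * measure lborel \<E> ^ (k + 1)"
  proof -
    \<comment> \<open>The volume of the ellipsoid is \<kappa>_d / a, so a^(-(k+1)) is its (k+1)-st
      power divided by \<kappa>_d^(k+1): one factor 1/a comes from the substitution, the other k
      from the mean stretch.\<close>
    have "?\<kappa> (real d) \<noteq> 0" using \<kappa>[of d] by linarith
    then show ?thesis
      unfolding vol C_def using a by (simp add: power_divide del: of_nat_mult of_nat_add of_nat_Suc)
  qed
  finally show ?thesis .
qed

end
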